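(* For every simple $G$-module $V_j$, \[ d^-_a(V_j)=N_a+\left.\frac{d}{dt}\right|_{t=1}\ln\frac{P_j(H_0,t)}{P_{j\otimes a}(H_0,t)},\qquad a=1,\dots,q. \] If $q=1$ the formula simplifies to \[ d^-(V_j)=d^-_1(V_j)=2\left.\frac{d}{dt}\right|_{t=1}\ln P_j(H_0,t). \]
   Context: Let $G$ be a finite group generated by orthogonal hyperplane reflections of Euclidean space $\mathbb{R}^n$, acting also on the complexification $V=\mathbb{C}^n$. Let $C_1,\dots,C_q$ be the conjugacy classes of reflections in $G$ and $N_a=|C_a|$. The algebra of $G$-invariant polynomial functions on $V$ is freely generated by homogeneous polynomials $\sigma_1,\dots,\sigma_n$; $H_0=\oplus_d H_0^d$ is the graded $G$-module of harmonic polynomials, i.e. of solutions of $\sigma_i(\partial)\phi=0$, $i=1,\dots,n$, where $\sigma_i(\partial)$ is the constant coefficient differential operator obtained by identifying $V$ with its dual via the bilinear extension of the Euclidean inner product. $V_1,\dots,V_p$ is a list of all inequivalent simple $G$-modules over $\mathbb{C}$ and $P_j(H_0,t)=\sum_{d\ge0}\dim\mathrm{Hom}_G(V_j,H_0^d)\,t^d$. For $a=1,\dots,q$, $\chi_a:G\to\{1,-1\}$ is the one-dimensional representation with $\chi_a(s)=-1$ if $s\in C_a$ and $\chi_a(s)=1$ if $s\in C_b$, $b\ne a$; the index $j\otimes a\in\{1,\dots,p\}$ is defined by $V_{j\otimes a}\cong V_j\otimes\chi_a$. Finally \[ d^-_a(V_j)=\frac{2N_a\dim(V_{j,\alpha}^-)}{\dim(V_j)},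 \] where $V_{j,\alpha}^-$ is the $(-1)$-eigenspace of any reflection $s_\alpha\in C_a$ acting on $V_j$. *)

theory Defs
  imports
    "HOL-Analysis.Analysis"
    "HOL-Algebra.Generated_Groups"
    "HOL-Library.Poly_Mapping"
    "HOL-Library.Function_Algebras"
    "Jordan_Normal_Form.Jordan_Normal_Form_Uniqueness"
begin

(* "$" is kept for real^'n; entries of JNF vectors are written vec_index. *)
no_notation Matrix.vec_index (infixl \<open>$\<close> 100)
no_notation Matrix.scalar_prod (infix \<open>\<bullet>\<close> 70)
hide_const (open) Matrix.mat Matrix.row Matrix.col Determinant.det

section \<open>Real reflection groups\<close>

type_synonym 'n rmat = "real^'n^'n"

definition reflection_matrix :: "real^'n \<Rightarrow> 'n rmat" where
  "reflection_matrix \<alpha> = matrix (\<lambda>x. x - (2 * (x \<bullet> \<alpha>) / (\<alpha> \<bullet> \<alpha>)) *\<^sub>R \<alpha>)"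

definition reflections :: "('n::finite) rmat set" where
  "reflections = {reflection_matrix \<alpha> |\<alpha>. \<alpha> \<noteq> 0}"

definition matrix_group :: "('n::finite) rmat set \<Rightarrow> 'n rmat monoid" where
  "matrix_group G = \<lparr>carrier = G, monoid.mult = (**), one = mat 1\<rparr>"

definition finite_reflection_group :: "('n::finite) rmat set \<Rightarrow> bool" where
  "finite_reflection_group G \<longleftrightarrow> finite G \<and>
     (\<exists>R \<subseteq> reflections. G = generate (matrix_group {A. orthogonal_matrix A}) R)"

definition reflection_classes :: "('n::finite) rmat set \<Rightarrow> 'n rmat set set" where
  "reflection_classes G = {{g ** s ** matrix_inv g |g. g \<in> G} |s. s \<in> G \<inter> reflections}"

section \<open>Polynomials on the complexification\<close>

text \<open>Polynomial functions on \<open>V = complex^'n\<close> are represented by formal polynomials in the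
  coordinates, \<open>Poly_Mapping.lookup p m\<close> being the coefficient of the monomial with exponent vector \<open>m\<close>;
  over an infinite field the two notions agree.\<close>

type_synonym 'n cpoly = "('n \<Rightarrow>\<^sub>0 nat) \<Rightarrow>\<^sub>0 complex"

definition pconst :: "complex \<Rightarrow> 'n cpoly" where
  "pconst c = Poly_Mapping.single 0 c"

definition pvar :: "'n \<Rightarrow> 'n cpoly" where
  "pvar i = Poly_Mapping.single (Poly_Mapping.single i 1) 1"

definition peval :: "'n cpoly \<Rightarrow> complex^('n::finite) \<Rightarrow> complex" where
  "peval p x = (\<Sum>m\<in>Poly_Mapping.keys p. Poly_Mapping.lookup p m * (\<Prod>i\<in>UNIV. (x $ i) ^ Poly_Mapping.lookup m i))"

definition psubst :: "('n \<Rightarrow> 'n cpoly) \<Rightarrow> ('n::finite) cpoly \<Rightarrow> 'n cpoly" where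
  "psubst r p = (\<Sum>m\<in>Poly_Mapping.keys p. pconst (Poly_Mapping.lookup p m) * (\<Prod>i\<in>UNIV. r i ^ Poly_Mapping.lookup m i))"

definition homogeneous :: "nat \<Rightarrow> ('n::finite) cpoly \<Rightarrow> bool" where
  "homogeneous d p \<longleftrightarrow> (\<forall>m\<in>Poly_Mapping.keys p. (\<Sum>i\<in>UNIV. Poly_Mapping.lookup m i) = d)"

text \<open>The action \<open>(g \<cdot> p)(x) = p(g\<inverse> x)\<close>; cf. lemma \<open>peval_pact\<close> below.\<close>

definition pact :: "('n::finite) rmat \<Rightarrow> 'n cpoly \<Rightarrow> 'n cpoly" where
  "pact g = psubst (\<lambda>i. \<Sum>k\<in>UNIV. pconst (of_real (matrix_inv g $ i $ k)) * pvar k)"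

definition invariants :: "('n::finite) rmat set \<Rightarrow> 'n cpoly set" where
  "invariants G = {p. \<forall>g\<in>G. pact g p = p}"

text \<open>The algebra homomorphism from the polynomial ring in \<open>'n\<close> indeterminates that sends the
  indeterminates to the \<open>\<sigma> i\<close> is an isomorphism onto the algebra of invariants.\<close>

definition freely_generates_invariants :: "('n::finite) rmat set \<Rightarrow> ('n \<Rightarrow> 'n cpoly) \<Rightarrow> bool" where
  "freely_generates_invariants G \<sigma> \<longleftrightarrow> bij_betw (psubst \<sigma>) UNIV (invariants G)"

text \<open>The constant coefficient operator \<open>\<tau>(\<partial>)\<close>. The coordinates are orthonormal, so the
  \<open>i\<close>-th coordinate becomes \<open>\<partial>/\<partial>x\<^sub>i\<close>. The scalar \<open>deriv_coeff m k\<close> is the factor in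
  \<open>\<partial>\<^sup>m x\<^sup>k = deriv_coeff m k * x\<^sup>(k-m)\<close>; it vanishes unless \<open>m \<le> k\<close> pointwise, so the truncated
  subtraction of exponents does no harm.\<close>

definition deriv_coeff :: "('n \<Rightarrow>\<^sub>0 nat) \<Rightarrow> (('n::finite) \<Rightarrow>\<^sub>0 nat) \<Rightarrow> complex" where
  "deriv_coeff m k = (\<Prod>i\<in>UNIV. \<Prod>r<Poly_Mapping.lookup m i. of_nat (Poly_Mapping.lookup k i) - of_nat r)"

definition diff_op :: "('n::finite) cpoly \<Rightarrow> 'n cpoly \<Rightarrow> 'n cpoly" where
  "diff_op \<tau> \<phi> = (\<Sum>m\<in>Poly_Mapping.keys \<tau>. \<Sum>k\<in>Poly_Mapping.keys \<phi>.
     Poly_Mapping.single (k - m) (Poly_Mapping.lookup \<tau> m * Poly_Mapping.lookup \<phi> k * deriv_coeff m k))"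

definition harmonics :: "('n \<Rightarrow> 'n cpoly) \<Rightarrow> ('n::finite) cpoly set" where
  "harmonics \<sigma> = {\<phi>. \<forall>i. diff_op (\<sigma> i) \<phi> = 0}"

definition harmonics_deg :: "('n \<Rightarrow> 'n cpoly) \<Rightarrow> nat \<Rightarrow> ('n::finite) cpoly set" where
  "harmonics_deg \<sigma> d = {\<phi> \<in> harmonics \<sigma>. homogeneous d \<phi>}"

section \<open>Finite-dimensional modules\<close>

text \<open>\<open>Gmodule m \<rho>\<close> is the space \<open>carrier_vec m\<close> of complex column vectors with \<open>g\<close> acting by the
  matrix \<open>\<rho> g\<close>. Simple modules of a finite group are finite-dimensional, so up to isomorphism
  all of them are of this form.\<close>

datatype 'g gmodule = Gmodule (gdim: nat) (gmat: "'g \<Rightarrow> complex Matrix.mat")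

definition is_gmodule :: "('n::finite) rmat set \<Rightarrow> 'n rmat gmodule \<Rightarrow> bool" where
  "is_gmodule G W \<longleftrightarrow>
     (\<forall>g\<in>G. gmat W g \<in> carrier_mat (gdim W) (gdim W)) \<and>
     gmat W (mat 1) = 1\<^sub>m (gdim W) \<and>
     (\<forall>g\<in>G. \<forall>h\<in>G. gmat W (g ** h) = gmat W g * gmat W h)"

definition simple_gmodule :: "('n::finite) rmat set \<Rightarrow> 'n rmat gmodule \<Rightarrow> bool" where
  "simple_gmodule G W \<longleftrightarrow> is_gmodule G W \<and> gdim W > 0 \<and>
     (\<forall>U. VectorSpace.subspace class_ring U (module_vec TYPE(complex) (gdim W)) \<longrightarrow>
          (\<forall>g\<in>G. \<forall>u\<in>U. gmat W g *\<^sub>v u \<in> U) \<longrightarrow>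
          U = {0\<^sub>v (gdim W)} \<or> U = carrier_vec (gdim W))"

definition gmodule_iso :: "('n::finite) rmat set \<Rightarrow> 'n rmat gmodule \<Rightarrow> 'n rmat gmodule \<Rightarrow> bool" where
  "gmodule_iso G W W' \<longleftrightarrow> gdim W = gdim W' \<and>
     (\<exists>T \<in> carrier_mat (gdim W) (gdim W). invertible_mat T \<and>
        (\<forall>g\<in>G. T * gmat W g = gmat W' g * T))"

text \<open>\<open>W \<otimes> chi\<close> for a one-dimensional \<open>chi\<close>, on the underlying space of \<open>W\<close>.\<close>

definition twist :: "'g gmodule \<Rightarrow> ('g \<Rightarrow> complex) \<Rightarrow> 'g gmodule" where
  "twist W chi = Gmodule (gdim W) (\<lambda>g. chi g \<cdot>\<^sub>m gmat W g)"

definition simple_gmodule_list ::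
    "('n::finite) rmat set \<Rightarrow> nat \<Rightarrow> (nat \<Rightarrow> 'n rmat gmodule) \<Rightarrow> bool" where
  "simple_gmodule_list G p V \<longleftrightarrow>
     (\<forall>j\<in>{1..p}. simple_gmodule G (V j)) \<and>
     (\<forall>j\<in>{1..p}. \<forall>k\<in>{1..p}. j \<noteq> k \<longrightarrow> \<not> gmodule_iso G (V j) (V k)) \<and>
     (\<forall>W. simple_gmodule G W \<longrightarrow> (\<exists>j\<in>{1..p}. gmodule_iso G W (V j)))"

text \<open>Linear maps on \<open>carrier_vec m\<close> are normalised to be \<open>0\<close> off it, which makes \<open>gmodule_hom\<close> a
  subspace of a function space with pointwise operations.\<close>

definition gmodule_hom :: "('n::finite) rmat set \<Rightarrow> 'n rmat gmodule \<Rightarrow> 'n cpoly set \<Rightarrow>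
    (complex Matrix.vec \<Rightarrow> 'n cpoly) set" where
  "gmodule_hom G W H = {f.
     (\<forall>v\<in>carrier_vec (gdim W). f v \<in> H) \<and>
     (\<forall>v. v \<notin> carrier_vec (gdim W) \<longrightarrow> f v = 0) \<and>
     (\<forall>v\<in>carrier_vec (gdim W). \<forall>w\<in>carrier_vec (gdim W). f (v + w) = f v + f w) \<and>
     (\<forall>c. \<forall>v\<in>carrier_vec (gdim W). f (c \<cdot>\<^sub>v v) = pconst c * f v) \<and>
     (\<forall>g\<in>G. \<forall>v\<in>carrier_vec (gdim W). f (gmat W g *\<^sub>v v) = pact g (f v))}"

definition fun_scale ::
    "complex \<Rightarrow> (complex Matrix.vec \<Rightarrow> 'n cpoly) \<Rightarrow> complex Matrix.vec \<Rightarrow> 'n cpoly" where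
  "fun_scale c f = (\<lambda>v. pconst c * f v)"

definition harm_mult ::
    "('n::finite) rmat set \<Rightarrow> ('n \<Rightarrow> 'n cpoly) \<Rightarrow> 'n rmat gmodule \<Rightarrow> nat \<Rightarrow> nat" where
  "harm_mult G \<sigma> W d = vector_space.dim fun_scale (gmodule_hom G W (harmonics_deg \<sigma> d))"

text \<open>\<open>P(H\<^sub>0,t)\<close>; only finitely many terms are nonzero.\<close>

definition harm_series ::
    "('n::finite) rmat set \<Rightarrow> ('n \<Rightarrow> 'n cpoly) \<Rightarrow> 'n rmat gmodule \<Rightarrow> real \<Rightarrow> real" where
  "harm_series G \<sigma> W t = suminf (\<lambda>d. real (harm_mult G \<sigma> W d) * t ^ d)"

definition reflection_character :: "('n::finite) rmat set \<Rightarrow> nat \<Rightarrow> (nat \<Rightarrow> 'n rmat set) \<Rightarrow>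
    nat \<Rightarrow> ('n rmat \<Rightarrow> complex) \<Rightarrow> bool" where
  "reflection_character G q C a chi \<longleftrightarrow>
     (\<forall>g\<in>G. chi g \<in> {1, -1}) \<and>
     (\<forall>g\<in>G. \<forall>h\<in>G. chi (g ** h) = chi g * chi h) \<and>
     (\<forall>s\<in>C a. chi s = -1) \<and>
     (\<forall>b\<in>{1..q}. b \<noteq> a \<longrightarrow> (\<forall>s\<in>C b. chi s = 1))"

text \<open>The numbers \<open>d\<^sub>a\<^sup>-\<close>, for the class \<open>K = C\<^sub>a\<close> and a chosen reflection \<open>s \<in> K\<close>;
  \<open>kernel_dim (char_matrix A (-1))\<close> is the dimension of \<open>ker (A + 1)\<close>.\<close>

definition d_minus ::
    "('n::finite) rmat set \<Rightarrow> 'n rmat \<Rightarrow> 'n rmat gmodule \<Rightarrow> real" where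
  "d_minus K s W =
     2 * real (card K) * real (kernel_dim (char_matrix (gmat W s) (-1))) / real (gdim W)"

section \<open>The polynomial operations agree with their analytic meaning\<close>

lemma cpoly_induct [case_names single add]:
  assumes "\<And>m c. P (Poly_Mapping.single m c)" and "\<And>p q. P p \<Longrightarrow> P q \<Longrightarrow> P (p + q)"
  shows "P (p :: 'n cpoly)"
proof (induction p rule: update_induct)
  case const
  show ?case using assms(1)[of 0 0] by simp
next
  case (update f a b)
  have "Poly_Mapping.update a b f = f + Poly_Mapping.single a b"
    using update by (intro poly_mapping_eqI) (auto simp: lookup_update lookup_add lookup_single in_keys_iff when_def)
  thus ?case using assms update by simp
qed

lemma peval_add: "peval (p + q) x = peval p x + peval q x"
  unfolding peval_def by (subst setsum_keys_plus_distrib) (auto simp: algebra_simps)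

lemma peval_0 [simp]: "peval 0 x = 0"
  by (simp add: peval_def)

lemma peval_sum: "peval (sum f A) x = (\<Sum>a\<in>A. peval (f a) x)"
  by (induction A rule: infinite_finite_induct) (auto simp: peval_add)

lemma peval_single: "peval (Poly_Mapping.single m c) x = c * (\<Prod>i\<in>UNIV. (x $ i) ^ Poly_Mapping.lookup m i)"
  by (simp add: peval_def)

lemma peval_mult: "peval (p * q) x = peval p x * peval q x"
proof (induction p rule: cpoly_induct)
  case (single m c)
  show ?case
    by (induction q rule: cpoly_induct)
       (auto simp: mult_single peval_single lookup_add power_add prod.distrib peval_add algebra_simps)
qed (auto simp: peval_add algebra_simps)

lemma peval_pconst [simp]: "peval (pconst c) x = c"
  by (simp add: pconst_def peval_single)

lemma peval_1 [simp]: "peval 1 x = 1"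
  using peval_pconst[of 1 x] by (simp add: pconst_def)

lemma peval_pvar [simp]: "peval (pvar i) x = x $ i"
proof -
  have "(\<Prod>j\<in>UNIV. (x $ j) ^ Poly_Mapping.lookup (Poly_Mapping.single i 1) j)
      = (\<Prod>j\<in>UNIV. if i = j then x $ j else 1)"
    by (intro prod.cong) (auto simp: lookup_single when_def)
  thus ?thesis by (simp add: pvar_def peval_single)
qed

lemma peval_power: "peval (p ^ k) x = peval p x ^ k"
  by (induction k) (auto simp: peval_mult)

lemma peval_prod: "peval (prod f A) x = (\<Prod>a\<in>A. peval (f a) x)"
  by (induction A rule: infinite_finite_induct) (auto simp: peval_mult)

lemma peval_psubst: "peval (psubst r p) x = peval p (\<chi> i. peval (r i) x)"
  unfolding psubst_def peval_sum peval_mult peval_prod peval_power peval_pconst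
  by (simp add: peval_def)

lemma peval_pact:
  "peval (pact g p) x = peval p ((\<chi> i j. of_real (matrix_inv g $ i $ j)) *v x)"
  by (simp add: pact_def peval_psubst peval_sum peval_mult matrix_vector_mult_def)

lemma diff_op_add_left: "diff_op (p + q) f = diff_op p f + diff_op q f"
  unfolding diff_op_def
  by (subst setsum_keys_plus_distrib) (auto simp: algebra_simps single_add sum.distrib)

lemma diff_op_add_right: "diff_op p (f + g) = diff_op p f + diff_op p g"
  unfolding diff_op_def sum.distrib[symmetric]
  by (intro sum.cong refl, subst setsum_keys_plus_distrib) (auto simp: algebra_simps single_add sum.distrib)

lemma diff_op_single: "diff_op (Poly_Mapping.single m a) (Poly_Mapping.single k b) =
    Poly_Mapping.single (k - m) (a * b * deriv_coeff m k)"
  by (cases "a = 0"; cases "b = 0") (auto simp: diff_op_def)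

lemma deriv_coeff_add: "deriv_coeff (m + m') k = deriv_coeff m' k * deriv_coeff m (k - m')"
proof -
  have *: "(\<Prod>r<a + b. of_nat c - of_nat r :: complex) =
      (\<Prod>r<b. of_nat c - of_nat r) * (\<Prod>r<a. of_nat (c - b) - of_nat r)" for a b c
  proof (cases "b \<le> c")
    case True
    have "(\<Prod>r<a. of_nat (c - b) - of_nat r :: complex) = (\<Prod>r<a. of_nat c - of_nat (b + r))"
      using True by (intro prod.cong) (auto simp: of_nat_diff)
    moreover have "(\<Prod>r<b + a. f r) = (\<Prod>r<b. f r) * (\<Prod>r<a. f (b + r))" for f :: "nat \<Rightarrow> complex"
      by (induction a) (auto simp: mult_ac)
    ultimately show ?thesis by (simp add: add.commute[of a])
  next
    case False
    hence "(\<Prod>r<b. of_nat c - of_nat r :: complex) = 0" "(\<Prod>r<a + b. of_nat c - of_nat r :: complex) = 0"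
      by (auto intro!: bexI[of _ c])
    thus ?thesis by (simp only: mult_zero_left)
  qed
  show ?thesis unfolding deriv_coeff_def lookup_add lookup_minus * prod.distrib ..
qed

text \<open>\<open>\<tau> \<mapsto> \<tau>(\<partial>)\<close> is multiplicative, and the \<open>i\<close>-th coordinate acts as \<open>\<partial>/\<partial>x\<^sub>i\<close>.\<close>

lemma diff_op_mult: "diff_op (p * q) f = diff_op p (diff_op q f)"
proof (induction p rule: cpoly_induct)
  case (single m a)
  show ?case
  proof (induction q rule: cpoly_induct)
    case (single m' b)
    show ?case
    proof (induction f rule: cpoly_induct)
      case (single k c)
      have "k - (m + m') = k - m' - m"
        by (intro poly_mapping_eqI) (simp add: lookup_minus lookup_add)
      thus ?case
        unfolding mult_single diff_op_single deriv_coeff_add by (simp add: mult.assoc mult.left_commute)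
    qed (simp add: diff_op_add_right)
  qed (simp add: diff_op_add_left diff_op_add_right algebra_simps)
qed (simp add: diff_op_add_left algebra_simps)

lemma diff_op_pvar:
  "((\<lambda>t. peval f (\<chi> j. if j = i then t else x $ j)) has_field_derivative
      peval (diff_op (pvar i) f) x) (at (x $ i))"
proof (induction f rule: cpoly_induct)
  case (single k c)
  have split: "(\<Prod>j\<in>UNIV. h j) = h i * (\<Prod>j\<in>UNIV - {i}. h j)" for h :: "'a \<Rightarrow> complex"
    by (simp add: prod.remove[of UNIV i])
  have dc: "deriv_coeff (Poly_Mapping.single i 1) k = of_nat (Poly_Mapping.lookup k i)"
  proof -
    have "(\<Prod>j\<in>UNIV - {i}. \<Prod>r<Poly_Mapping.lookup (Poly_Mapping.single i (1::nat)) j.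
             of_nat (Poly_Mapping.lookup k j) - of_nat r :: complex) = 1"
      by (intro prod.neutral) (auto simp: lookup_single)
    thus ?thesis unfolding deriv_coeff_def split by simp
  qed
  have e1: "peval (Poly_Mapping.single k c) (\<chi> j. if j = i then t else x $ j) =
      c * (t ^ Poly_Mapping.lookup k i * (\<Prod>j\<in>UNIV - {i}. (x $ j) ^ Poly_Mapping.lookup k j))" for t
    unfolding peval_single split by (auto intro!: prod.cong)
  have "(\<Prod>j\<in>UNIV - {i}. (x $ j) ^ Poly_Mapping.lookup (k - Poly_Mapping.single i 1) j)
      = (\<Prod>j\<in>UNIV - {i}. (x $ j) ^ Poly_Mapping.lookup k j)"
    by (intro prod.cong) (auto simp: lookup_minus lookup_single)
  hence e2: "peval (diff_op (pvar i) (Poly_Mapping.single k c)) x =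
     c * (of_nat (Poly_Mapping.lookup k i) * (x $ i) ^ (Poly_Mapping.lookup k i - 1) *
       (\<Prod>j\<in>UNIV - {i}. (x $ j) ^ Poly_Mapping.lookup k j))"
    unfolding pvar_def diff_op_single dc peval_single split by (simp add: lookup_minus)
  show ?case unfolding e1 e2 by (auto intro!: derivative_eq_intros)
qed (auto simp: peval_add diff_op_add_right intro!: derivative_intros)

lemma vector_space_fun_scale: "vector_space (fun_scale :: _ \<Rightarrow> _ \<Rightarrow> _ \<Rightarrow> 'n cpoly)"
  by unfold_locales
     (auto simp: fun_scale_def fun_eq_iff pconst_def algebra_simps single_add mult_single
        simp flip: mult.assoc)

end

theory Submission
  imports Defs "Jordan_Normal_Form.Jordan_Normal_Form_Existence"
begin

text \<open>
  Let \<open>S\<close> be the algebra of polynomials, \<open>R\<close> the algebra of invariants, \<open>H\<close> the space of harmonic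
  polynomials and \<open>n\<close> the dimension. For a module \<open>W\<close> with character \<open>\<chi>\<close> write \<open>P(t)\<close> for its graded
  multiplicity in \<open>H\<close>. Both formulas are read off from the value and the derivative of \<open>P\<close> at \<open>1\<close>:
  \<open>P(1) = dim W\<close> and \<open>P'(1) = (N dim W - \<Sum> \<chi>(s)) / 2\<close>, where \<open>s\<close> runs through the \<open>N\<close> reflections
  (lemma \<open>harm_series_at_1\<close>). Two facts give these.

  First, \<open>S = H \<otimes> R\<close> as graded modules, so that the Hilbert series of the equivariant maps from \<open>W\<close> to \<open>S\<close> is
  \<open>P\<close> times the Hilbert series of \<open>R\<close> (lemma \<open>harm_mult_convolution\<close>). The products span because \<open>H\<close> is the
  orthogonal complement, for the Fischer inner product, of the ideal generated by the invariants of
  positive degree (lemma \<open>harmonic_decomposition\<close>). They are independent by Chevalley's lemma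
  (\<open>chevalley\<close>), where it matters that the group is generated by reflections: the difference operator of
  a reflection is linear over \<open>R\<close> and lowers the degree.

  Secondly, by Molien's formula (lemmas \<open>dim_covs_deg\<close> and \<open>dim_invariants_deg\<close>) the two Hilbert series
  are averages over the group of the series \<open>\<Sum> tr(g on S\<^sub>d) t\<^sup>d\<close>, weighted by \<open>\<chi>(g)\<close> and by \<open>1\<close>. Such a
  series is the product of the \<open>1 / (1 - \<mu> t)\<close> over the eigenvalues \<open>\<mu>\<close> of \<open>g\<close>. After multiplication
  by \<open>(1 - t)\<^sup>n\<close> it takes the value \<open>1\<close> or \<open>0\<close> at \<open>t = 1\<close> according to whether \<open>g\<close> is the identity, and it has
  derivative \<open>-1/2\<close> or \<open>0\<close> there according to whether \<open>g\<close> is a reflection (lemma \<open>graded_trace_pole\<close>).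

  A reflection \<open>s\<close> acts on \<open>W\<close> as an involution, so \<open>\<chi>(s) = dim W - 2 dim W\<^sup>-\<close> (lemma \<open>gtrace_reflection\<close>).
  Twisting by \<open>\<chi>\<^sub>a\<close> changes the sign of \<open>\<chi>\<close> on the class \<open>C\<^sub>a\<close> and at no other reflection. Hence the
  logarithmic derivative of the quotient of the two multiplicities is \<open>-N\<^sub>a \<chi>(s) / dim W\<close> for \<open>s\<close> in \<open>C\<^sub>a\<close>;
  and if there is only one class, that of \<open>P\<close> is \<open>(N / 2) (1 - \<chi>(s) / dim W)\<close>.
\<close>

no_notation Matrix.vec_index (infixl \<open>$\<close> 100)
no_notation Matrix.scalar_prod (infix \<open>\<bullet>\<close> 70)
hide_const (open) Matrix.mat Matrix.row Matrix.col Determinant.det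

abbreviation "lookup \<equiv> Poly_Mapping.lookup"
abbreviation "keys \<equiv> Poly_Mapping.keys"
abbreviation "single \<equiv> Poly_Mapping.single"

section \<open>Polynomials: grading, substitution, linear changes of variables\<close>

definition mdeg :: "('n::finite \<Rightarrow>\<^sub>0 nat) \<Rightarrow> nat" where
  "mdeg m = (\<Sum>i\<in>UNIV. lookup m i)"

definition hcomp :: "nat \<Rightarrow> ('n::finite) cpoly \<Rightarrow> 'n cpoly" where
  "hcomp d p = (\<Sum>m\<in>{m\<in>keys p. mdeg m = d}. single m (lookup p m))"

lemma mdeg_add: "mdeg (m + k) = mdeg m + mdeg k"
  by (simp add: mdeg_def lookup_add sum.distrib)

lemma mdeg_0 [simp]: "mdeg 0 = 0"
  by (simp add: mdeg_def)

lemma mdeg_eq_0_iff [simp]: "mdeg m = 0 \<longleftrightarrow> m = 0"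
  by (auto simp: mdeg_def poly_mapping_eq_iff fun_eq_iff)

lemma mdeg_single [simp]: "mdeg (single i k) = k"
  by (simp add: mdeg_def lookup_single when_def)

lemma homogeneous_iff: "homogeneous d p \<longleftrightarrow> (\<forall>m. lookup p m \<noteq> 0 \<longrightarrow> mdeg m = d)"
  by (auto simp: homogeneous_def mdeg_def in_keys_iff)

lemma finite_mdeg: "finite {m :: 'n::finite \<Rightarrow>\<^sub>0 nat. mdeg m = d}"
proof -
  have "lookup ` {m :: 'n \<Rightarrow>\<^sub>0 nat. mdeg m = d} \<subseteq> PiE UNIV (\<lambda>_. {..d})"
    by (auto simp: mdeg_def intro!: member_le_sum)
  hence "finite (lookup ` {m :: 'n \<Rightarrow>\<^sub>0 nat. mdeg m = d})"
    by (rule finite_subset) (auto intro!: finite_PiE)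
  moreover have "inj_on lookup {m :: 'n \<Rightarrow>\<^sub>0 nat. mdeg m = d}"
    by (simp add: inj_on_def lookup_inject)
  ultimately show ?thesis by (rule finite_imageD)
qed

lemma lookup_pconst_mult [simp]:
  "lookup (pconst c * p) m = c * lookup p m"
  unfolding pconst_def mult_map_scale_conv_mult [symmetric] by (simp add: map.rep_eq when_def)

lemma lookup_pconst: "lookup (pconst c) m = (if m = 0 then c else 0)"
  by (simp add: pconst_def lookup_single when_def)

lemma pconst_add: "pconst (a + b) = pconst a + pconst b"
  by (simp add: pconst_def single_add)

lemma pconst_mult: "pconst (a * b) = pconst a * pconst b"
  by (simp add: pconst_def mult_single)

lemma pconst_0 [simp]: "pconst 0 = 0"
  by (simp add: pconst_def)

lemma pconst_1 [simp]: "pconst 1 = 1"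
  by (simp add: pconst_def)

lemma pconst_sum: "pconst (sum f A) = (\<Sum>a\<in>A. pconst (f a))"
  by (induction A rule: infinite_finite_induct) (auto simp: pconst_add)

lemma pconst_uminus: "pconst (- a) = - pconst a"
  by (simp add: pconst_def single_uminus)

lemma pconst_single: "pconst a * single m c = single m (a * c)"
  by (simp add: pconst_def mult_single)

lemma pconst_inverse_cancel: "c \<noteq> 0 \<Longrightarrow> pconst (inverse c) * (pconst c * p) = p"
  by (simp add: mult.assoc [symmetric] pconst_mult [symmetric])

lemma pvar_power: "pvar i ^ k = single (single i k) 1"
  by (induction k) (simp_all add: pvar_def mult_single single_add [symmetric])

lemma pvar_monomial: "(\<Prod>i\<in>UNIV. pvar i ^ lookup m i) = single (m :: 'n::finite \<Rightarrow>\<^sub>0 nat) 1"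
proof -
  have "(\<Prod>i\<in>A. pvar i ^ lookup m i)
      = single (\<Sum>i\<in>A. single i (lookup m i)) 1" if "finite A" for A
    using that by induction (simp_all add: pvar_power mult_single)
  moreover have "(\<Sum>i\<in>UNIV. single i (lookup m i)) = m"
    by (intro poly_mapping_eqI) (simp add: lookup_sum lookup_single when_def)
  ultimately show ?thesis by simp
qed

lemma single_conv_pvar:
  "single (m :: 'n::finite \<Rightarrow>\<^sub>0 nat) c = pconst c * (\<Prod>i\<in>UNIV. pvar i ^ lookup m i)"
  by (simp add: pvar_monomial pconst_single)

text \<open>It suffices to check constants and coordinates for identities that are compatible with products,
  such as the chain rule below.\<close>

lemma cpoly_ring_induct [case_names const var add mult]:
  fixes p :: "('n::finite) cpoly"
  assumes "\<And>c. P (pconst c)" "\<And>i. P (pvar i)"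
    and "\<And>p q. P p \<Longrightarrow> P q \<Longrightarrow> P (p + q)" "\<And>p q. P p \<Longrightarrow> P q \<Longrightarrow> P (p * q)"
  shows "P p"
proof (induction p rule: cpoly_induct)
  case (single m c)
  have 1: "P 1" using assms(1)[of 1] by simp
  have "P (pvar i ^ k)" for i k
    by (induction k) (auto intro: assms(2,4) 1)
  hence "P (\<Prod>i\<in>A. pvar i ^ lookup m i)" for A
    by (induction A rule: infinite_finite_induct) (auto intro: assms(4) 1)
  thus ?case unfolding single_conv_pvar by (intro assms(1,4))
qed (rule assms(3))

lemma psubst_single:
  "psubst r (single m c) = pconst c * (\<Prod>i\<in>UNIV. r i ^ lookup m i)"
  by (simp add: psubst_def)

lemma psubst_add: "psubst r (p + q) = psubst r p + psubst r q"
  unfolding psubst_def by (subst setsum_keys_plus_distrib) (auto simp: pconst_add algebra_simps)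

lemma psubst_0 [simp]: "psubst r 0 = 0"
  by (simp add: psubst_def)

lemma psubst_pconst [simp]: "psubst r (pconst c) = pconst c"
  by (simp add: pconst_def psubst_single)

lemma psubst_1 [simp]: "psubst r 1 = 1"
  using psubst_pconst[of r 1] by simp

lemma psubst_mult: "psubst r (p * q) = psubst r p * psubst r q"
proof (induction p rule: cpoly_induct)
  case (single m c)
  show ?case
    by (induction q rule: cpoly_induct)
       (auto simp: mult_single psubst_single lookup_add power_add prod.distrib psubst_add
          pconst_mult algebra_simps)
qed (auto simp: psubst_add algebra_simps)

lemma psubst_sum: "psubst r (sum f A) = (\<Sum>a\<in>A. psubst r (f a))"
  by (induction A rule: infinite_finite_induct) (auto simp: psubst_add)

lemma psubst_prod: "psubst r (prod f A) = (\<Prod>a\<in>A. psubst r (f a))"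
  by (induction A rule: infinite_finite_induct) (auto simp: psubst_mult)

lemma psubst_uminus: "psubst r (- p) = - psubst r p"
  using psubst_add[of r p "-p"] by (simp add: add_eq_0_iff)

lemma psubst_diff: "psubst r (p - q) = psubst r p - psubst r q"
  using psubst_add[of r p "-q"] by (simp add: psubst_uminus)

lemma psubst_pvar [simp]: "psubst r (pvar i) = r i"
proof -
  have "(\<Prod>j\<in>UNIV. r j ^ lookup (single i 1) j)
      = (\<Prod>j\<in>UNIV. if i = j then r j else 1)"
    by (intro prod.cong) (auto simp: lookup_single when_def)
  thus ?thesis by (simp add: pvar_def psubst_single)
qed

lemma psubst_psubst: "psubst r (psubst r' p) = psubst (\<lambda>i. psubst r (r' i)) p"
  by (induction p rule: cpoly_ring_induct) (auto simp: psubst_add psubst_mult)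

lemma psubst_id: "psubst pvar p = p"
  by (induction p rule: cpoly_ring_induct) (auto simp: psubst_add psubst_mult)

subsection \<open>Homogeneous polynomials\<close>

lemma cpoly_expand:
  "p = (\<Sum>m\<in>keys p. single m (lookup p m))"
proof (intro poly_mapping_eqI)
  fix k
  have "(\<Sum>m\<in>keys p. lookup (single m (lookup p m)) k)
      = (\<Sum>m\<in>keys p. if m = k then lookup p k else 0)"
    by (intro sum.cong) (auto simp: lookup_single when_def)
  thus "lookup p k = lookup (\<Sum>m\<in>keys p.
      single m (lookup p m)) k"
    by (simp add: lookup_sum in_keys_iff)
qed

lemma homogeneous_0 [simp]: "homogeneous d 0"
  by (simp add: homogeneous_iff)

lemma homogeneous_add: "homogeneous d p \<Longrightarrow> homogeneous d q \<Longrightarrow> homogeneous d (p + q)"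
  unfolding homogeneous_iff lookup_add by (metis add.right_neutral)

lemma homogeneous_sum: "(\<And>a. a \<in> A \<Longrightarrow> homogeneous d (f a)) \<Longrightarrow> homogeneous d (sum f A)"
  by (induction A rule: infinite_finite_induct) (auto intro: homogeneous_add)

lemma homogeneous_mult:
  assumes "homogeneous d p" "homogeneous e q"
  shows "homogeneous (d + e) (p * q)"
  unfolding homogeneous_def
proof
  fix m assume "m \<in> keys (p * q)"
  then obtain a b where "m = a + b" "a \<in> keys p" "b \<in> keys q"
    using keys_mult[of p q] by auto
  thus "(\<Sum>i\<in>UNIV. lookup m i) = d + e"
    using assms mdeg_add[of a b] by (auto simp: homogeneous_def mdeg_def)
qed

lemma homogeneous_pconst [simp]: "homogeneous 0 (pconst c)"
  by (auto simp: homogeneous_iff lookup_pconst)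

lemma homogeneous_1 [simp]: "homogeneous 0 1"
  using homogeneous_pconst[of 1] by simp

lemma homogeneous_pconst_mult: "homogeneous d p \<Longrightarrow> homogeneous d (pconst c * p)"
  using homogeneous_mult[OF homogeneous_pconst, of d p] by simp

lemma homogeneous_uminus: "homogeneous d p \<Longrightarrow> homogeneous d (- p)"
  by (simp add: homogeneous_iff)

lemma homogeneous_diff: "homogeneous d p \<Longrightarrow> homogeneous d q \<Longrightarrow> homogeneous d (p - q)"
  using homogeneous_add[of d p "- q"] by (simp add: homogeneous_uminus)

lemma homogeneous_single: "homogeneous (mdeg m) (single m c)"
  by (auto simp: homogeneous_iff lookup_single when_def split: if_splits)

lemma homogeneous_pvar [simp]: "homogeneous 1 (pvar i)"
  using homogeneous_single[of "single i 1" 1] by (simp add: pvar_def)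

lemma homogeneous_power: "homogeneous d p \<Longrightarrow> homogeneous (k * d) (p ^ k)"
  by (induction k) (auto intro: homogeneous_mult)

lemma homogeneous_prod:
  "(\<And>a. a \<in> A \<Longrightarrow> homogeneous (d a) (f a)) \<Longrightarrow> homogeneous (sum d A) (prod f A)"
  by (induction A rule: infinite_finite_induct) (auto intro: homogeneous_mult)

lemma homogeneous_0_imp_pconst:
  assumes "homogeneous 0 p"
  shows "p = pconst (lookup p 0)"
  using assms by (intro poly_mapping_eqI) (auto simp: homogeneous_iff lookup_pconst)

lemma lookup_hcomp:
  "lookup (hcomp d p) m = (if mdeg m = d then lookup p m else 0)"
proof -
  have "lookup (hcomp d p) m
      = (\<Sum>k\<in>{k\<in>keys p. mdeg k = d}. if k = m then lookup p m else 0)"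
    unfolding hcomp_def lookup_sum by (intro sum.cong) (auto simp: lookup_single when_def)
  also have "\<dots> = (if mdeg m = d then lookup p m else 0)"
    by (subst sum.delta) (auto simp: in_keys_iff)
  finally show ?thesis .
qed

lemma homogeneous_hcomp [simp]: "homogeneous d (hcomp d p)"
  by (auto simp: homogeneous_iff lookup_hcomp)

lemma hcomp_add: "hcomp d (p + q) = hcomp d p + hcomp d q"
  by (intro poly_mapping_eqI) (simp add: lookup_hcomp lookup_add)

lemma hcomp_0 [simp]: "hcomp d 0 = 0"
  by (simp add: hcomp_def)

lemma hcomp_sum: "hcomp d (sum f A) = (\<Sum>a\<in>A. hcomp d (f a))"
  by (induction A rule: infinite_finite_induct) (auto simp: hcomp_add)

lemma hcomp_homogeneous: "homogeneous e p \<Longrightarrow> hcomp d p = (if d = e then p else 0)"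
  by (intro poly_mapping_eqI) (auto simp: lookup_hcomp homogeneous_iff)

lemma sum_hcomp:
  assumes "\<And>m. m \<in> keys p \<Longrightarrow> mdeg m \<le> D"
  shows "p = (\<Sum>d\<le>D. hcomp d p)"
proof (intro poly_mapping_eqI)
  fix m
  have "mdeg m \<le> D" if "lookup p m \<noteq> 0"
    using assms[of m] that by (simp add: in_keys_iff)
  thus "lookup p m = lookup (\<Sum>d\<le>D. hcomp d p) m"
    unfolding lookup_sum lookup_hcomp by (subst sum.delta') auto
qed

lemma hcomp_mult_homogeneous:
  assumes "homogeneous e q"
  shows "hcomp d (p * q) = (if e \<le> d then hcomp (d - e) p * q else 0)"
proof -
  define D where "D = (\<Sum>m\<in>keys p. mdeg m)"
  have D: "mdeg m \<le> D" if "m \<in> keys p" for m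
    unfolding D_def by (intro member_le_sum that) auto
  have "hcomp d (p * q) = (\<Sum>k\<le>D. hcomp d (hcomp k p * q))"
    by (subst sum_hcomp[OF D]) (auto simp: sum_distrib_right hcomp_sum)
  also have "\<dots> = (\<Sum>k\<le>D. if d = k + e then hcomp k p * q else 0)"
    using assms by (intro sum.cong refl hcomp_homogeneous homogeneous_mult) auto
  also have "\<dots> = (\<Sum>k\<le>D. if e \<le> d \<and> k = d - e then hcomp (d - e) p * q else 0)"
    by (intro sum.cong) auto
  also have "\<dots> = (if e \<le> d then hcomp (d - e) p * q else 0)"
  proof (cases "d - e \<le> D")
    case False
    hence "hcomp (d - e) p = 0"
      using D by (intro poly_mapping_eqI) (metis in_keys_iff lookup_hcomp lookup_zero)
    thus ?thesis by simp
  qed auto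
  finally show ?thesis .
qed

subsection \<open>Linear changes of variables\<close>

text \<open>The polynomial \<open>x \<mapsto> p(A x)\<close>; composition therefore reverses the order of the matrices.\<close>

definition lsubst :: "complex^'n^'n \<Rightarrow> ('n::finite) cpoly \<Rightarrow> 'n cpoly" where
  "lsubst A = psubst (\<lambda>i. \<Sum>k\<in>UNIV. pconst (A $ i $ k) * pvar k)"

definition cmat :: "('n::finite) rmat \<Rightarrow> complex^'n^'n" where
  "cmat g = (\<chi> i j. of_real (g $ i $ j))"

lemma cmat_mult: "cmat (g ** h) = cmat g ** cmat h"
  by (simp add: cmat_def matrix_matrix_mult_def Finite_Cartesian_Product.vec_eq_iff)

lemma cmat_1 [simp]: "cmat (mat 1) = mat 1"
  by (simp add: cmat_def Finite_Cartesian_Product.mat_def Finite_Cartesian_Product.vec_eq_iff)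

lemma pact_conv_lsubst: "pact g = lsubst (cmat (matrix_inv g))"
  by (simp add: pact_def lsubst_def cmat_def)

lemma lsubst_pvar: "lsubst A (pvar i) = (\<Sum>k\<in>UNIV. pconst (A $ i $ k) * pvar k)"
  by (simp add: lsubst_def)

lemma lsubst_add: "lsubst A (p + q) = lsubst A p + lsubst A q"
  and lsubst_mult: "lsubst A (p * q) = lsubst A p * lsubst A q"
  and lsubst_0 [simp]: "lsubst A 0 = 0"
  and lsubst_1 [simp]: "lsubst A 1 = 1"
  and lsubst_pconst [simp]: "lsubst A (pconst c) = pconst c"
  and lsubst_diff: "lsubst A (p - q) = lsubst A p - lsubst A q"
  and lsubst_sum: "lsubst A (sum f I) = (\<Sum>i\<in>I. lsubst A (f i))"
  and lsubst_prod: "lsubst A (prod f I) = (\<Prod>i\<in>I. lsubst A (f i))"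
  by (simp_all add: lsubst_def psubst_add psubst_mult psubst_diff psubst_sum psubst_prod)

lemma lsubst_lsubst: "lsubst A (lsubst B p) = lsubst (B ** A) p"
proof -
  have "(\<Sum>k\<in>UNIV. pconst (B $ i $ k) * (\<Sum>l\<in>UNIV. pconst (A $ k $ l) * pvar l))
      = (\<Sum>l\<in>UNIV. pconst ((B ** A) $ i $ l) * pvar l)" for i
    unfolding sum_distrib_left
    by (subst sum.swap)
       (simp add: matrix_matrix_mult_def pconst_sum pconst_mult sum_distrib_right mult.assoc)
  thus ?thesis
    unfolding lsubst_def psubst_psubst by (simp add: psubst_sum psubst_mult)
qed

lemma lsubst_mat_1 [simp]: "lsubst (mat 1) p = p"
proof -
  have "(\<Sum>k\<in>UNIV. pconst ((mat 1 :: complex^'a^'a) $ i $ k) * pvar k) = pvar i" for i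
  proof -
    have "(\<Sum>k\<in>UNIV. pconst ((mat 1 :: complex^'a^'a) $ i $ k) * pvar k)
        = (\<Sum>k\<in>UNIV. if i = k then pvar k else 0)"
      by (intro sum.cong) (auto simp: Finite_Cartesian_Product.mat_def)
    thus ?thesis by simp
  qed
  thus ?thesis by (simp add: lsubst_def psubst_id)
qed

lemma homogeneous_lsubst:
  assumes "homogeneous d p"
  shows "homogeneous d (lsubst A p)"
proof -
  have "homogeneous (mdeg m) (lsubst A (single m c))" for m c
  proof -
    have "homogeneous (\<Sum>i\<in>UNIV. lookup m i * 1)
        (\<Prod>i\<in>UNIV. (\<Sum>k\<in>UNIV. pconst (A $ i $ k) * pvar k) ^ lookup m i)"
      by (intro homogeneous_prod homogeneous_power homogeneous_sum homogeneous_pconst_mult homogeneous_pvar)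
    thus ?thesis
      unfolding lsubst_def psubst_single by (intro homogeneous_pconst_mult) (simp add: mdeg_def)
  qed
  hence "homogeneous d (\<Sum>m\<in>keys p. lsubst A (single m (lookup p m)))"
    using assms by (intro homogeneous_sum) (metis homogeneous_def mdeg_def)
  thus ?thesis
    by (subst cpoly_expand) (simp add: lsubst_sum)
qed

section \<open>Reflection groups and their invariants\<close>

lemma matrix_inv_unique:
  fixes A B :: "'n::finite rmat"
  assumes "A ** B = mat 1"
  shows "matrix_inv A = B"
proof -
  have "A ** B = mat 1 \<and> B ** A = mat 1"
    using assms matrix_left_right_inverse[of A B] by simp
  hence "A ** matrix_inv A = mat 1 \<and> matrix_inv A ** A = mat 1"
    unfolding matrix_inv_def by (rule someI)
  hence "matrix_inv A = matrix_inv A ** (A ** B)" using assms by simp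
  also have "\<dots> = B"
    using \<open>A ** matrix_inv A = mat 1 \<and> matrix_inv A ** A = mat 1\<close>
    by (simp add: matrix_mul_assoc)
  finally show ?thesis .
qed

lemma matrix_inv_orthogonal:
  "orthogonal_matrix (A :: 'n::finite rmat) \<Longrightarrow> matrix_inv A = Finite_Cartesian_Product.transpose A"
  by (intro matrix_inv_unique) (simp add: orthogonal_matrix_def)

lemma reflection_matrix_nth:
  "reflection_matrix \<alpha> $ i $ j = (if i = j then 1 else 0) - 2 * \<alpha> $ i * \<alpha> $ j / (\<alpha> \<bullet> \<alpha>)"
  by (simp add: reflection_matrix_def matrix_def inner_axis') (auto simp: axis_def)

lemma transpose_reflection_matrix:
  "Finite_Cartesian_Product.transpose (reflection_matrix \<alpha>) = reflection_matrix \<alpha>"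
  by (auto simp: Finite_Cartesian_Product.transpose_def Finite_Cartesian_Product.vec_eq_iff reflection_matrix_nth)

lemma reflection_matrix_square:
  assumes "\<alpha> \<noteq> 0"
  shows "reflection_matrix \<alpha> ** reflection_matrix \<alpha> = mat 1"
proof -
  define f where "f x = x - (2 * (x \<bullet> \<alpha>) / (\<alpha> \<bullet> \<alpha>)) *\<^sub>R \<alpha>" for x
  have lin: "linear f"
    by (intro linearI) (simp_all add: f_def inner_simps add_divide_distrib algebra_simps)
  have "f x \<bullet> \<alpha> = - (x \<bullet> \<alpha>)" for x
    using assms by (simp add: f_def inner_simps)
  hence "f (f x) = x" for x
    by (simp add: f_def[of "f x"]) (simp add: f_def)
  hence "f \<circ> f = id" by auto
  thus ?thesis
    using matrix_compose[OF lin lin] by (simp add: reflection_matrix_def f_def[abs_def] matrix_id_mat_1)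
qed

lemma reflectionsE:
  assumes "s \<in> reflections"
  obtains \<alpha> where "\<alpha> \<noteq> 0" "s = reflection_matrix \<alpha>"
  using assms by (auto simp: reflections_def)

lemma reflection_square: "s \<in> reflections \<Longrightarrow> s ** s = mat 1"
  by (auto simp: reflections_def reflection_matrix_square)

lemma reflection_orthogonal: "s \<in> reflections \<Longrightarrow> orthogonal_matrix s"
  by (auto simp: reflections_def orthogonal_matrix_def transpose_reflection_matrix reflection_matrix_square)

lemma matrix_inv_reflection: "s \<in> reflections \<Longrightarrow> matrix_inv s = s"
  by (intro matrix_inv_unique reflection_square)

locale reflection_group =
  fixes G :: "('n::finite) rmat set"
  assumes reflection_group: "finite_reflection_group G"
begin

lemma finite_G [simp]: "finite G"
  using reflection_group by (simp add: finite_reflection_group_def)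

lemma one_in_G [simp]: "mat 1 \<in> G"
  using reflection_group generate.one[of "matrix_group {A. orthogonal_matrix A}"]
  by (auto simp: finite_reflection_group_def matrix_group_def)

lemma mult_in_G [simp]: "g \<in> G \<Longrightarrow> h \<in> G \<Longrightarrow> g ** h \<in> G"
  using reflection_group generate.eng[of _ "matrix_group {A. orthogonal_matrix A}"]
  by (auto simp: finite_reflection_group_def matrix_group_def)

text \<open>Reflections are their own inverses, so the elements of the group are products of reflections that
  belong to it.\<close>

lemma G_induct [consumes 1, case_names one reflection mult]:
  assumes "g \<in> G" "P (mat 1)" "\<And>s. s \<in> G \<inter> reflections \<Longrightarrow> P s"
    and mult: "\<And>g h. g \<in> G \<Longrightarrow> h \<in> G \<Longrightarrow> P g \<Longrightarrow> P h \<Longrightarrow> P (g ** h)"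
  shows "P g"
proof -
  define M where "M = matrix_group {A :: 'n rmat. orthogonal_matrix A}"
  obtain R where R: "R \<subseteq> reflections" "G = generate M R"
    using reflection_group unfolding finite_reflection_group_def M_def by auto
  have RG: "R \<subseteq> G" using R generate.incl[of _ R M] by auto
  have inv: "inv\<^bsub>M\<^esub> s = s" if "s \<in> R" for s
  proof -
    have s: "s \<in> reflections" using that R by auto
    show ?thesis unfolding m_inv_def
    proof (rule the_equality)
      fix y assume "y \<in> carrier M \<and> s \<otimes>\<^bsub>M\<^esub> y = \<one>\<^bsub>M\<^esub> \<and> y \<otimes>\<^bsub>M\<^esub> s = \<one>\<^bsub>M\<^esub>"
      hence "s ** y = mat 1" by (simp add: M_def matrix_group_def)
      thus "y = s" using matrix_inv_unique[of s y] matrix_inv_reflection[OF s] by simp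
    qed (use s in \<open>auto simp: M_def matrix_group_def reflection_square reflection_orthogonal\<close>)
  qed
  have "g \<in> generate M R" using assms(1) R by simp
  hence "g \<in> G \<and> P g"
  proof induction
    case one
    thus ?case using assms(2) by (simp add: M_def matrix_group_def)
  next
    case (incl h) thus ?case using assms(3) R RG by auto
  next
    case (inv h) thus ?case using assms(3) R RG \<open>h \<in> R \<Longrightarrow> inv\<^bsub>M\<^esub> h = h\<close> by auto
  next
    case (eng h1 h2) thus ?case using mult by (simp add: M_def matrix_group_def)
  qed
  thus ?thesis by simp
qed

lemma orthogonal_G: "g \<in> G \<Longrightarrow> orthogonal_matrix g"
  by (induction rule: G_induct)
     (auto simp: reflection_orthogonal orthogonal_matrix_mul orthogonal_matrix_id)

lemma matrix_inv_G:
  assumes "g \<in> G"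
  shows "matrix_inv g ** g = mat 1" "g ** matrix_inv g = mat 1"
  using orthogonal_G[OF assms] by (auto simp: matrix_inv_orthogonal orthogonal_matrix_def)

lemma matrix_inv_mult_G:
  assumes "g \<in> G" "h \<in> G"
  shows "matrix_inv (g ** h) = matrix_inv h ** matrix_inv g"
proof (rule matrix_inv_unique)
  have "g ** h ** (matrix_inv h ** matrix_inv g) = g ** (h ** matrix_inv h) ** matrix_inv g"
    by (simp only: matrix_mul_assoc)
  thus "g ** h ** (matrix_inv h ** matrix_inv g) = mat 1"
    using assms by (simp add: matrix_inv_G)
qed

lemma inv_in_G [simp]: "g \<in> G \<Longrightarrow> matrix_inv g \<in> G"
proof (induction rule: G_induct)
  case one
  show ?case using matrix_inv_unique[of "mat 1" "mat 1 :: 'n rmat"] by simp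
qed (simp_all add: matrix_inv_reflection matrix_inv_mult_G)

lemma inv_inv_G [simp]: "g \<in> G \<Longrightarrow> matrix_inv (matrix_inv g) = g"
  by (intro matrix_inv_unique matrix_inv_G)

lemma G_nonempty [simp]: "G \<noteq> {}"
  using one_in_G by blast

lemma card_G_neq_0 [simp]: "of_nat (card G) \<noteq> (0 :: complex)"
  by simp

lemma bij_betw_mult_left: "h \<in> G \<Longrightarrow> bij_betw (\<lambda>g. h ** g) G G"
  by (rule bij_betwI[where g = "\<lambda>g. matrix_inv h ** g"])
     (auto simp: matrix_mul_assoc matrix_inv_G)

lemma bij_betw_inv: "bij_betw matrix_inv G G"
  by (rule bij_betwI[where g = matrix_inv]) auto

end

subsection \<open>The action on polynomials\<close>

lemma pact_add: "pact g (p + q) = pact g p + pact g q"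
  and pact_mult: "pact g (p * q) = pact g p * pact g q"
  and pact_0 [simp]: "pact g 0 = 0"
  and pact_pconst [simp]: "pact g (pconst c) = pconst c"
  and pact_diff: "pact g (p - q) = pact g p - pact g q"
  and pact_sum: "pact g (sum f I) = (\<Sum>i\<in>I. pact g (f i))"
  and pact_prod: "pact g (prod f I) = (\<Prod>i\<in>I. pact g (f i))"
  and homogeneous_pact: "homogeneous d p \<Longrightarrow> homogeneous d (pact g p)"
  by (simp_all add: pact_conv_lsubst lsubst_add lsubst_mult lsubst_diff lsubst_sum lsubst_prod
        homogeneous_lsubst)

lemma invariants_pconst [simp]: "pconst c \<in> invariants G"
  and invariants_0 [simp]: "0 \<in> invariants G"
  and invariants_1 [simp]: "1 \<in> invariants G"
  and invariants_add: "u \<in> invariants G \<Longrightarrow> v \<in> invariants G \<Longrightarrow> u + v \<in> invariants G"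
  and invariants_mult: "u \<in> invariants G \<Longrightarrow> v \<in> invariants G \<Longrightarrow> u * v \<in> invariants G"
  using pact_pconst[of _ 1] by (auto simp: invariants_def pact_add pact_mult)

context reflection_group
begin

lemma pact_one [simp]: "pact (mat 1) p = p"
  by (simp add: pact_conv_lsubst matrix_inv_unique[of "mat 1" "mat 1"])

lemma pact_pact: "g \<in> G \<Longrightarrow> h \<in> G \<Longrightarrow> pact g (pact h p) = pact (g ** h) p"
  by (simp add: pact_conv_lsubst lsubst_lsubst matrix_inv_mult_G cmat_mult)

text \<open>The Reynolds operator.\<close>

definition avg :: "'n cpoly \<Rightarrow> 'n cpoly" where
  "avg p = pconst (1 / of_nat (card G)) * (\<Sum>g\<in>G. pact g p)"

lemma avg_invariant: "avg p \<in> invariants G"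
  unfolding invariants_def
proof clarify
  fix h assume h: "h \<in> G"
  have "(\<Sum>g\<in>G. pact (h ** g) p) = (\<Sum>g\<in>G. pact g p)"
    by (rule sum.reindex_bij_betw[OF bij_betw_mult_left[OF h]])
  thus "pact h (avg p) = avg p"
    using h by (simp add: avg_def pact_mult pact_sum pact_pact)
qed

lemma avg_invariant_mult: "u \<in> invariants G \<Longrightarrow> avg (p * u) = avg p * u"
  by (simp add: avg_def pact_mult invariants_def sum_distrib_right mult.assoc)

lemma avg_sum: "avg (sum f A) = (\<Sum>a\<in>A. avg (f a))"
  unfolding avg_def by (simp add: pact_sum sum_distrib_left) (subst sum.swap, rule refl)

lemma avg_pconst: "avg (pconst c) = pconst c"
proof -
  have "avg (pconst c) = pconst (1 / of_nat (card G)) * (\<Sum>g\<in>G. pconst c)"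
    by (simp add: avg_def del: sum_constant)
  also have "\<dots> = pconst c"
    unfolding pconst_sum [symmetric] pconst_mult [symmetric] by simp
  finally show ?thesis .
qed

lemma avg_0 [simp]: "avg 0 = 0"
  by (simp add: avg_def)

lemma homogeneous_avg: "homogeneous d p \<Longrightarrow> homogeneous d (avg p)"
  unfolding avg_def by (intro homogeneous_pconst_mult homogeneous_sum homogeneous_pact)

end

section \<open>The ideal generated by the basic invariants\<close>

lemma lookup_mult_zero:
  fixes p q :: "('n::finite) cpoly"
  shows "lookup (p * q) 0 = lookup p 0 * lookup q 0"
proof (induction p rule: cpoly_induct)
  case (single m c)
  show ?case
  proof (induction q rule: cpoly_induct)
    case (single k d)
    have "m + k = 0 \<longleftrightarrow> m = 0 \<and> k = 0"
      using mdeg_add[of m k] by (metis add_eq_0_iff_both_eq_0 mdeg_eq_0_iff)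
    thus ?case by (auto simp: mult_single lookup_single when_def)
  qed (simp add: lookup_add algebra_simps)
qed (simp add: lookup_add algebra_simps)

lemma single_Suc_neq_0 [simp]: "single (i :: 'n::finite) (Suc k) \<noteq> 0"
  using mdeg_single[of i "Suc k"] by force

locale basic_invariants = reflection_group G for G :: "('n::finite) rmat set" +
  fixes \<sigma> :: "'n \<Rightarrow> 'n cpoly"
  assumes homogeneous_generators: "\<exists>d. homogeneous d (\<sigma> i)"
    and free_generators: "freely_generates_invariants G \<sigma>"
begin

lemma invariants_eq_range: "invariants G = range (psubst \<sigma>)"
  using free_generators by (simp add: freely_generates_invariants_def bij_betw_def)

lemma inj_psubst: "psubst \<sigma> p = psubst \<sigma> q \<Longrightarrow> p = q"
  using free_generators by (auto simp: freely_generates_invariants_def bij_betw_def dest: injD)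

lemma generator_invariant [simp]: "\<sigma> i \<in> invariants G"
  unfolding invariants_eq_range by (metis psubst_pvar rangeI)

text \<open>A generator with a nonzero constant term would be constant by homogeneity, hence the image of a
  constant as well as of an indeterminate.\<close>

lemma lookup_generator_zero [simp]: "lookup (\<sigma> i) 0 = 0"
proof (rule ccontr)
  assume nz: "lookup (\<sigma> i) 0 \<noteq> 0"
  obtain d where d: "homogeneous d (\<sigma> i)" using homogeneous_generators by blast
  with nz have "d = 0" by (auto simp: homogeneous_iff)
  with d obtain c where c: "\<sigma> i = pconst c" using homogeneous_0_imp_pconst by blast
  have "psubst \<sigma> (pvar i) = psubst \<sigma> (pconst c)" using c by simp
  hence "pvar i = pconst c" by (rule inj_psubst)
  hence "lookup (pvar i) (single i 1)
      = lookup (pconst c) (single i 1)" by simp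
  thus False by (simp add: pvar_def lookup_pconst split: if_splits)
qed

text \<open>Generators are nonzero by injectivity, so this choice of a degree is the only possible one.\<close>

definition gdeg :: "'n \<Rightarrow> nat" where
  "gdeg i = (SOME d. homogeneous d (\<sigma> i))"

lemma homogeneous_generator: "homogeneous (gdeg i) (\<sigma> i)"
  unfolding gdeg_def by (rule someI_ex) (rule homogeneous_generators)

lemma gdeg_pos: "0 < gdeg i"
proof (rule ccontr)
  assume "\<not> 0 < gdeg i"
  hence "\<sigma> i = pconst 0"
    using homogeneous_generator[of i] homogeneous_0_imp_pconst[of "\<sigma> i"] by simp
  hence "psubst \<sigma> (pvar i) = psubst \<sigma> 0" by simp
  hence "pvar i = 0" by (rule inj_psubst)
  thus False by (metis lookup_single_eq lookup_zero pvar_def zero_neq_one)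
qed

text \<open>By lemma \<open>invariant_in_pos_ideal\<close> below this is the ideal generated by all invariants
  without constant term.\<close>

definition pos_ideal :: "'n cpoly set" where
  "pos_ideal = {\<Sum>i\<in>UNIV. \<sigma> i * a i |a. True}"

lemma pos_idealI: "p = (\<Sum>i\<in>UNIV. \<sigma> i * a i) \<Longrightarrow> p \<in> pos_ideal"
  by (auto simp: pos_ideal_def)

lemma pos_idealE:
  assumes "p \<in> pos_ideal"
  obtains a where "p = (\<Sum>i\<in>UNIV. \<sigma> i * a i)"
  using assms by (auto simp: pos_ideal_def)

lemma pos_ideal_0 [simp]: "0 \<in> pos_ideal"
  by (rule pos_idealI[where a = "\<lambda>_. 0"]) simp

lemma pos_ideal_add: "p \<in> pos_ideal \<Longrightarrow> q \<in> pos_ideal \<Longrightarrow> p + q \<in> pos_ideal"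
  by (elim pos_idealE, rule pos_idealI[where a = "\<lambda>i. _ i + _ i"])
     (simp add: distrib_left sum.distrib)

lemma pos_ideal_mult: "p \<in> pos_ideal \<Longrightarrow> p * q \<in> pos_ideal"
  by (elim pos_idealE, rule pos_idealI[where a = "\<lambda>i. _ i * q"])
     (simp add: sum_distrib_right mult.assoc)

lemma pos_ideal_mult_left: "p \<in> pos_ideal \<Longrightarrow> q * p \<in> pos_ideal"
  using pos_ideal_mult[of p q] by (simp add: mult.commute)

lemma pos_ideal_uminus: "p \<in> pos_ideal \<Longrightarrow> - p \<in> pos_ideal"
  using pos_ideal_mult[of p "- 1"] by simp

lemma pos_ideal_sum: "(\<And>a. a \<in> A \<Longrightarrow> f a \<in> pos_ideal) \<Longrightarrow> sum f A \<in> pos_ideal"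
  by (induction A rule: infinite_finite_induct) (auto intro: pos_ideal_add)

lemma generator_in_pos_ideal: "\<sigma> i \<in> pos_ideal"
proof (rule pos_idealI)
  have "(\<Sum>j\<in>UNIV. \<sigma> j * (if j = i then 1 else 0)) = (\<Sum>j\<in>UNIV. if j = i then \<sigma> j else 0)"
    by (intro sum.cong) auto
  thus "\<sigma> i = (\<Sum>j\<in>UNIV. \<sigma> j * (if j = i then 1 else 0))" by simp
qed

lemma pact_pos_ideal: "g \<in> G \<Longrightarrow> p \<in> pos_ideal \<Longrightarrow> pact g p \<in> pos_ideal"
  using generator_invariant
  by (elim pos_idealE, intro pos_idealI[where a = "\<lambda>i. pact g (_ i)"])
     (simp add: pact_sum pact_mult invariants_def)

lemma lookup_pos_ideal_zero: "p \<in> pos_ideal \<Longrightarrow> lookup p 0 = 0"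
  by (elim pos_idealE) (simp add: lookup_sum lookup_mult_zero)

text \<open>An invariant is a polynomial in the generators, which vanish modulo the ideal; so it is congruent to
  its constant term.\<close>

lemma invariant_in_pos_ideal:
  assumes "u \<in> invariants G" "lookup u 0 = 0"
  shows "u \<in> pos_ideal"
proof -
  have *: "psubst \<sigma> b - pconst (lookup b 0) \<in> pos_ideal" for b
  proof (induction b rule: cpoly_ring_induct)
    case (const c)
    show ?case by (simp add: lookup_pconst)
  next
    case (var i)
    have "lookup (pvar i) 0 = 0"
      by (simp add: pvar_def lookup_single when_def)
    thus ?case by (simp add: generator_in_pos_ideal)
  next
    case (add p q)
    thus ?case using pos_ideal_add[OF add.IH] by (simp add: psubst_add lookup_add pconst_add algebra_simps)
  next
    case (mult p q)
    define a where "a = lookup p 0"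
    define b where "b = lookup q 0"
    have "psubst \<sigma> (p * q) - pconst (lookup (p * q) 0)
        = (psubst \<sigma> p - pconst a) * psubst \<sigma> q + pconst a * (psubst \<sigma> q - pconst b)"
      by (simp add: psubst_mult lookup_mult_zero pconst_mult a_def b_def algebra_simps)
    also have "\<dots> \<in> pos_ideal"
      unfolding a_def b_def by (intro pos_ideal_add pos_ideal_mult[OF mult.IH(1)] pos_ideal_mult_left mult.IH(2))
    finally show ?case .
  qed
  obtain b where b: "u = psubst \<sigma> b" using assms(1) by (auto simp: invariants_eq_range)
  have "lookup b 0 = 0"
    using lookup_pos_ideal_zero[OF *[of b]] assms(2) b by (simp add: lookup_minus lookup_pconst)
  thus ?thesis using *[of b] b by simp
qed

lemma homogeneous_invariant_in_pos_ideal: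
  "u \<in> invariants G \<Longrightarrow> homogeneous d u \<Longrightarrow> 0 < d \<Longrightarrow> u \<in> pos_ideal"
  by (intro invariant_in_pos_ideal) (auto simp: homogeneous_iff)

end

subsection \<open>Divisibility of \<open>p - s p\<close> by the root of the reflection \<open>s\<close>\<close>

definition root_form :: "real^'n \<Rightarrow> ('n::finite) cpoly" where
  "root_form \<alpha> = (\<Sum>k\<in>UNIV. pconst (of_real (\<alpha> $ k)) * pvar k)"

lemma homogeneous_root_form: "homogeneous 1 (root_form \<alpha>)"
  unfolding root_form_def by (intro homogeneous_sum homogeneous_pconst_mult homogeneous_pvar)

lemma lookup_single_mult_add:
  fixes q :: "('n::finite) cpoly"
  shows "lookup (single a c * q) (a + m) = c * lookup q m"
  by (induction q rule: cpoly_induct)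
     (auto simp: mult_single lookup_single lookup_add when_def distrib_left)

text \<open>A nonzero linear form is not a zero divisor: if \<open>x\<^sub>i\<close> occurs in it and \<open>m\<close> is a monomial of \<open>q\<close> of largest
  degree in \<open>x\<^sub>i\<close>, then nothing cancels \<open>x\<^sub>i m\<close> in the product.\<close>

lemma root_form_mult_cancel:
  assumes "\<alpha> \<noteq> 0" "root_form \<alpha> * q = 0"
  shows "q = 0"
proof (rule ccontr)
  assume q: "q \<noteq> 0"
  obtain i where i: "\<alpha> $ i \<noteq> 0"
    using assms(1) by (auto simp: Finite_Cartesian_Product.vec_eq_iff)
  let ?e = "\<lambda>k. single k (1::nat)"
  have "finite ((\<lambda>m. lookup m i) ` keys q)" by simp
  moreover have "keys q \<noteq> {}"
    using q by (metis ex_in_conv in_keys_iff lookup_zero poly_mapping_eqI)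
  ultimately obtain m where m: "m \<in> keys q"
    "\<And>k. k \<in> keys q \<Longrightarrow> lookup k i \<le> lookup m i"
    using Max_in[of "(\<lambda>m. lookup m i) ` keys q"]
      Max_ge[of "(\<lambda>m. lookup m i) ` keys q"] by fastforce
  have "lookup (pvar k * q) (?e i + m) = 0" if "k \<noteq> i" for k
  proof (rule ccontr)
    assume "lookup (pvar k * q) (?e i + m) \<noteq> 0"
    hence "?e i + m \<in> keys (pvar k * q)" by (simp add: in_keys_iff)
    then obtain b where b: "?e i + m = ?e k + b" "b \<in> keys q"
      using keys_mult[of "pvar k" q] by (auto simp: pvar_def)
    have "lookup (?e i + m) i = lookup (?e k + b) i" using b by simp
    thus False using m(2)[OF b(2)] that by (simp add: lookup_add lookup_single)
  qed
  hence "(\<Sum>k\<in>UNIV. of_real (\<alpha> $ k) * lookup (pvar k * q) (?e i + m))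
      = (\<Sum>k\<in>UNIV. if k = i then of_real (\<alpha> $ i) * lookup (pvar i * q) (?e i + m) else 0)"
    by (intro sum.cong) auto
  also have "\<dots> = of_real (\<alpha> $ i) * lookup q m"
    by (simp add: pvar_def lookup_single_mult_add)
  also have "(\<Sum>k\<in>UNIV. of_real (\<alpha> $ k) * lookup (pvar k * q) (?e i + m))
      = lookup (root_form \<alpha> * q) (?e i + m)"
    by (simp add: root_form_def sum_distrib_right lookup_sum mult.assoc)
  finally show False using assms(2) i m(1) by (simp add: in_keys_iff)
qed

text \<open>For a coordinate this is the formula for the reflection, and it passes to products because of
  \<open>p q - s(p q) = p (q - s q) + (p - s p) s q\<close>.\<close>

lemma root_form_dvd_diff:
  assumes "\<alpha> \<noteq> 0"
  obtains q where "p - pact (reflection_matrix \<alpha>) p = root_form \<alpha> * q"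
proof -
  let ?s = "reflection_matrix \<alpha>"
  have inv: "matrix_inv ?s = ?s"
    using assms by (intro matrix_inv_reflection) (auto simp: reflections_def)
  have "\<exists>q. p - pact ?s p = root_form \<alpha> * q"
  proof (induction p rule: cpoly_ring_induct)
    case (const c)
    show ?case by (auto intro: exI[of _ 0])
  next
    case (var i)
    define c :: complex where "c = of_real (2 * \<alpha> $ i / (\<alpha> \<bullet> \<alpha>))"
    have "pact ?s (pvar i) = (\<Sum>k\<in>UNIV. (if i = k then pvar k else 0) - pconst c * (pconst (of_real (\<alpha> $ k)) * pvar k))"
      unfolding pact_conv_lsubst lsubst_pvar inv
    proof (intro sum.cong refl)
      fix k
      have "cmat ?s $ i $ k = (if i = k then 1 else 0) + - (c * of_real (\<alpha> $ k))"
        by (simp add: cmat_def reflection_matrix_nth c_def)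
      thus "pconst (cmat ?s $ i $ k) * pvar k = (if i = k then pvar k else 0) - pconst c * (pconst (of_real (\<alpha> $ k)) * pvar k)"
        by (simp only: pconst_add pconst_uminus pconst_mult) (simp add: algebra_simps)
    qed
    also have "\<dots> = pvar i - pconst c * root_form \<alpha>"
      by (simp add: sum_subtractf root_form_def sum_distrib_left)
    finally show ?case by (intro exI[of _ "pconst c"]) (simp add: mult.commute)
  next
    case (add p q)
    then obtain a b where "p - pact ?s p = root_form \<alpha> * a" "q - pact ?s q = root_form \<alpha> * b" by blast
    thus ?case by (intro exI[of _ "a + b"]) (simp add: pact_add algebra_simps)
  next
    case (mult p q)
    then obtain a b where ab: "p - pact ?s p = root_form \<alpha> * a" "q - pact ?s q = root_form \<alpha> * b" by blast
    have "p * q - pact ?s (p * q) = p * (q - pact ?s q) + (p - pact ?s p) * pact ?s q"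
      by (simp add: pact_mult algebra_simps)
    thus ?case unfolding ab by (intro exI[of _ "p * b + a * pact ?s q"]) (simp add: algebra_simps)
  qed
  thus ?thesis using that by blast
qed

lemma homogeneous_root_form_quotient:
  assumes "\<alpha> \<noteq> 0" "homogeneous (Suc d) (root_form \<alpha> * q)"
  shows "homogeneous d q"
proof -
  have "root_form \<alpha> * q = hcomp (Suc d) (q * root_form \<alpha>)"
    using hcomp_homogeneous[OF assms(2), of "Suc d"] by (simp add: mult.commute)
  also have "\<dots> = hcomp d q * root_form \<alpha>"
    using hcomp_mult_homogeneous[OF homogeneous_root_form, of "Suc d" q \<alpha>] by simp
  finally have "root_form \<alpha> * (q - hcomp d q) = 0" by (simp add: algebra_simps)
  hence "q = hcomp d q" using root_form_mult_cancel[OF assms(1)] by fastforce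
  thus ?thesis by (metis homogeneous_hcomp)
qed

subsection \<open>Chevalley's lemma\<close>

context basic_invariants
begin

text \<open>Induction on the degree of \<open>f l0\<close>. For a reflection with root \<open>\<alpha>\<close> the operator \<open>f \<mapsto> (f - s f) / \<alpha>\<close> is linear
  over the invariants and lowers the degree, so by the induction hypothesis \<open>f l0\<close> is congruent modulo
  the ideal to its image under \<open>s\<close>, hence to its images under the whole group and to their average. The
  average is an invariant of positive degree. If \<open>f l0\<close> is a nonzero constant, then the average of
  the relation expresses \<open>u l0\<close> by the other \<open>u l\<close>.\<close>

lemma chevalley:
  assumes "finite L" "l0 \<in> L" "\<And>l. l \<in> L \<Longrightarrow> u l \<in> invariants G"
    and "(\<Sum>l\<in>L. f l * u l) = 0" "homogeneous d (f l0)"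
    and indep: "\<And>v. (\<And>l. v l \<in> invariants G) \<Longrightarrow> u l0 \<noteq> (\<Sum>l\<in>L-{l0}. v l * u l)"
  shows "f l0 \<in> pos_ideal"
  using assms(4,5)
proof (induction d arbitrary: f)
  case 0
  then obtain c where c: "f l0 = pconst c" using homogeneous_0_imp_pconst by blast
  have "0 = avg (\<Sum>l\<in>L. f l * u l)" using 0 by simp
  also have "\<dots> = (\<Sum>l\<in>L. avg (f l) * u l)"
    using assms(3) by (simp add: avg_sum avg_invariant_mult)
  also have "\<dots> = pconst c * u l0 + (\<Sum>l\<in>L-{l0}. avg (f l) * u l)"
    using assms(1,2) c by (simp add: sum.remove avg_pconst)
  finally have eq: "pconst c * u l0 + (\<Sum>l\<in>L-{l0}. avg (f l) * u l) = 0" by simp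
  have "c = 0"
  proof (rule ccontr)
    assume "c \<noteq> 0"
    define v where "v l = pconst (- inverse c) * avg (f l)" for l
    have "u l0 = pconst (inverse c) * (pconst c * u l0)"
      using \<open>c \<noteq> 0\<close> by (simp add: pconst_inverse_cancel)
    also have "pconst c * u l0 = - (\<Sum>l\<in>L-{l0}. avg (f l) * u l)"
      using eq by (simp add: eq_neg_iff_add_eq_0)
    also have "pconst (inverse c) * \<dots> = (\<Sum>l\<in>L-{l0}. v l * u l)"
      by (simp add: v_def pconst_uminus sum_distrib_left sum_negf mult.assoc)
    finally have "u l0 = (\<Sum>l\<in>L-{l0}. v l * u l)" .
    moreover have "v l \<in> invariants G" for l
      unfolding v_def by (intro invariants_mult invariants_pconst avg_invariant)
    ultimately show False using indep by blast
  qed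
  thus ?case using c by simp
next
  case (Suc d)
  have "f l0 - pact g (f l0) \<in> pos_ideal" if "g \<in> G" for g
    using that
  proof (induction rule: G_induct)
    case one
    show ?case by simp
  next
    case (reflection s)
    then obtain \<alpha> where \<alpha>: "\<alpha> \<noteq> 0" "s = reflection_matrix \<alpha>" by (auto elim: reflectionsE)
    have "\<exists>q. p - pact s p = root_form \<alpha> * q" for p
      using root_form_dvd_diff[OF \<alpha>(1), of p] \<alpha>(2) by metis
    then obtain q where q: "\<And>p. p - pact s p = root_form \<alpha> * q p" by metis
    have "root_form \<alpha> * (\<Sum>l\<in>L. q (f l) * u l) = (\<Sum>l\<in>L. (f l - pact s (f l)) * u l)"
      by (simp add: q sum_distrib_left mult.assoc)
    also have "\<dots> = (\<Sum>l\<in>L. f l * u l) - pact s (\<Sum>l\<in>L. f l * u l)"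
      using assms(3) reflection
      by (simp add: left_diff_distrib sum_subtractf pact_sum pact_mult invariants_def)
    finally have "(\<Sum>l\<in>L. q (f l) * u l) = 0"
      using Suc.prems(1) root_form_mult_cancel[OF \<alpha>(1)] by simp
    moreover have "homogeneous (Suc d) (f l0 - pact s (f l0))"
      using Suc.prems(2) by (intro homogeneous_diff homogeneous_pact)
    hence "homogeneous d (q (f l0))"
      unfolding q using homogeneous_root_form_quotient[OF \<alpha>(1)] by blast
    ultimately have "q (f l0) \<in> pos_ideal"
      by (intro Suc.IH[of "\<lambda>l. q (f l)"])
    thus ?case by (simp add: q pos_ideal_mult_left)
  next
    case (mult g h)
    have "f l0 - pact (g ** h) (f l0) = (f l0 - pact g (f l0)) + pact g (f l0 - pact h (f l0))"
      using mult by (simp add: pact_diff pact_pact)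
    also have "\<dots> \<in> pos_ideal" using mult by (intro pos_ideal_add pact_pos_ideal)
    finally show ?case .
  qed
  hence "(\<Sum>g\<in>G. f l0 - pact g (f l0)) \<in> pos_ideal" by (intro pos_ideal_sum)
  hence "pconst (1 / of_nat (card G)) * (\<Sum>g\<in>G. f l0 - pact g (f l0)) \<in> pos_ideal"
    by (rule pos_ideal_mult_left)
  moreover have "pconst (1 / of_nat (card G)) * (\<Sum>g\<in>G. f l0 - pact g (f l0)) = f l0 - avg (f l0)"
  proof -
    have "pconst (1 / of_nat (card G)) * (\<Sum>g\<in>G. f l0) = f l0"
      using pconst_inverse_cancel[OF card_G_neq_0, of "f l0"]
      by (simp add: pconst_def inverse_eq_divide flip: single_of_nat)
    thus ?thesis by (simp add: sum_subtractf right_diff_distrib avg_def)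
  qed
  moreover have "avg (f l0) \<in> pos_ideal"
    using Suc.prems(2)
    by (intro homogeneous_invariant_in_pos_ideal[of _ "Suc d"] avg_invariant homogeneous_avg) auto
  ultimately show ?case
    using pos_ideal_add[of "f l0 - avg (f l0)" "avg (f l0)"] by simp
qed

text \<open>This is the injectivity of \<open>H \<otimes> R \<rightarrow> S\<close>. In a nontrivial relation pick an \<open>l0\<close> with \<open>h l0 \<noteq> 0\<close> for which \<open>u l0\<close>
  has least degree. By Chevalley's lemma, \<open>u l0\<close> is a combination of the other \<open>u l\<close> with coefficients in the
  invariants. In the component of degree \<open>k l0\<close> these coefficients are constants, since no other
  \<open>u l\<close> has smaller degree; this contradicts the linear independence.\<close>

lemma invariants_independent_over_complement:
  fixes u :: "'a \<Rightarrow> 'n cpoly"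
  assumes "finite L" "\<And>l. l \<in> L \<Longrightarrow> u l \<in> invariants G" "\<And>l. l \<in> L \<Longrightarrow> homogeneous (k l) (u l)"
    and indep: "\<And>c. (\<Sum>l\<in>L. pconst (c l) * u l) = 0 \<Longrightarrow> \<forall>l\<in>L. c l = 0"
    and "\<And>l. l \<in> L \<Longrightarrow> homogeneous (e l) (h l)" "\<And>l. l \<in> L \<Longrightarrow> h l \<in> pos_ideal \<Longrightarrow> h l = 0"
    and "(\<Sum>l\<in>L. h l * u l) = 0"
  shows "\<forall>l\<in>L. h l = 0"
proof (rule ccontr)
  assume "\<not> (\<forall>l\<in>L. h l = 0)"
  define L' where "L' = {l\<in>L. h l \<noteq> 0}"
  have L': "finite L'" "L' \<noteq> {}" "L' \<subseteq> L"
    using assms(1) \<open>\<not> (\<forall>l\<in>L. h l = 0)\<close> by (auto simp: L'_def)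
  obtain l0 where l0: "l0 \<in> L'" "\<And>l. l \<in> L' \<Longrightarrow> k l0 \<le> k l"
    using arg_min_if_finite[OF L'(1,2), of k] by (metis not_le)
  have "(\<Sum>l\<in>L'. h l * u l) = (\<Sum>l\<in>L. h l * u l)"
    using assms(1) by (intro sum.mono_neutral_left) (auto simp: L'_def)
  hence sum0: "(\<Sum>l\<in>L'. h l * u l) = 0" using assms(7) by simp
  have "h l0 \<in> pos_ideal"
  proof (rule chevalley[OF L'(1) l0(1) _ sum0, where d = "e l0"])
    fix v :: "'a \<Rightarrow> 'n cpoly" assume "\<And>l. v l \<in> invariants G"
    \<comment> \<open>the coefficients of the relation in degree \<open>k l0\<close>, extended by zero to all of \<open>L\<close>\<close>
    define c where "c l = (if l = l0 then - 1 else if l \<in> L' \<and> k l = k l0 then lookup (v l) 0 else 0)" for l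
    show "u l0 \<noteq> (\<Sum>l\<in>L'-{l0}. v l * u l)"
    proof
      assume eq: "u l0 = (\<Sum>l\<in>L'-{l0}. v l * u l)"
      have "u l0 = hcomp (k l0) (u l0)"
        using assms(3) l0(1) L' by (subst hcomp_homogeneous) auto
      also have "\<dots> = (\<Sum>l\<in>L'-{l0}. hcomp (k l0) (v l * u l))"
        by (subst eq) (simp add: hcomp_sum)
      also have "\<dots> = (\<Sum>l\<in>L'-{l0}. pconst (c l) * u l)"
      proof (intro sum.cong refl)
        fix l assume l: "l \<in> L' - {l0}"
        hence "homogeneous (k l) (u l)" using assms(3) L' by auto
        moreover have "hcomp 0 (v l) = pconst (lookup (v l) 0)"
          using homogeneous_0_imp_pconst[OF homogeneous_hcomp, of "v l"] by (simp add: lookup_hcomp)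
        ultimately show "hcomp (k l0) (v l * u l) = pconst (c l) * u l"
          using l l0(2)[of l] by (auto simp: hcomp_mult_homogeneous c_def)
      qed
      finally have "(\<Sum>l\<in>L'. pconst (c l) * u l) = 0"
        using L'(1) l0(1) by (simp add: sum.remove c_def pconst_uminus)
      also have "(\<Sum>l\<in>L'. pconst (c l) * u l) = (\<Sum>l\<in>L. pconst (c l) * u l)"
        using assms(1) l0(1) L' by (intro sum.mono_neutral_left) (auto simp: c_def)
      finally have "c l0 = 0" using indep l0(1) L' by blast
      thus False by (simp add: c_def)
    qed
  qed (use assms L' l0 in auto)
  thus False using assms(6) l0(1) by (auto simp: L'_def)
qed

end

section \<open>Harmonic polynomials complement the ideal of positive-degree invariants\<close>

lemma diff_op_0_left [simp]: "diff_op 0 f = 0"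
  by (simp add: diff_op_def)

lemma diff_op_0_right [simp]: "diff_op p 0 = 0"
  by (simp add: diff_op_def)

lemma diff_op_sum_left: "diff_op (sum p A) f = (\<Sum>a\<in>A. diff_op (p a) f)"
  by (induction A rule: infinite_finite_induct) (auto simp: diff_op_add_left)

lemma diff_op_sum_right: "diff_op p (sum f A) = (\<Sum>a\<in>A. diff_op p (f a))"
  by (induction A rule: infinite_finite_induct) (auto simp: diff_op_add_right)

lemma deriv_coeff_0 [simp]: "deriv_coeff 0 k = 1"
  by (simp add: deriv_coeff_def)

lemma diff_op_pconst: "diff_op (pconst c) f = pconst c * f"
  by (induction f rule: cpoly_induct)
     (simp_all add: pconst_def diff_op_single mult_single diff_op_add_right distrib_left)

lemma diff_op_scale_left: "diff_op (pconst c * p) f = pconst c * diff_op p f"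
  by (simp add: diff_op_mult diff_op_pconst)

lemma diff_op_scale_right: "diff_op p (pconst c * f) = pconst c * diff_op p f"
  by (metis diff_op_mult diff_op_pconst mult.commute)

subsection \<open>Orthogonal changes of variables\<close>

lemma deriv_coeff_single: "deriv_coeff (single i 1) k = of_nat (lookup k i)"
proof -
  have "deriv_coeff (single i 1) k
      = (\<Prod>j\<in>UNIV. if j = i then of_nat (lookup k i) else 1)"
    unfolding deriv_coeff_def by (intro prod.cong) (auto simp: lookup_single when_def)
  thus ?thesis by simp
qed

lemma diff_op_pvar_single:
  "diff_op (pvar i) (single k c)
    = single (k - single i 1) (c * of_nat (lookup k i))"
  unfolding pvar_def diff_op_single deriv_coeff_single by simp

lemma diff_op_pvar_mult:
  "diff_op (pvar i) (p * q) = diff_op (pvar i) p * q + p * diff_op (pvar i) q"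
proof (induction p rule: cpoly_induct)
  case (single m a)
  show ?case
  proof (induction q rule: cpoly_induct)
    case (single k b)
    let ?e = "single i (1::nat)"
    have *: "single (m + k - ?e) (c * of_nat (lookup m i))
        = single (m - ?e + k) (c * of_nat (lookup m i))" for m k :: "'a \<Rightarrow>\<^sub>0 nat" and c :: complex
    proof (cases "lookup m i = 0")
      case False
      have "m + k - ?e = m - ?e + k"
        by (intro poly_mapping_eqI) (use False in \<open>auto simp: lookup_add lookup_minus lookup_single when_def\<close>)
      thus ?thesis by simp
    qed simp
    have "diff_op (pvar i) (single m a * single k b)
        = single (m + k - ?e) (a * b * of_nat (lookup m i))
        + single (k + m - ?e) (a * b * of_nat (lookup k i))"
      by (simp only: mult_single diff_op_pvar_single single_add [symmetric] add.commute[of k m] lookup_add of_nat_add distrib_left)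
    also have "\<dots> = diff_op (pvar i) (single m a) * single k b
        + single m a * diff_op (pvar i) (single k b)"
      unfolding * diff_op_pvar_single mult_single by (simp add: mult_ac add_ac)
    finally show ?case .
  qed (simp add: diff_op_add_right algebra_simps)
qed (simp add: diff_op_add_right algebra_simps)

lemma diff_op_pvar_pconst: "diff_op (pvar i) (pconst c) = 0"
  unfolding pconst_def diff_op_pvar_single by simp

lemma diff_op_pvar_pvar: "diff_op (pvar i) (pvar j) = (if i = j then 1 else 0)"
  unfolding pvar_def[of j] diff_op_pvar_single by (auto simp: lookup_single)

text \<open>The chain rule.\<close>

lemma diff_op_pvar_lsubst:
  "diff_op (pvar k) (lsubst A p) = (\<Sum>l\<in>UNIV. pconst (A $ l $ k) * lsubst A (diff_op (pvar l) p))"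
proof (induction p rule: cpoly_ring_induct)
  case (const c)
  show ?case by (simp add: diff_op_pvar_pconst)
next
  case (var i)
  have "diff_op (pvar k) (lsubst A (pvar i)) = (\<Sum>j\<in>UNIV. if j = k then pconst (A $ i $ k) else 0)"
    unfolding lsubst_pvar diff_op_sum_right diff_op_scale_right diff_op_pvar_pvar by (intro sum.cong) auto
  moreover have "(\<Sum>l\<in>UNIV. pconst (A $ l $ k) * lsubst A (diff_op (pvar l) (pvar i)))
      = (\<Sum>l\<in>UNIV. if l = i then pconst (A $ i $ k) else 0)"
    unfolding diff_op_pvar_pvar by (intro sum.cong) auto
  ultimately show ?case by simp
next
  case (add p q)
  thus ?case by (simp add: lsubst_add diff_op_add_right distrib_left sum.distrib)
next
  case (mult p q)
  thus ?case
    by (simp add: lsubst_mult lsubst_add diff_op_pvar_mult distrib_left sum.distrib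
          sum_distrib_left sum_distrib_right mult_ac)
qed

text \<open>As \<open>\<tau> \<mapsto> \<tau>(\<partial>)\<close> is multiplicative, only the coordinates have to be checked: the gradient transforms by the
  transposed matrix, which for orthogonal \<open>A\<close> is the inverse.\<close>

lemma diff_op_lsubst_orthogonal:
  assumes "A ** Finite_Cartesian_Product.transpose A = mat 1"
  shows "diff_op (lsubst A \<tau>) (lsubst A f) = lsubst A (diff_op \<tau> f)"
proof (induction \<tau> arbitrary: f rule: cpoly_ring_induct)
  case (const c)
  show ?case by (simp add: diff_op_pconst lsubst_mult)
next
  case (var i)
  have orth: "(\<Sum>k\<in>UNIV. A $ i $ k * A $ l $ k) = (if i = l then 1 else 0)" for l
    using arg_cong[OF assms, of "\<lambda>M. M $ i $ l"]
    by (simp add: matrix_matrix_mult_def Finite_Cartesian_Product.transpose_def Finite_Cartesian_Product.mat_def)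
  have "diff_op (lsubst A (pvar i)) (lsubst A f)
      = (\<Sum>k\<in>UNIV. \<Sum>l\<in>UNIV. pconst (A $ i $ k * A $ l $ k) * lsubst A (diff_op (pvar l) f))"
    unfolding lsubst_pvar diff_op_sum_left diff_op_scale_left diff_op_pvar_lsubst
    by (simp add: sum_distrib_left mult.assoc pconst_mult)
  also have "\<dots> = (\<Sum>l\<in>UNIV. pconst (\<Sum>k\<in>UNIV. A $ i $ k * A $ l $ k) * lsubst A (diff_op (pvar l) f))"
    by (subst sum.swap) (simp add: pconst_sum sum_distrib_right)
  also have "\<dots> = (\<Sum>l\<in>UNIV. if l = i then lsubst A (diff_op (pvar i) f) else 0)"
    unfolding orth by (intro sum.cong) auto
  finally show ?case by simp
next
  case (add p q)
  thus ?case by (simp add: lsubst_add diff_op_add_left)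
next
  case (mult p q)
  thus ?case by (simp add: lsubst_mult diff_op_mult)
qed

lemma (in basic_invariants) pact_harmonics:
  assumes "g \<in> G" "f \<in> harmonics \<sigma>"
  shows "pact g f \<in> harmonics \<sigma>"
proof -
  have "cmat (matrix_inv g) ** Finite_Cartesian_Product.transpose (cmat (matrix_inv g)) = cmat (matrix_inv g ** g)"
  proof -
    have "Finite_Cartesian_Product.transpose (matrix_inv g) = g"
      using orthogonal_G[OF assms(1)] by (simp add: matrix_inv_orthogonal)
    hence "Finite_Cartesian_Product.transpose (cmat (matrix_inv g)) = cmat g"
      by (auto simp: cmat_def Finite_Cartesian_Product.transpose_def Finite_Cartesian_Product.vec_eq_iff)
    thus ?thesis by (simp add: cmat_mult)
  qed
  hence orth: "cmat (matrix_inv g) ** Finite_Cartesian_Product.transpose (cmat (matrix_inv g)) = mat 1"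
    using assms(1) by (simp add: matrix_inv_G)
  have "diff_op (\<sigma> i) (pact g f) = 0" for i
  proof -
    have "diff_op (\<sigma> i) (pact g f) = diff_op (pact g (\<sigma> i)) (pact g f)"
      using generator_invariant[of i] assms(1) by (simp add: invariants_def)
    also have "\<dots> = pact g (diff_op (\<sigma> i) f)"
      unfolding pact_conv_lsubst by (rule diff_op_lsubst_orthogonal[OF orth])
    finally show ?thesis using assms(2) by (simp add: harmonics_def)
  qed
  thus ?thesis by (simp add: harmonics_def)
qed

subsection \<open>The Fischer inner product\<close>

definition pcnj :: "('n::finite) cpoly \<Rightarrow> 'n cpoly" where
  "pcnj p = Poly_Mapping.map cnj p"

lemma lookup_pcnj [simp]: "lookup (pcnj p) m = cnj (lookup p m)"
  by (simp add: pcnj_def map.rep_eq when_def)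

lemma pcnj_single [simp]: "pcnj (single m c) = single m (cnj c)"
  by (intro poly_mapping_eqI) (simp add: lookup_single when_def)

lemma pcnj_add: "pcnj (p + q) = pcnj p + pcnj q"
  by (intro poly_mapping_eqI) (simp add: lookup_add)

lemma pcnj_0 [simp]: "pcnj 0 = 0"
  by (intro poly_mapping_eqI) simp

lemma pcnj_sum: "pcnj (sum f A) = (\<Sum>a\<in>A. pcnj (f a))"
  by (induction A rule: infinite_finite_induct) (auto simp: pcnj_add)

lemma pcnj_pcnj [simp]: "pcnj (pcnj p) = p"
  by (intro poly_mapping_eqI) simp

lemma pcnj_mult: "pcnj (p * q) = pcnj p * pcnj q"
proof (induction p rule: cpoly_induct)
  case (single m c)
  show ?case
    by (induction q rule: cpoly_induct) (auto simp: mult_single pcnj_add distrib_left)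
qed (simp add: pcnj_add distrib_right)

lemma pcnj_pconst [simp]: "pcnj (pconst c) = pconst (cnj c)"
  by (simp add: pconst_def)

lemma pcnj_pvar [simp]: "pcnj (pvar i) = pvar i"
  by (simp add: pvar_def)

lemma pcnj_pact: "pcnj (pact g p) = pact g (pcnj p)"
proof (induction p rule: cpoly_ring_induct)
  case (var i)
  show ?case by (simp add: pact_conv_lsubst lsubst_pvar pcnj_sum pcnj_mult cmat_def)
qed (simp_all add: pact_add pact_mult pcnj_add pcnj_mult)

lemma cnj_deriv_coeff: "cnj (deriv_coeff m k) = deriv_coeff m k"
  by (simp add: deriv_coeff_def)

lemma pcnj_diff_op: "pcnj (diff_op p f) = diff_op (pcnj p) (pcnj f)"
proof (induction p rule: cpoly_induct)
  case (single m c)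
  show ?case
    by (induction f rule: cpoly_induct)
       (auto simp: diff_op_single diff_op_add_right pcnj_add cnj_deriv_coeff)
qed (simp add: diff_op_add_left pcnj_add)

definition mfact :: "('n::finite \<Rightarrow>\<^sub>0 nat) \<Rightarrow> real" where
  "mfact m = (\<Prod>i\<in>UNIV. fact (lookup m i))"

lemma mfact_pos: "0 < mfact m"
  unfolding mfact_def by (intro prod_pos) simp

lemma deriv_coeff_self: "deriv_coeff m m = of_real (mfact m)"
proof -
  have "(\<Prod>r<n. of_nat n - of_nat r :: complex) = fact n" for n
  proof -
    have "(\<Prod>r<n. of_nat n - of_nat r :: complex) = (\<Prod>r<n. of_nat (n - r))"
      by (intro prod.cong) (auto simp: of_nat_diff)
    also have "\<dots> = (\<Prod>r<n. of_nat (Suc r))"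
      by (rule prod.reindex_bij_witness[where i = "\<lambda>r. n - Suc r" and j = "\<lambda>r. n - Suc r"]) auto
    also have "\<dots> = fact n"
      by (simp add: fact_prod_Suc atLeast0LessThan)
    finally show ?thesis .
  qed
  thus ?thesis by (simp add: deriv_coeff_def mfact_def)
qed

lemma lookup_diff_op_zero:
  "lookup (diff_op p f) 0
    = (\<Sum>m\<in>keys f. lookup p m * lookup f m * of_real (mfact m))"
proof (induction f rule: cpoly_induct)
  case (single k b)
  have "lookup (diff_op p (single k b)) 0
      = lookup p k * b * of_real (mfact k)"
  proof (induction p rule: cpoly_induct)
    case (single m a)
    have "deriv_coeff m k = 0" if "k - m = 0" "m \<noteq> k"
    proof -
      from that(2) obtain i where "lookup m i \<noteq> lookup k i"
        by (metis poly_mapping_eqI)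
      moreover have "lookup k i - lookup m i = 0"
        using arg_cong[OF that(1), of "\<lambda>x. lookup x i"] by (simp add: lookup_minus)
      ultimately have "lookup k i < lookup m i" by simp
      hence "(\<Prod>r<lookup m i. of_nat (lookup k i) - of_nat r :: complex) = 0"
        by (auto intro!: bexI[of _ "lookup k i"])
      thus ?thesis unfolding deriv_coeff_def by (intro prod_zero) auto
    qed
    thus ?case
      by (cases "m = k") (auto simp: diff_op_single deriv_coeff_self lookup_single when_def)
  qed (simp add: diff_op_add_left lookup_add algebra_simps)
  thus ?case by simp
next
  case (add f g)
  thus ?case
    by (subst setsum_keys_plus_distrib) (auto simp: diff_op_add_right lookup_add algebra_simps)
qed

text \<open>Monomials are orthogonal for this inner product, and \<open>mfact m\<close> is the squared norm of the monomial \<open>m\<close>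
  (lemma \<open>fischer_conv_sum\<close>). Multiplication by \<open>u\<close> is adjoint to the operator of the conjugate of \<open>u\<close>, because
  \<open>\<tau> \<mapsto> \<tau>(\<partial>)\<close> is multiplicative.\<close>

definition fischer :: "('n::finite) cpoly \<Rightarrow> 'n cpoly \<Rightarrow> complex" where
  "fischer p q = lookup (diff_op p (pcnj q)) 0"

lemma fischer_add_left: "fischer (p + q) r = fischer p r + fischer q r"
  by (simp add: fischer_def diff_op_add_left lookup_add)

lemma fischer_add_right: "fischer r (p + q) = fischer r p + fischer r q"
  by (simp add: fischer_def diff_op_add_right pcnj_add lookup_add)

lemma fischer_scale_left: "fischer (pconst c * p) r = c * fischer p r"
  by (simp add: fischer_def diff_op_scale_left)

lemma fischer_scale_right: "fischer r (pconst c * p) = cnj c * fischer r p"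
  by (simp add: fischer_def diff_op_scale_right pcnj_mult)

lemma fischer_uminus_right: "fischer r (- p) = - fischer r p"
  using fischer_scale_right[of r "- 1" p] by (simp add: pconst_uminus)

lemma fischer_diff_right: "fischer r (p - q) = fischer r p - fischer r q"
  using fischer_add_right[of r p "- q"] by (simp add: fischer_uminus_right)

lemma fischer_conv_sum:
  "fischer p q = (\<Sum>m\<in>keys q. lookup p m * cnj (lookup q m) * of_real (mfact m))"
proof -
  have "keys (pcnj q) = keys q" by (auto simp: in_keys_iff)
  thus ?thesis by (simp add: fischer_def lookup_diff_op_zero)
qed

lemma fischer_self_eq_0:
  assumes "fischer p p = 0"
  shows "p = 0"
proof -
  have "fischer p p = of_real (\<Sum>m\<in>keys p. (norm (lookup p m))\<^sup>2 * mfact m)"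
    unfolding fischer_conv_sum of_real_sum of_real_mult complex_norm_square ..
  hence "(\<Sum>m\<in>keys p. (norm (lookup p m))\<^sup>2 * mfact m) = 0"
    using assms by (metis of_real_eq_0_iff)
  hence "\<forall>m\<in>keys p. (norm (lookup p m))\<^sup>2 * mfact m = 0"
    by (subst (asm) sum_nonneg_eq_0_iff) (auto simp: less_imp_le[OF mfact_pos])
  hence "keys p = {}"
    using mfact_pos less_irrefl by (metis equals0I in_keys_iff mult_eq_0_iff norm_eq_zero power_eq_0_iff)
  thus ?thesis by (metis empty_iff in_keys_iff lookup_zero poly_mapping_eqI)
qed

lemma fischer_hcomp:
  assumes "homogeneous d q"
  shows "fischer p q = fischer (hcomp d p) q"
  unfolding fischer_conv_sum using assms
  by (intro sum.cong) (auto simp: lookup_hcomp homogeneous_def mdeg_def)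

definition pscale :: "complex \<Rightarrow> ('n::finite) cpoly \<Rightarrow> 'n cpoly" where
  "pscale c p = pconst c * p"

interpretation cpoly: vector_space "pscale :: complex \<Rightarrow> ('n::finite) cpoly \<Rightarrow> 'n cpoly"
  by unfold_locales (simp_all add: pscale_def pconst_add pconst_mult algebra_simps)

text \<open>Orthogonal projection, by the Gram-Schmidt step: adding \<open>b\<close> to the spanning set amounts to adding its
  component \<open>b2\<close> orthogonal to the previous span.\<close>

lemma fischer_projection:
  assumes "finite B"
  shows "\<exists>y\<in>cpoly.span B. \<forall>b\<in>cpoly.span B. fischer b (f - y) = 0"
  using assms
proof (induction B arbitrary: f)
  case empty
  show ?case by (auto simp: fischer_def)
next
  case (insert b B)
  obtain b1 where b1: "b1 \<in> cpoly.span B" "\<forall>x\<in>cpoly.span B. fischer x (b - b1) = 0"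
    using insert.IH by blast
  define b2 where "b2 = b - b1"
  obtain y where y: "y \<in> cpoly.span B" "\<forall>x\<in>cpoly.span B. fischer x (f - y) = 0"
    using insert.IH by blast
  \<comment> \<open>if \<open>b2 = 0\<close> then the quotient is \<open>0\<close> by convention, which is the right coefficient\<close>
  define c where "c = cnj (fischer b2 (f - y) / fischer b2 b2)"
  have b2: "fischer b2 (f - y) = cnj c * fischer b2 b2"
  proof (cases "fischer b2 b2 = 0")
    case True
    hence "b2 = 0" by (rule fischer_self_eq_0)
    thus ?thesis by (simp add: fischer_def)
  qed (simp add: c_def)
  have span: "x \<in> cpoly.span (insert b B) \<longleftrightarrow> (\<exists>k z. z \<in> cpoly.span B \<and> x = pconst k * b2 + z)" for x
  proof
    assume "x \<in> cpoly.span (insert b B)"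
    then obtain k where k: "x - pconst k * b \<in> cpoly.span B"
      by (auto simp: cpoly.span_insert pscale_def)
    have "x = pconst k * b2 + ((x - pconst k * b) + pscale k b1)"
      by (simp add: b2_def pscale_def algebra_simps)
    moreover have "(x - pconst k * b) + pscale k b1 \<in> cpoly.span B"
      by (intro cpoly.span_add cpoly.span_scale k b1(1))
    ultimately show "\<exists>k z. z \<in> cpoly.span B \<and> x = pconst k * b2 + z" by blast
  next
    assume "\<exists>k z. z \<in> cpoly.span B \<and> x = pconst k * b2 + z"
    then obtain k z where kz: "z \<in> cpoly.span B" "x = pconst k * b2 + z" by blast
    have "x - pscale k b = z - pscale k b1"
      by (simp add: kz b2_def pscale_def algebra_simps)
    also have "\<dots> \<in> cpoly.span B" by (intro cpoly.span_diff cpoly.span_scale kz b1(1))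
    finally show "x \<in> cpoly.span (insert b B)" by (auto simp: cpoly.span_insert)
  qed
  show ?case
  proof (intro bexI ballI)
    show "pconst c * b2 + y \<in> cpoly.span (insert b B)" using span y(1) by blast
    fix x assume "x \<in> cpoly.span (insert b B)"
    then obtain k z where x: "z \<in> cpoly.span B" "x = pconst k * b2 + z" using span by blast
    have "fischer z (f - y) = 0" "fischer z b2 = 0"
      using x(1) y(2) b1(2) by (auto simp: b2_def)
    hence "fischer x ((f - y) - pconst c * b2) = k * (fischer b2 (f - y) - cnj c * fischer b2 b2)"
      by (simp add: x(2) fischer_add_left fischer_scale_left fischer_diff_right[of _ "f - y"] fischer_scale_right
            right_diff_distrib)
    hence "fischer x ((f - y) - pconst c * b2) = 0" by (simp add: b2)
    thus "fischer x (f - (pconst c * b2 + y)) = 0" by (simp add: algebra_simps)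
  qed
qed

definition monomials :: "nat \<Rightarrow> ('n::finite) cpoly set" where
  "monomials d = (\<lambda>m. single m 1) ` {m. mdeg m = d}"

lemma finite_monomials [simp]: "finite (monomials d)"
  by (simp add: monomials_def finite_mdeg)

lemma homogeneous_in_span_monomials:
  assumes "homogeneous d p"
  shows "p \<in> cpoly.span (monomials d)"
proof -
  have "p = (\<Sum>m\<in>keys p. pscale (lookup p m) (single m 1))"
    unfolding pscale_def pconst_single mult_1_right by (rule cpoly_expand)
  also have "\<dots> \<in> cpoly.span (monomials d)"
    using assms
    by (intro cpoly.span_sum cpoly.span_scale cpoly.span_base)
       (auto simp: monomials_def homogeneous_def mdeg_def)
  finally show ?thesis .
qed

context basic_invariants
begin

lemma pcnj_invariant: "u \<in> invariants G \<Longrightarrow> pcnj u \<in> invariants G"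
  by (simp add: invariants_def pcnj_pact [symmetric])

text \<open>The generators need not have real coefficients, but the group consists of real matrices, so their
  conjugates are invariants as well.\<close>

lemma pcnj_pos_ideal:
  assumes "p \<in> pos_ideal"
  shows "pcnj p \<in> pos_ideal"
proof -
  obtain a where a: "p = (\<Sum>i\<in>UNIV. \<sigma> i * a i)" using assms by (rule pos_idealE)
  have "pcnj (\<sigma> i) \<in> pos_ideal" for i
    by (intro invariant_in_pos_ideal pcnj_invariant) auto
  thus ?thesis unfolding a pcnj_sum pcnj_mult by (intro pos_ideal_sum pos_ideal_mult)
qed

lemma diff_op_pos_ideal_harmonic:
  assumes "p \<in> pos_ideal" "f \<in> harmonics \<sigma>"
  shows "diff_op p f = 0"
proof -
  obtain a where "p = (\<Sum>i\<in>UNIV. \<sigma> i * a i)" using assms(1) by (rule pos_idealE)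
  hence "diff_op p f = (\<Sum>i\<in>UNIV. diff_op (a i) (diff_op (\<sigma> i) f))"
    by (simp add: diff_op_sum_left diff_op_mult [symmetric] mult.commute)
  thus ?thesis using assms(2) by (simp add: harmonics_def)
qed

text \<open>The operator of the conjugate of \<open>f\<close> annihilates \<open>f\<close>, but the constant term of the result is the squared
  norm of the conjugate of \<open>f\<close>.\<close>

lemma harmonic_pos_ideal_zero:
  assumes "f \<in> harmonics \<sigma>" "f \<in> pos_ideal"
  shows "f = 0"
proof -
  have "fischer (pcnj f) (pcnj f) = 0"
    using diff_op_pos_ideal_harmonic[OF pcnj_pos_ideal[OF assms(2)] assms(1)] by (simp add: fischer_def)
  hence "pcnj f = 0" by (rule fischer_self_eq_0)
  thus ?thesis by (metis pcnj_0 pcnj_pcnj)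
qed

lemma hcomp_pos_ideal:
  assumes "p \<in> pos_ideal"
  shows "hcomp d p \<in> pos_ideal"
proof -
  obtain a where a: "p = (\<Sum>i\<in>UNIV. \<sigma> i * a i)" using assms by (rule pos_idealE)
  have "hcomp d (\<sigma> i * a i) \<in> pos_ideal" for i
    using hcomp_mult_homogeneous[OF homogeneous_generator, of d "a i" i]
    by (simp add: mult.commute pos_ideal_mult generator_in_pos_ideal)
  thus ?thesis unfolding a hcomp_sum by (intro pos_ideal_sum)
qed

text \<open>For \<open>w = \<sigma>\<^sub>i(\<partial>) z\<close>, adjointness gives \<open>\<langle>w, w\<rangle> = \<langle>w \<tau>, z\<rangle>\<close> with \<open>\<tau>\<close> the conjugate of \<open>\<sigma>\<^sub>i\<close>, and \<open>w \<tau>\<close> is in the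
  ideal.\<close>

lemma orthogonal_pos_ideal_harmonic:
  assumes "homogeneous d z" "\<And>p. p \<in> pos_ideal \<Longrightarrow> homogeneous d p \<Longrightarrow> fischer p z = 0"
  shows "z \<in> harmonics \<sigma>"
proof -
  have *: "fischer p z = 0" if "p \<in> pos_ideal" for p
    using fischer_hcomp[OF assms(1), of p] assms(2)[OF hcomp_pos_ideal[OF that] homogeneous_hcomp] by simp
  have "diff_op (\<sigma> i) z = 0" for i
  proof -
    define w where "w = diff_op (\<sigma> i) z"
    have "w * pcnj (\<sigma> i) \<in> pos_ideal"
      by (intro pos_ideal_mult_left pcnj_pos_ideal generator_in_pos_ideal)
    hence "0 = fischer (w * pcnj (\<sigma> i)) z" using * by simp
    also have "\<dots> = fischer w w"
      by (simp add: fischer_def diff_op_mult pcnj_diff_op w_def)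
    finally show ?thesis using fischer_self_eq_0[of w] by (simp add: w_def)
  qed
  thus ?thesis by (simp add: harmonics_def)
qed

lemma harmonic_decomposition:
  assumes "homogeneous d f"
  obtains h p where "f = h + p" "h \<in> harmonics_deg \<sigma> d" "p \<in> pos_ideal" "homogeneous d p"
proof -
  define Id where "Id = {p \<in> pos_ideal. homogeneous d p}"
  have sub: "cpoly.subspace Id"
    unfolding cpoly.subspace_def Id_def pscale_def
    by (simp add: pos_ideal_add pos_ideal_mult_left homogeneous_add homogeneous_pconst_mult)
  obtain B where B: "B \<subseteq> Id" "cpoly.independent B" "Id \<subseteq> cpoly.span B"
    by (rule cpoly.basis_exists[of Id])
  have "B \<subseteq> cpoly.span (monomials d)"
    using B(1) homogeneous_in_span_monomials by (auto simp: Id_def)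
  hence "finite B" using cpoly.independent_span_bound[of "monomials d" B] B(2) by simp
  moreover have "cpoly.span B = Id"
    using B(3) cpoly.span_minimal[OF B(1) sub] by (rule subset_antisym[rotated])
  ultimately obtain p where p: "p \<in> Id" "\<forall>b\<in>Id. fischer b (f - p) = 0"
    using fischer_projection[of B f] by metis
  have hom: "homogeneous d (f - p)" using assms p(1) by (simp add: Id_def homogeneous_diff)
  hence "f - p \<in> harmonics \<sigma>"
    using p(2) by (intro orthogonal_pos_ideal_harmonic[of d]) (simp_all add: Id_def)
  hence "f - p \<in> harmonics_deg \<sigma> d" using hom by (simp add: harmonics_deg_def)
  thus ?thesis using that[of "f - p" p] p(1) by (simp add: Id_def)
qed

end

section \<open>Dimensions of spaces of covariants\<close>

text \<open>Let \<open>C\<close> be a basis of the image \<open>Y\<close> of the projection, and write \<open>\<pi> (e i) = \<Sum> b i c c\<close> with \<open>c\<close> in \<open>C\<close>. Applying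
  \<open>\<pi>\<close> to the expansion of \<open>c\<close> gives \<open>\<Sum> coord i c b i c = 1\<close>, the sum over \<open>i\<close>, so the trace is a sum of ones over \<open>C\<close>.\<close>

lemma (in vector_space) dim_eq_trace_projection:
  assumes fin: "finite I" and Y: "subspace Y"
    and coord: "\<And>y. y \<in> Y \<Longrightarrow> y = (\<Sum>i\<in>I. scale (coord i y) (e i))"
    and coord_add: "\<And>i x y. coord i (x + y) = coord i x + coord i y"
    and coord_scale: "\<And>i c x. coord i (scale c x) = c * coord i x"
    and proj_add: "\<And>x y. \<pi> (x + y) = \<pi> x + \<pi> y"
    and proj_scale: "\<And>c x. \<pi> (scale c x) = scale c (\<pi> x)"
    and proj_id: "\<And>y. y \<in> Y \<Longrightarrow> \<pi> y = y"
    and proj_in: "\<And>i. i \<in> I \<Longrightarrow> \<pi> (e i) \<in> Y"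
  shows "of_nat (dim Y) = (\<Sum>i\<in>I. coord i (\<pi> (e i)))"
proof -
  obtain C where C: "C \<subseteq> Y" "independent C" "Y \<subseteq> span C" "card C = dim Y"
    by (rule basis_exists)
  have "Y \<subseteq> span (e ` I)"
  proof
    fix y assume "y \<in> Y"
    have "(\<Sum>i\<in>I. scale (coord i y) (e i)) \<in> span (e ` I)"
      by (intro span_sum span_scale span_base) auto
    thus "y \<in> span (e ` I)" unfolding coord[OF \<open>y \<in> Y\<close>, symmetric] .
  qed
  hence finC: "finite C"
    using independent_span_bound[of "e ` I" C] C(1,2) fin by auto
  have coord_0: "coord i 0 = 0" for i
    using coord_scale[of i 0 0] by simp
  have coord_sum: "coord i (sum f A) = (\<Sum>a\<in>A. coord i (f a))" if "finite A" for i f and A :: "'b set"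
    using that by induction (simp_all add: coord_0 coord_add)
  have proj_0: "\<pi> 0 = 0"
    using proj_add[of 0 0] by simp
  have proj_sum: "\<pi> (sum f A) = (\<Sum>a\<in>A. \<pi> (f a))" if "finite A" for f and A :: "'c set"
    using that by induction (simp_all add: proj_0 proj_add)
  have "\<exists>b. \<pi> (e i) = (\<Sum>c\<in>C. scale (b c) c)" if "i \<in> I" for i
    using proj_in[OF that] C(3) span_finite[OF finC] by blast
  then obtain b where b: "\<And>i. i \<in> I \<Longrightarrow> \<pi> (e i) = (\<Sum>c\<in>C. scale (b i c) c)" by metis
  have dual: "(\<Sum>i\<in>I. coord i c * b i c) = 1" if c: "c \<in> C" for c
  proof -
    have "c \<in> Y" using c C(1) by auto
    hence "c = \<pi> (\<Sum>i\<in>I. scale (coord i c) (e i))" by (metis coord proj_id)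
    also have "\<dots> = (\<Sum>i\<in>I. scale (coord i c) (\<pi> (e i)))"
      using fin by (simp add: proj_sum proj_scale)
    also have "\<dots> = (\<Sum>i\<in>I. \<Sum>c'\<in>C. scale (coord i c * b i c') c')"
      by (intro sum.cong refl) (simp add: b scale_sum_right)
    also have "\<dots> = (\<Sum>c'\<in>C. scale (\<Sum>i\<in>I. coord i c * b i c') c')"
      by (subst sum.swap) (simp add: scale_sum_left)
    finally have "(\<Sum>c'\<in>C. scale (\<Sum>i\<in>I. coord i c * b i c') c') - c = 0"
      by (rule eq_iff_diff_eq_0[THEN iffD1, OF sym])
    moreover have "(\<Sum>c'\<in>C. scale (if c' = c then 1 else 0) c') = c"
    proof -
      have "(\<Sum>c'\<in>C. scale (if c' = c then 1 else 0) c') = (\<Sum>c'\<in>C. if c' = c then c else 0)"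
        by (intro sum.cong) auto
      thus ?thesis using c finC by simp
    qed
    ultimately have "(\<Sum>c'\<in>C. scale ((\<Sum>i\<in>I. coord i c * b i c') - (if c' = c then 1 else 0)) c') = 0"
      by (simp add: scale_left_diff_distrib sum_subtractf)
    from independentD[OF C(2) finC subset_refl this c] show ?thesis by simp
  qed
  have "(\<Sum>i\<in>I. coord i (\<pi> (e i))) = (\<Sum>i\<in>I. \<Sum>c\<in>C. b i c * coord i c)"
    by (intro sum.cong refl) (simp add: b coord_sum[OF finC] coord_scale)
  also have "\<dots> = (\<Sum>c\<in>C. \<Sum>i\<in>I. coord i c * b i c)"
    by (subst sum.swap) (simp add: mult.commute)
  also have "\<dots> = (\<Sum>c\<in>C. 1)" by (intro sum.cong refl dual)
  finally show ?thesis using C(4) by simp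
qed

lemma (in vector_space) independent_family:
  assumes "finite L" "\<And>c. (\<Sum>l\<in>L. scale (c l) (\<Phi> l)) = 0 \<Longrightarrow> \<forall>l\<in>L. c l = 0"
  shows "inj_on \<Phi> L \<and> independent (\<Phi> ` L)"
proof
  show inj: "inj_on \<Phi> L"
  proof (rule inj_onI, rule ccontr)
    fix l l' assume l: "l \<in> L" "l' \<in> L" "\<Phi> l = \<Phi> l'" "l \<noteq> l'"
    define c :: "_ \<Rightarrow> 'a" where "c x = (if x = l then 1 else if x = l' then - 1 else 0)" for x
    have "(\<Sum>x\<in>L. scale (c x) (\<Phi> x)) = (\<Sum>x\<in>{l,l'}. scale (c x) (\<Phi> x))"
      using assms(1) l by (intro sum.mono_neutral_right) (auto simp: c_def)
    also have "\<dots> = 0" using l by (simp add: c_def)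
    finally have "c l = 0" using assms(2) l(1) by blast
    thus False by (simp add: c_def)
  qed
  show "independent (\<Phi> ` L)"
  proof (rule independent_if_scalars_zero)
    fix f x assume "(\<Sum>x\<in>\<Phi> ` L. scale (f x) x) = 0" "x \<in> \<Phi> ` L"
    thus "f x = 0" using assms(2)[of "\<lambda>l. f (\<Phi> l)"] inj by (auto simp: sum.reindex)
  qed (use assms(1) in simp)
qed

subsection \<open>Linear maps into polynomials\<close>

interpretation covs: vector_space "fun_scale :: complex \<Rightarrow> (complex Matrix.vec \<Rightarrow> ('n::finite) cpoly) \<Rightarrow> _"
  by (rule vector_space_fun_scale)

definition linear_maps :: "nat \<Rightarrow> ('n::finite) cpoly set \<Rightarrow> (complex Matrix.vec \<Rightarrow> 'n cpoly) set" where
  "linear_maps m H = {f.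
     (\<forall>v\<in>carrier_vec m. f v \<in> H) \<and>
     (\<forall>v. v \<notin> carrier_vec m \<longrightarrow> f v = 0) \<and>
     (\<forall>v\<in>carrier_vec m. \<forall>w\<in>carrier_vec m. f (v + w) = f v + f w) \<and>
     (\<forall>c. \<forall>v\<in>carrier_vec m. f (c \<cdot>\<^sub>v v) = pconst c * f v)}"

lemma gmodule_hom_conv: "gmodule_hom G W H = {f \<in> linear_maps (gdim W) H.
    \<forall>g\<in>G. \<forall>v\<in>carrier_vec (gdim W). f (gmat W g *\<^sub>v v) = pact g (f v)}"
  by (auto simp: gmodule_hom_def linear_maps_def)

lemma linear_maps_expand:
  assumes f: "f \<in> linear_maps m H" and v: "v \<in> carrier_vec m"
  shows "f v = (\<Sum>i<m. pconst (vec_index v i) * f (unit_vec m i))"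
proof -
  define w where "w k = Matrix.vec m (\<lambda>i. if i < k then vec_index v i else 0)" for k
  have add: "f (x + y) = f x + f y" if "x \<in> carrier_vec m" "y \<in> carrier_vec m" for x y
    using f that by (auto simp: linear_maps_def)
  have scale: "f (c \<cdot>\<^sub>v x) = pconst c * f x" if "x \<in> carrier_vec m" for c x
    using f that by (auto simp: linear_maps_def)
  have "f (w k) = (\<Sum>i<k. pconst (vec_index v i) * f (unit_vec m i))" if "k \<le> m" for k
    using that
  proof (induction k)
    case 0
    have "w 0 = 0 \<cdot>\<^sub>v w 0" by (intro eq_vecI) (auto simp: w_def)
    hence "f (w 0) = pconst 0 * f (w 0)" by (metis scale w_def vec_carrier)
    thus ?case by simp
  next
    case (Suc k)
    have "w (Suc k) = w k + vec_index v k \<cdot>\<^sub>v unit_vec m k"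
      using Suc.prems by (intro eq_vecI) (auto simp: w_def unit_vec_def less_Suc_eq)
    hence "f (w (Suc k)) = f (w k) + pconst (vec_index v k) * f (unit_vec m k)"
      by (simp add: add scale w_def)
    thus ?case using Suc by simp
  qed
  moreover have "w m = v" using v by (intro eq_vecI) (auto simp: w_def)
  ultimately show ?thesis by auto
qed

definition from_basis :: "nat \<Rightarrow> (nat \<Rightarrow> ('n::finite) cpoly) \<Rightarrow> complex Matrix.vec \<Rightarrow> 'n cpoly" where
  "from_basis m b v = (if v \<in> carrier_vec m then \<Sum>i<m. pconst (vec_index v i) * b i else 0)"

lemma from_basis_linear:
  assumes "cpoly.subspace H" "\<And>i. i < m \<Longrightarrow> b i \<in> H"
  shows "from_basis m b \<in> linear_maps m H"
proof -
  have "(\<Sum>i<m. pscale (vec_index v i) (b i)) \<in> H" for v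
    using assms by (intro cpoly.subspace_sum cpoly.subspace_scale) auto
  thus ?thesis
    by (auto simp: linear_maps_def from_basis_def pscale_def pconst_add pconst_mult distrib_right
          sum.distrib sum_distrib_left mult.assoc)
qed

lemma subspace_homogeneous: "cpoly.subspace {p. homogeneous d p}"
  by (simp add: cpoly.subspace_def pscale_def homogeneous_add homogeneous_pconst_mult)

lemma subspace_harmonics_deg: "cpoly.subspace (harmonics_deg \<sigma> d)"
  by (simp add: cpoly.subspace_def harmonics_deg_def harmonics_def pscale_def homogeneous_add
        homogeneous_pconst_mult diff_op_add_right diff_op_scale_right)

lemma subspace_gmodule_hom:
  assumes "cpoly.subspace H"
  shows "covs.subspace (gmodule_hom G W H)"
proof (rule covs.subspaceI)
  have [simp]: "0 \<in> H" using assms by (rule cpoly.subspace_0)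
  show "0 \<in> gmodule_hom G W H" by (simp add: gmodule_hom_def)
  show "f + f' \<in> gmodule_hom G W H" if "f \<in> gmodule_hom G W H" "f' \<in> gmodule_hom G W H" for f f'
    using that cpoly.subspace_add[OF assms] by (simp add: gmodule_hom_def pact_add distrib_left)
  show "fun_scale c f \<in> gmodule_hom G W H" if "f \<in> gmodule_hom G W H" for c f
    using that cpoly.subspace_scale[OF assms]
    by (simp add: gmodule_hom_def fun_scale_def pscale_def pact_mult distrib_left mult.left_commute)
qed

lemma gmodule_hom_mono: "H \<subseteq> H' \<Longrightarrow> gmodule_hom G W H \<subseteq> gmodule_hom G W H'"
  by (auto simp: gmodule_hom_def)

definition gtrace :: "'g gmodule \<Rightarrow> 'g \<Rightarrow> complex" where
  "gtrace W g = (\<Sum>i<gdim W. gmat W g $$ (i, i))"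

text \<open>The trace of \<open>p \<mapsto> p(A x)\<close> on the polynomials of degree \<open>d\<close>, in the basis of monomials.\<close>

definition sym_trace :: "complex^'n^'n \<Rightarrow> nat \<Rightarrow> complex" where
  "sym_trace A d = (\<Sum>m\<in>{m :: ('n::finite) \<Rightarrow>\<^sub>0 nat. mdeg m = d}. lookup (lsubst A (single m 1)) m)"

locale covariants = basic_invariants G \<sigma> for G :: "('n::finite) rmat set" and \<sigma> +
  fixes W :: "'n rmat gmodule"
  assumes gmodule: "is_gmodule G W"
begin

lemma gmat_carrier: "g \<in> G \<Longrightarrow> gmat W g \<in> carrier_mat (gdim W) (gdim W)"
  using gmodule by (simp add: is_gmodule_def)

lemma gmat_vec_carrier [simp]: "g \<in> G \<Longrightarrow> v \<in> carrier_vec (gdim W) \<Longrightarrow> gmat W g *\<^sub>v v \<in> carrier_vec (gdim W)"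
  by (rule mult_mat_vec_carrier[OF gmat_carrier])

lemma gmat_vec_add: "g \<in> G \<Longrightarrow> v \<in> carrier_vec (gdim W) \<Longrightarrow> w \<in> carrier_vec (gdim W) \<Longrightarrow>
    gmat W g *\<^sub>v (v + w) = gmat W g *\<^sub>v v + gmat W g *\<^sub>v w"
  by (rule mult_add_distrib_mat_vec[OF gmat_carrier])

lemma gmat_vec_smult: "g \<in> G \<Longrightarrow> v \<in> carrier_vec (gdim W) \<Longrightarrow>
    gmat W g *\<^sub>v (c \<cdot>\<^sub>v v) = c \<cdot>\<^sub>v (gmat W g *\<^sub>v v)"
  by (rule mult_mat_vec[OF gmat_carrier])

lemma gmat_vec_mult: "g \<in> G \<Longrightarrow> h \<in> G \<Longrightarrow> v \<in> carrier_vec (gdim W) \<Longrightarrow>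
    gmat W g *\<^sub>v (gmat W h *\<^sub>v v) = gmat W (g ** h) *\<^sub>v v"
  using assoc_mult_mat_vec[OF gmat_carrier gmat_carrier, of g h v] gmodule by (simp add: is_gmodule_def)

lemma gmat_vec_one: "v \<in> carrier_vec (gdim W) \<Longrightarrow> gmat W (mat 1) *\<^sub>v v = v"
  using gmodule by (simp add: is_gmodule_def)

text \<open>The average over the group of \<open>g f g\<inverse>\<close>; it projects the linear maps onto the equivariant ones.\<close>

definition cov_avg :: "(complex Matrix.vec \<Rightarrow> 'n cpoly) \<Rightarrow> complex Matrix.vec \<Rightarrow> 'n cpoly" where
  "cov_avg f v = (if v \<in> carrier_vec (gdim W)
     then pconst (1 / of_nat (card G)) * (\<Sum>g\<in>G. pact g (f (gmat W (matrix_inv g) *\<^sub>v v))) else 0)"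

lemma cov_avg_add: "cov_avg (f + f') = cov_avg f + cov_avg f'"
  by (auto simp: cov_avg_def fun_eq_iff pact_add sum.distrib distrib_left)

lemma cov_avg_sum: "cov_avg (\<lambda>v. \<Sum>a\<in>A. f a v) = (\<lambda>v. \<Sum>a\<in>A. cov_avg (f a) v)"
proof
  fix v
  show "cov_avg (\<lambda>v. \<Sum>a\<in>A. f a v) v = (\<Sum>a\<in>A. cov_avg (f a) v)"
    by (simp add: cov_avg_def pact_sum sum_distrib_left) (intro impI, subst sum.swap, rule refl)
qed

lemma cov_avg_invariant_mult:
  "u \<in> invariants G \<Longrightarrow> cov_avg (\<lambda>v. u * f v) = (\<lambda>v. u * cov_avg f v)"
  by (auto simp: cov_avg_def fun_eq_iff pact_mult invariants_def sum_distrib_left mult_ac)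

lemma cov_avg_scale: "cov_avg (fun_scale c f) = fun_scale c (cov_avg f)"
  using cov_avg_invariant_mult[of "pconst c" f] by (simp add: fun_scale_def)

lemma cov_avg_in:
  assumes H: "cpoly.subspace H" "\<And>g p. g \<in> G \<Longrightarrow> p \<in> H \<Longrightarrow> pact g p \<in> H"
    and f: "f \<in> linear_maps (gdim W) H"
  shows "cov_avg f \<in> gmodule_hom G W H"
proof -
  have "cov_avg f v \<in> H" if v: "v \<in> carrier_vec (gdim W)" for v
  proof -
    have "(\<Sum>g\<in>G. pact g (f (gmat W (matrix_inv g) *\<^sub>v v))) \<in> H"
      using f v by (intro cpoly.subspace_sum H) (auto simp: linear_maps_def)
    thus ?thesis using cpoly.subspace_scale[OF H(1)] v by (auto simp: cov_avg_def pscale_def)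
  qed
  moreover have "cov_avg f (gmat W h *\<^sub>v v) = pact h (cov_avg f v)" if h: "h \<in> G" and v: "v \<in> carrier_vec (gdim W)" for h v
  proof -
    have "(\<Sum>g\<in>G. pact (h ** g) (f (gmat W (matrix_inv (h ** g)) *\<^sub>v (gmat W h *\<^sub>v v))))
        = (\<Sum>g\<in>G. pact g (f (gmat W (matrix_inv g) *\<^sub>v (gmat W h *\<^sub>v v))))"
      by (rule sum.reindex_bij_betw[OF bij_betw_mult_left[OF h]])
    moreover have "gmat W (matrix_inv (h ** g)) *\<^sub>v (gmat W h *\<^sub>v v) = gmat W (matrix_inv g) *\<^sub>v v" if "g \<in> G" for g
    proof -
      have "matrix_inv g ** matrix_inv h ** h = matrix_inv g"
        using h by (simp add: matrix_inv_G flip: matrix_mul_assoc)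
      thus ?thesis using that h v by (simp add: gmat_vec_mult matrix_inv_mult_G)
    qed
    ultimately show ?thesis
      using h v by (simp add: cov_avg_def pact_mult pact_sum pact_pact)
  qed
  moreover have "cov_avg f (v + w) = cov_avg f v + cov_avg f w"
    if "v \<in> carrier_vec (gdim W)" "w \<in> carrier_vec (gdim W)" for v w
    using f that by (auto simp: cov_avg_def linear_maps_def gmat_vec_add pact_add sum.distrib distrib_left)
  moreover have "cov_avg f (c \<cdot>\<^sub>v v) = pconst c * cov_avg f v" if "v \<in> carrier_vec (gdim W)" for c v
    using f that by (auto simp: cov_avg_def linear_maps_def gmat_vec_smult pact_mult sum_distrib_left mult_ac)
  ultimately show ?thesis by (auto simp: gmodule_hom_def cov_avg_def)
qed

lemma cov_avg_id:
  assumes "f \<in> gmodule_hom G W H"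
  shows "cov_avg f = f"
proof
  fix v
  show "cov_avg f v = f v"
  proof (cases "v \<in> carrier_vec (gdim W)")
    case True
    have "pact g (f (gmat W (matrix_inv g) *\<^sub>v v)) = f v" if "g \<in> G" for g
    proof -
      have "pact g (f (gmat W (matrix_inv g) *\<^sub>v v)) = f (gmat W g *\<^sub>v (gmat W (matrix_inv g) *\<^sub>v v))"
        using assms that True by (simp add: gmodule_hom_def)
      thus ?thesis using that True by (simp add: gmat_vec_mult gmat_vec_one matrix_inv_G)
    qed
    hence "cov_avg f v = pconst (1 / of_nat (card G)) * (\<Sum>g\<in>G. f v)"
      using True by (simp add: cov_avg_def del: sum_constant)
    also have "\<dots> = (\<Sum>g\<in>G. pconst (1 / of_nat (card G))) * f v"
      by (simp only: sum_distrib_left sum_distrib_right)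
    also have "\<dots> = f v" unfolding pconst_sum [symmetric] by simp
    finally show ?thesis .
  next
    case False
    thus ?thesis using assms by (simp add: cov_avg_def gmodule_hom_def)
  qed
qed

end

subsection \<open>Molien's formula\<close>

lemma sum_fun_apply: "sum f A x = (\<Sum>a\<in>A. f a x)"
  by (induction A rule: infinite_finite_induct) auto

lemma lookup_fun_scale: "lookup (fun_scale c f v) m = c * lookup (f v) m"
  by (simp add: fun_scale_def)

lemma homogeneous_expand:
  assumes "homogeneous d p"
  shows "p = (\<Sum>m\<in>{m. mdeg m = d}. pscale (lookup p m) (single m 1))"
proof -
  have "(\<Sum>m\<in>keys p. pscale (lookup p m) (single m 1))
      = (\<Sum>m\<in>{m. mdeg m = d}. pscale (lookup p m) (single m 1))"
    using assms by (intro sum.mono_neutral_left finite_mdeg) (auto simp: homogeneous_def mdeg_def in_keys_iff)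
  moreover have "p = (\<Sum>m\<in>keys p. pscale (lookup p m) (single m 1))"
    unfolding pscale_def pconst_single mult_1_right by (rule cpoly_expand)
  ultimately show ?thesis by (rule trans[rotated])
qed

context basic_invariants
begin

definition invariants_deg :: "nat \<Rightarrow> 'n cpoly set" where
  "invariants_deg d = {u \<in> invariants G. homogeneous d u}"

lemma subspace_invariants_deg: "cpoly.subspace (invariants_deg d)"
  by (simp add: cpoly.subspace_def invariants_deg_def pscale_def homogeneous_add
        homogeneous_pconst_mult invariants_add invariants_mult)

lemma avg_id:
  assumes "u \<in> invariants G"
  shows "avg u = u"
proof -
  have "avg (1 * u) = avg 1 * u" using assms by (rule avg_invariant_mult)
  thus ?thesis using avg_pconst[of 1] by simp
qed

lemma avg_add: "avg (p + q) = avg p + avg q"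
  by (simp add: avg_def pact_add sum.distrib distrib_left)

lemma avg_scale: "avg (pconst c * p) = pconst c * avg p"
  using avg_invariant_mult[of "pconst c" p] by (simp add: mult.commute)

lemma sum_matrix_inv_G: "(\<Sum>g\<in>G. f (matrix_inv g)) = (\<Sum>g\<in>G. f g)"
  by (rule sum.reindex_bij_betw[OF bij_betw_inv])

text \<open>The dimension of the invariants is the trace of the Reynolds operator.\<close>

lemma dim_invariants_deg:
  "of_nat (cpoly.dim (invariants_deg d)) = (\<Sum>g\<in>G. sym_trace (cmat g) d) / of_nat (card G)"
proof -
  have "of_nat (cpoly.dim (invariants_deg d))
      = (\<Sum>m\<in>{m. mdeg m = d}. lookup (avg (single m 1)) m)"
  proof (rule cpoly.dim_eq_trace_projection[where \<pi> = avg and e = "\<lambda>m. single m 1"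
        and coord = "\<lambda>m p. lookup p m"])
    show "y = (\<Sum>m\<in>{m. mdeg m = d}. pscale (lookup y m) (single m 1))"
      if "y \<in> invariants_deg d" for y
      using that by (intro homogeneous_expand) (simp add: invariants_deg_def)
    show "avg (single m 1) \<in> invariants_deg d" if "m \<in> {m. mdeg m = d}" for m
      using that homogeneous_single[of m 1] by (simp add: invariants_deg_def avg_invariant homogeneous_avg)
    show "cpoly.subspace (invariants_deg d)" by (rule subspace_invariants_deg)
  qed (simp_all add: finite_mdeg lookup_add pscale_def avg_add avg_scale avg_id invariants_deg_def)
  also have "\<dots> = (\<Sum>m\<in>{m. mdeg m = d}. \<Sum>g\<in>G. lookup (pact g (single m 1)) m / of_nat (card G))"
    by (simp add: avg_def lookup_sum sum_divide_distrib)
  also have "\<dots> = (\<Sum>g\<in>G. sym_trace (cmat (matrix_inv g)) d / of_nat (card G))"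
    by (subst sum.swap) (simp add: sym_trace_def sum_divide_distrib pact_conv_lsubst)
  also have "\<dots> = (\<Sum>g\<in>G. sym_trace (cmat g) d / of_nat (card G))"
    by (rule sum_matrix_inv_G)
  finally show ?thesis by (simp add: sum_divide_distrib)
qed

end

context covariants
begin

abbreviation covs_deg :: "nat \<Rightarrow> (complex Matrix.vec \<Rightarrow> 'n cpoly) set" where
  "covs_deg d \<equiv> gmodule_hom G W {p. homogeneous d p}"

text \<open>The map that sends the vector with coordinates \<open>v\<^sub>j\<close> to \<open>v\<^sub>i\<close> times the monomial \<open>k\<close>; these maps
  form a basis of the linear maps with values in a homogeneous component.\<close>

definition elem_map :: "('n \<Rightarrow>\<^sub>0 nat) \<times> nat \<Rightarrow> complex Matrix.vec \<Rightarrow> 'n cpoly" where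
  "elem_map = (\<lambda>(k, i) v. if v \<in> carrier_vec (gdim W) then single k (vec_index v i) else 0)"

lemma covs_expand:
  assumes f: "f \<in> linear_maps (gdim W) {p. homogeneous d p}"
  shows "f = (\<Sum>x\<in>{k. mdeg k = d} \<times> {..<gdim W}.
     fun_scale (lookup (f (unit_vec (gdim W) (snd x))) (fst x)) (elem_map x))" (is "f = ?sum")
proof
  fix v
  show "f v = ?sum v"
  proof (cases "v \<in> carrier_vec (gdim W)")
    case True
    have hom: "homogeneous d (f (unit_vec (gdim W) i))" for i
      using f by (auto simp: linear_maps_def)
    have "f v = (\<Sum>i<gdim W. pconst (vec_index v i) * f (unit_vec (gdim W) i))"
      by (rule linear_maps_expand[OF f True])
    also have "\<dots> = (\<Sum>i<gdim W. \<Sum>k\<in>{k. mdeg k = d}.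
        single k (lookup (f (unit_vec (gdim W) i)) k * vec_index v i))"
    proof (intro sum.cong refl)
      fix i
      have "pconst (vec_index v i) * f (unit_vec (gdim W) i) = pconst (vec_index v i) * (\<Sum>k\<in>{k. mdeg k = d}.
          pscale (lookup (f (unit_vec (gdim W) i)) k) (single k 1))"
        by (subst homogeneous_expand[OF hom]) (rule refl)
      also have "\<dots> = (\<Sum>k\<in>{k. mdeg k = d}.
        single k (lookup (f (unit_vec (gdim W) i)) k * vec_index v i))"
        by (simp add: sum_distrib_left pscale_def pconst_single mult.commute[of _ "vec_index v i"])
      finally show "pconst (vec_index v i) * f (unit_vec (gdim W) i) = (\<Sum>k\<in>{k. mdeg k = d}.
        single k (lookup (f (unit_vec (gdim W) i)) k * vec_index v i))" .
    qed
    also have "\<dots> = (\<Sum>x\<in>{k. mdeg k = d} \<times> {..<gdim W}.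
        fun_scale (lookup (f (unit_vec (gdim W) (snd x))) (fst x)) (elem_map x) v)"
      by (subst sum.swap)
         (simp add: sum.cartesian_product case_prod_unfold fun_scale_def elem_map_def True pconst_single)
    finally show ?thesis by (simp add: sum_fun_apply)
  next
    case False
    thus ?thesis using f by (simp add: sum_fun_apply fun_scale_def elem_map_def case_prod_unfold linear_maps_def)
  qed
qed

lemma gmodule_hom_linear: "f \<in> gmodule_hom G W H \<Longrightarrow> f \<in> linear_maps (gdim W) H"
  by (simp add: gmodule_hom_conv)

lemma elem_map_linear: "mdeg (fst x) = d \<Longrightarrow> snd x < gdim W \<Longrightarrow> elem_map x \<in> linear_maps (gdim W) {p. homogeneous d p}"
  using homogeneous_single[of "fst x"]
  by (cases x) (auto simp: linear_maps_def elem_map_def single_add [symmetric] pconst_single)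

lemma finite_dim_covs: "covs_deg d \<subseteq> covs.span (elem_map ` ({k. mdeg k = d} \<times> {..<gdim W}))"
proof
  fix f assume "f \<in> covs_deg d"
  hence *: "f \<in> linear_maps (gdim W) {p. homogeneous d p}" by (rule gmodule_hom_linear)
  have "(\<Sum>x\<in>{k. mdeg k = d} \<times> {..<gdim W}.
     fun_scale (lookup (f (unit_vec (gdim W) (snd x))) (fst x)) (elem_map x))
     \<in> covs.span (elem_map ` ({k. mdeg k = d} \<times> {..<gdim W}))"
    by (intro covs.span_sum covs.span_scale covs.span_base imageI)
  thus "f \<in> covs.span (elem_map ` ({k. mdeg k = d} \<times> {..<gdim W}))"
    by (simp only: covs_expand[OF *, symmetric])
qed

text \<open>The operator \<open>f \<mapsto> g f g\<inverse>\<close> has as trace the product of the traces of \<open>g\<inverse>\<close> on the module and of \<open>g\<close> on the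
  polynomials. As the action on polynomials substitutes the inverse matrix, only \<open>g\<inverse>\<close> occurs, and the
  sum may be taken over \<open>g\<close>.\<close>

lemma dim_covs_deg:
  "of_nat (covs.dim (covs_deg d)) = (\<Sum>g\<in>G. gtrace W g * sym_trace (cmat g) d) / of_nat (card G)"
proof -
  let ?I = "{k :: 'n \<Rightarrow>\<^sub>0 nat. mdeg k = d} \<times> {..<gdim W}"
  let ?F = "\<lambda>g x. gmat W (matrix_inv g) $$ (snd x, snd x)
      * lookup (lsubst (cmat (matrix_inv g)) (single (fst x) 1)) (fst x) / of_nat (card G)"
  have "of_nat (covs.dim (covs_deg d))
      = (\<Sum>x\<in>?I. lookup (cov_avg (elem_map x) (unit_vec (gdim W) (snd x))) (fst x))"
  proof (rule covs.dim_eq_trace_projection[where \<pi> = cov_avg and e = elem_map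
        and coord = "\<lambda>x f. lookup (f (unit_vec (gdim W) (snd x))) (fst x)"])
    show "y = (\<Sum>x\<in>?I. fun_scale (lookup (y (unit_vec (gdim W) (snd x))) (fst x)) (elem_map x))"
      if "y \<in> covs_deg d" for y
      by (rule covs_expand[OF gmodule_hom_linear[OF that]])
    show "cov_avg (elem_map x) \<in> covs_deg d" if "x \<in> ?I" for x
      using that by (intro cov_avg_in subspace_homogeneous elem_map_linear) (auto simp: homogeneous_pact)
    show "finite ?I" by (simp add: finite_mdeg)
    show "covs.subspace (covs_deg d)" by (intro subspace_gmodule_hom subspace_homogeneous)
    show "cov_avg y = y" if "y \<in> covs_deg d" for y by (rule cov_avg_id[OF that])
  qed (simp_all add: lookup_add cov_avg_add cov_avg_scale lookup_fun_scale)
  also have "\<dots> = (\<Sum>x\<in>?I. \<Sum>g\<in>G. ?F g x)"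
  proof (intro sum.cong refl)
    fix x assume "x \<in> ?I"
    then obtain k i where x: "x = (k, i)" "mdeg k = d" "i < gdim W" by auto
    have "pact g (elem_map x (gmat W (matrix_inv g) *\<^sub>v unit_vec (gdim W) i))
        = pconst (gmat W (matrix_inv g) $$ (i, i)) * pact g (single k 1)" if "g \<in> G" for g
    proof -
      have "vec_index (gmat W (matrix_inv g) *\<^sub>v unit_vec (gdim W) i) i = gmat W (matrix_inv g) $$ (i, i)"
        using gmat_carrier[of "matrix_inv g"] that x(3) by (simp add: scalar_prod_right_unit)
      hence "elem_map x (gmat W (matrix_inv g) *\<^sub>v unit_vec (gdim W) i)
          = pconst (gmat W (matrix_inv g) $$ (i, i)) * single k 1"
        using that by (simp add: elem_map_def x(1) pconst_single)
      thus ?thesis by (simp add: pact_mult)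
    qed
    thus "lookup (cov_avg (elem_map x) (unit_vec (gdim W) (snd x))) (fst x)
        = (\<Sum>g\<in>G. ?F g x)"
      using x by (simp add: cov_avg_def lookup_sum sum_divide_distrib pact_conv_lsubst)
  qed
  also have "\<dots> = (\<Sum>g\<in>G. \<Sum>x\<in>?I. ?F g x)"
    by (rule sum.swap)
  also have "\<dots> = (\<Sum>g\<in>G. gtrace W (matrix_inv g) * sym_trace (cmat (matrix_inv g)) d / of_nat (card G))"
  proof (intro sum.cong refl)
    fix g
    have "gtrace W (matrix_inv g) * sym_trace (cmat (matrix_inv g)) d
       = (\<Sum>k\<in>{k. mdeg k = d}. \<Sum>i<gdim W. gmat W (matrix_inv g) $$ (i, i)
      * lookup (lsubst (cmat (matrix_inv g)) (single k 1)) k)"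
      unfolding gtrace_def sym_trace_def sum_product by (rule sum.swap)
    also have "\<dots> / of_nat (card G) = (\<Sum>x\<in>?I. ?F g x)"
      unfolding sum.cartesian_product sum_divide_distrib by (simp add: case_prod_unfold)
    finally show "(\<Sum>x\<in>?I. ?F g x)
      = gtrace W (matrix_inv g) * sym_trace (cmat (matrix_inv g)) d / of_nat (card G)" by (rule sym)
  qed
  also have "\<dots> = (\<Sum>g\<in>G. gtrace W g * sym_trace (cmat g) d / of_nat (card G))"
    by (rule sum_matrix_inv_G)
  finally show ?thesis by (simp add: sum_divide_distrib)
qed

subsection \<open>Covariants are free over the invariants, with the harmonic covariants as basis\<close>

abbreviation harm_covs :: "nat \<Rightarrow> (complex Matrix.vec \<Rightarrow> 'n cpoly) set" where
  "harm_covs d \<equiv> gmodule_hom G W (harmonics_deg \<sigma> d)"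

definition cov_products :: "nat \<Rightarrow> (complex Matrix.vec \<Rightarrow> 'n cpoly) set" where
  "cov_products d = {\<lambda>v. u * h v |u h k. k \<le> d \<and> u \<in> invariants_deg k \<and> h \<in> harm_covs (d - k)}"

lemma cov_products_mult:
  assumes "x \<in> covs.span (cov_products d)" "u \<in> invariants_deg k"
  shows "(\<lambda>v. u * x v) \<in> covs.span (cov_products (k + d))"
proof -
  let ?S = "{x. (\<lambda>v. u * x v) \<in> covs.span (cov_products (k + d))}"
  have "covs.span (cov_products d) \<subseteq> ?S"
  proof (rule covs.span_minimal)
    show "covs.subspace ?S"
    proof (rule covs.subspaceI)
      show "0 \<in> ?S"
        using covs.span_zero by (simp add: zero_fun_def)
    next
      fix x y assume "x \<in> ?S"
        "y \<in> ?S"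
      hence "(\<lambda>v. u * x v) + (\<lambda>v. u * y v) \<in> covs.span (cov_products (k + d))"
        by (intro covs.span_add) auto
      thus "x + y \<in> ?S"
        by (simp add: plus_fun_def distrib_left)
    next
      fix c x assume "x \<in> ?S"
      hence "fun_scale c (\<lambda>v. u * x v) \<in> covs.span (cov_products (k + d))"
        by (intro covs.span_scale) auto
      thus "fun_scale c x \<in> ?S"
        by (simp add: fun_scale_def mult.left_commute)
    qed
  next
    show "cov_products d \<subseteq> ?S"
    proof
      fix x assume "x \<in> cov_products d"
      then obtain u' h k' where x: "x = (\<lambda>v. u' * h v)" "k' \<le> d" "u' \<in> invariants_deg k'" "h \<in> harm_covs (d - k')"
        by (auto simp: cov_products_def)
      have "u * u' \<in> invariants_deg (k + k')"
        using assms(2) x(3) by (simp add: invariants_deg_def invariants_mult homogeneous_mult)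
      moreover have "k + d - (k + k') = d - k'" by simp
      ultimately have "(\<lambda>v. u * x v) \<in> cov_products (k + d)"
        unfolding cov_products_def x(1)
        by (intro CollectI exI[of _ "u * u'"] exI[of _ h] exI[of _ "k + k'"]) (use x in \<open>simp add: mult.assoc\<close>)
      thus "x \<in> ?S"
        by (intro CollectI covs.span_base)
    qed
  qed
  thus ?thesis using assms(1) by auto
qed

lemma pos_ideal_homogeneous_expand:
  assumes "p \<in> pos_ideal" "homogeneous d p"
  obtains a where "p = (\<Sum>k\<in>UNIV. \<sigma> k * a k)" "\<And>k. gdeg k \<le> d \<Longrightarrow> homogeneous (d - gdeg k) (a k)"
    "\<And>k. d < gdeg k \<Longrightarrow> a k = 0"
proof -
  obtain a where a: "p = (\<Sum>k\<in>UNIV. \<sigma> k * a k)" using assms(1) by (rule pos_idealE)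
  define b where "b k = (if gdeg k \<le> d then hcomp (d - gdeg k) (a k) else 0)" for k
  have "p = hcomp d p" using assms(2) by (simp add: hcomp_homogeneous)
  also have "\<dots> = (\<Sum>k\<in>UNIV. \<sigma> k * b k)"
    unfolding a hcomp_sum
  proof (intro sum.cong refl)
    fix k show "hcomp d (\<sigma> k * a k) = \<sigma> k * b k"
      using hcomp_mult_homogeneous[OF homogeneous_generator, of d "a k" k]
      by (simp add: b_def mult.commute)
  qed
  finally show ?thesis using that[of b] by (simp add: b_def)
qed

text \<open>Induction on the degree. The values of \<open>f\<close> on the unit vectors are decomposed into a harmonic part and
  a combination of the generators with coefficients of smaller degree. The linear maps that these parts
  define need not be equivariant, but \<open>f\<close> is, so averaging them again gives a decomposition of \<open>f\<close>.\<close>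

lemma covs_deg_subset_span: "covs_deg d \<subseteq> covs.span (cov_products d)"
proof (induction d rule: less_induct)
  case (less d)
  let ?m = "gdim W" and ?H = "\<lambda>d. {p :: 'n cpoly. homogeneous d p}"
  show ?case
  proof
    fix f assume f: "f \<in> covs_deg d"
    define P where "P i h a \<longleftrightarrow> f (unit_vec ?m i) = h + (\<Sum>k\<in>UNIV. \<sigma> k * a k) \<and> h \<in> harmonics_deg \<sigma> d \<and>
        (\<forall>k. gdeg k \<le> d \<longrightarrow> homogeneous (d - gdeg k) (a k)) \<and> (\<forall>k. d < gdeg k \<longrightarrow> a k = 0)" for i h a
    have "\<exists>h a. P i h a" for i
    proof -
      have "homogeneous d (f (unit_vec ?m i))" using f by (simp add: gmodule_hom_def)
      then obtain h p where hp: "f (unit_vec ?m i) = h + p" "h \<in> harmonics_deg \<sigma> d" "p \<in> pos_ideal" "homogeneous d p"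
        by (rule harmonic_decomposition)
      obtain a where "p = (\<Sum>k\<in>UNIV. \<sigma> k * a k)" "\<And>k. gdeg k \<le> d \<Longrightarrow> homogeneous (d - gdeg k) (a k)"
        "\<And>k. d < gdeg k \<Longrightarrow> a k = 0"
        by (rule pos_ideal_homogeneous_expand[OF hp(3,4)]) blast
      hence "P i h a" using hp(1,2) by (simp add: P_def)
      thus ?thesis by blast
    qed
    then obtain h a where "\<And>i. P i (h i) (a i)" by metis
    hence ha: "\<And>i. f (unit_vec ?m i) = h i + (\<Sum>k\<in>UNIV. \<sigma> k * a i k)" "\<And>i. h i \<in> harmonics_deg \<sigma> d"
        "\<And>i k. gdeg k \<le> d \<Longrightarrow> homogeneous (d - gdeg k) (a i k)" "\<And>i k. d < gdeg k \<Longrightarrow> a i k = 0"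
      by (auto simp: P_def)
    define A where "A k = from_basis ?m (\<lambda>i. a i k)" for k
    have "f = from_basis ?m h + (\<lambda>v. \<Sum>k\<in>UNIV. \<sigma> k * A k v)"
    proof
      fix v
      show "f v = (from_basis ?m h + (\<lambda>v. \<Sum>k\<in>UNIV. \<sigma> k * A k v)) v"
      proof (cases "v \<in> carrier_vec ?m")
        case True
        have "f v = (\<Sum>i<?m. pconst (vec_index v i) * h i) + (\<Sum>i<?m. \<Sum>k\<in>UNIV. \<sigma> k * (pconst (vec_index v i) * a i k))"
          unfolding linear_maps_expand[OF gmodule_hom_linear[OF f] True] ha(1)
          by (simp add: distrib_left sum.distrib sum_distrib_left mult.left_commute)
        also have "(\<Sum>i<?m. \<Sum>k\<in>UNIV. \<sigma> k * (pconst (vec_index v i) * a i k)) = (\<Sum>k\<in>UNIV. \<sigma> k * A k v)"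
          by (subst sum.swap) (simp add: A_def from_basis_def True sum_distrib_left)
        finally show ?thesis using True by (simp add: from_basis_def)
      next
        case False
        thus ?thesis using f by (simp add: gmodule_hom_def A_def from_basis_def)
      qed
    qed
    hence "cov_avg f = cov_avg (from_basis ?m h) + (\<lambda>v. \<Sum>k\<in>UNIV. \<sigma> k * cov_avg (A k) v)"
      by (simp add: cov_avg_add cov_avg_sum cov_avg_invariant_mult)
    hence eq: "f = cov_avg (from_basis ?m h) + (\<Sum>k\<in>UNIV. (\<lambda>v. \<sigma> k * cov_avg (A k) v))"
      by (simp add: cov_avg_id[OF f] sum_fun_apply fun_eq_iff)
    have "cov_avg (from_basis ?m h) \<in> harm_covs d"
      by (intro cov_avg_in subspace_harmonics_deg from_basis_linear ha(2))
         (auto simp: harmonics_deg_def pact_harmonics homogeneous_pact)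
    hence "(\<lambda>v. 1 * cov_avg (from_basis ?m h) v) \<in> cov_products d"
      unfolding cov_products_def
      by (intro CollectI exI[of _ 1] exI[of _ "cov_avg (from_basis ?m h)"] exI[of _ 0])
         (simp add: invariants_deg_def)
    hence 1: "cov_avg (from_basis ?m h) \<in> covs.span (cov_products d)"
      using covs.span_base by auto
    have 2: "(\<lambda>v. \<sigma> k * cov_avg (A k) v) \<in> covs.span (cov_products d)" for k
    proof (cases "gdeg k \<le> d")
      case True
      have "cov_avg (A k) \<in> covs_deg (d - gdeg k)"
        unfolding A_def using ha(3)[OF True]
        by (intro cov_avg_in subspace_homogeneous from_basis_linear) (auto simp: homogeneous_pact)
      hence "cov_avg (A k) \<in> covs.span (cov_products (d - gdeg k))"
        using less.IH[of "d - gdeg k"] True gdeg_pos[of k] by auto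
      hence "(\<lambda>v. \<sigma> k * cov_avg (A k) v) \<in> covs.span (cov_products (gdeg k + (d - gdeg k)))"
        by (rule cov_products_mult) (simp add: invariants_deg_def homogeneous_generator)
      thus ?thesis using True by simp
    next
      case False
      hence "A k = (\<lambda>v. 0)" using ha(4) by (simp add: A_def from_basis_def fun_eq_iff)
      hence "(\<lambda>v. \<sigma> k * cov_avg (A k) v) = 0" by (simp add: cov_avg_def fun_eq_iff)
      thus ?thesis using covs.span_zero by simp
    qed
    show "f \<in> covs.span (cov_products d)"
      unfolding eq by (intro covs.span_add covs.span_sum 1 2)
  qed
qed

end

context covariants
begin

text \<open>Products of the members of bases of the invariants and of the harmonic covariants form a basis of the
  covariants. A linear relation between them, evaluated at a vector, is a relation between invariants with
  harmonic coefficients.\<close>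

lemma dim_covs_deg_convolution:
  "covs.dim (covs_deg d) = (\<Sum>k\<le>d. cpoly.dim (invariants_deg k) * covs.dim (harm_covs (d - k)))"
proof -
  have "\<exists>B. B \<subseteq> invariants_deg k \<and> cpoly.independent B \<and> invariants_deg k \<subseteq> cpoly.span B \<and> card B = cpoly.dim (invariants_deg k)" for k
    using cpoly.basis_exists[of "invariants_deg k"] by metis
  then obtain B where B: "\<And>k. B k \<subseteq> invariants_deg k" "\<And>k. cpoly.independent (B k)"
      "\<And>k. invariants_deg k \<subseteq> cpoly.span (B k)" "\<And>k. card (B k) = cpoly.dim (invariants_deg k)" by metis
  have "\<exists>E. E \<subseteq> harm_covs k \<and> covs.independent E \<and> harm_covs k \<subseteq> covs.span E \<and> card E = covs.dim (harm_covs k)" for k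
    using covs.basis_exists[of "harm_covs k"] by metis
  then obtain E where E: "\<And>k. E k \<subseteq> harm_covs k" "\<And>k. covs.independent (E k)"
      "\<And>k. harm_covs k \<subseteq> covs.span (E k)" "\<And>k. card (E k) = covs.dim (harm_covs k)" by metis
  have finB: "finite (B k)" for k
  proof -
    have "B k \<subseteq> cpoly.span (monomials k)"
      using B(1) homogeneous_in_span_monomials by (auto simp: invariants_deg_def)
    thus ?thesis using cpoly.independent_span_bound[of "monomials k" "B k"] B(2) by simp
  qed
  have harm_sub: "harm_covs k \<subseteq> covs_deg k" for k
    by (intro gmodule_hom_mono) (auto simp: harmonics_deg_def)
  have finE: "finite (E k)" for k
  proof -
    have "E k \<subseteq> covs.span (elem_map ` ({m. mdeg m = k} \<times> {..<gdim W}))"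
      using E(1) harm_sub finite_dim_covs by blast
    thus ?thesis
      using covs.independent_span_bound[of "elem_map ` ({m. mdeg m = k} \<times> {..<gdim W})" "E k"] E(2)
      by (simp add: finite_mdeg)
  qed
  define K where "K = Sigma {..d} B"
  define L where "L = Sigma K (\<lambda>x. E (d - fst x))"
  define \<Phi> :: "(nat \<times> 'n cpoly) \<times> (complex Matrix.vec \<Rightarrow> 'n cpoly) \<Rightarrow> complex Matrix.vec \<Rightarrow> 'n cpoly"
    where "\<Phi> = (\<lambda>(x, h) v. snd x * h v)"
  have finK: "finite K" by (simp add: K_def finB)
  have finL: "finite L" by (simp add: L_def finK finE)
  have K_inv: "snd x \<in> invariants_deg (fst x)" if "x \<in> K" for x
    using that B(1)[of "fst x"] by (auto simp: K_def)
  have indep_B: "\<forall>x\<in>K. c x = 0" if c: "(\<Sum>x\<in>K. pconst (c x) * snd x) = 0" for c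
  proof
    fix x assume "x \<in> K"
    then obtain k u where x: "x = (k, u)" "k \<le> d" "u \<in> B k" by (auto simp: K_def)
    have hom: "homogeneous l (pconst (c (l, y)) * y)" if "y \<in> B l" for l y
      using B(1)[of l] that by (auto simp: invariants_deg_def intro: homogeneous_pconst_mult)
    have "0 = hcomp k (\<Sum>x\<in>K. pconst (c x) * snd x)" using c by simp
    also have "\<dots> = (\<Sum>l\<le>d. \<Sum>y\<in>B l. hcomp k (pconst (c (l, y)) * y))"
      unfolding K_def hcomp_sum by (subst sum.Sigma) (simp_all add: finB case_prod_unfold)
    also have "\<dots> = (\<Sum>l\<le>d. if l = k then \<Sum>y\<in>B k. pconst (c (k, y)) * y else 0)"
      by (intro sum.cong refl) (auto simp: hcomp_homogeneous[OF hom] intro!: sum.neutral)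
    also have "\<dots> = (\<Sum>y\<in>B k. pscale (c (k, y)) y)" using x(2) by (simp add: pscale_def)
    finally have "(\<Sum>y\<in>B k. pscale (c (k, y)) y) = 0" by (rule sym)
    from cpoly.independentD[OF B(2) finB subset_refl this x(3)] show "c x = 0" by (simp add: x(1))
  qed
  have zero: "\<forall>l\<in>L. c l = 0" if c: "(\<Sum>l\<in>L. fun_scale (c l) (\<Phi> l)) = 0" for c
  proof -
    define H where "H v x = (\<Sum>h\<in>E (d - fst x). pconst (c (x, h)) * h v)" for v and x :: "nat \<times> 'n cpoly"
    have H0: "H v x = 0" if "x \<in> K" for v x
    proof (cases "v \<in> carrier_vec (gdim W)")
      case True
      have "(\<Sum>x\<in>K. H v x * snd x) = (\<Sum>x\<in>K. \<Sum>h\<in>E (d - fst x). fun_scale (c (x, h)) (\<Phi> (x, h)) v)"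
        unfolding H_def sum_distrib_right
        by (intro sum.cong refl) (simp add: fun_scale_def \<Phi>_def mult_ac)
      also have "\<dots> = (\<Sum>l\<in>L. fun_scale (c l) (\<Phi> l)) v"
        unfolding L_def sum_fun_apply by (subst sum.Sigma) (simp_all add: finK finE case_prod_unfold)
      finally have sum0: "(\<Sum>x\<in>K. H v x * snd x) = 0" using c by simp
      have Hharm: "H v x \<in> harmonics_deg \<sigma> (d - fst x)" for x
      proof -
        have "(\<Sum>h\<in>E (d - fst x). pscale (c (x, h)) (h v)) \<in> harmonics_deg \<sigma> (d - fst x)"
          using E(1)[of "d - fst x"] True
          by (intro cpoly.subspace_sum cpoly.subspace_scale subspace_harmonics_deg) (auto simp: gmodule_hom_def)
        thus ?thesis by (simp add: H_def pscale_def)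
      qed
      have "\<forall>x\<in>K. H v x = 0"
      proof (rule invariants_independent_over_complement[OF finK _ _ _ _ _ sum0, where k = fst and e = "\<lambda>x. d - fst x"])
        show "\<forall>x\<in>K. c x = 0" if "(\<Sum>x\<in>K. pconst (c x) * snd x) = 0" for c by (rule indep_B[OF that])
        show "homogeneous (d - fst x) (H v x)" for x
          using Hharm[of x] by (simp add: harmonics_deg_def)
        show "H v x = 0" if "H v x \<in> pos_ideal" for x
          using Hharm[of x] that by (auto simp: harmonics_deg_def intro: harmonic_pos_ideal_zero)
      qed (use K_inv in \<open>auto simp: invariants_deg_def\<close>)
      thus ?thesis using that by blast
    next
      case False
      have "h v = 0" if "h \<in> E (d - fst x)" for h
        using E(1)[of "d - fst x"] that False by (auto simp: gmodule_hom_def)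
      thus ?thesis unfolding H_def by (intro sum.neutral ballI) (metis mult_zero_right)
    qed
    show "\<forall>l\<in>L. c l = 0"
    proof
      fix l assume "l \<in> L"
      then obtain x h where l: "l = (x, h)" "x \<in> K" "h \<in> E (d - fst x)" by (auto simp: L_def)
      have "(\<Sum>h\<in>E (d - fst x). fun_scale (c (x, h)) h) = 0"
        using H0[OF l(2)] by (simp add: fun_eq_iff sum_fun_apply H_def fun_scale_def)
      from covs.independentD[OF E(2) finE subset_refl this l(3)] show "c l = 0" by (simp add: l(1))
    qed
  qed
  have indep: "inj_on \<Phi> L" "covs.independent (\<Phi> ` L)"
    using covs.independent_family[OF finL zero] by blast+
  have sub: "\<Phi> ` L \<subseteq> covs_deg d"
  proof clarify
    fix k u h assume "((k, u), h) \<in> L"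
    hence *: "k \<le> d" "u \<in> invariants_deg k" "h \<in> covs_deg (d - k)"
      using B(1)[of k] E(1)[of "d - k"] harm_sub[of "d - k"] by (auto simp: L_def K_def)
    have "homogeneous d (u * h v)" if "v \<in> carrier_vec (gdim W)" for v
    proof -
      have "homogeneous (k + (d - k)) (u * h v)"
        using * that by (intro homogeneous_mult) (auto simp: invariants_deg_def gmodule_hom_def)
      thus ?thesis using *(1) by simp
    qed
    thus "\<Phi> ((k, u), h) \<in> covs_deg d"
      using *(2,3) by (simp add: \<Phi>_def gmodule_hom_def invariants_deg_def invariants_def pact_mult
          distrib_left mult.left_commute)
  qed
  have "cov_products d \<subseteq> covs.span (\<Phi> ` L)"
  proof
    fix f assume "f \<in> cov_products d"
    then obtain k u h where f: "f = (\<lambda>v. u * h v)" "k \<le> d" "u \<in> invariants_deg k" "h \<in> harm_covs (d - k)"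
      by (auto simp: cov_products_def)
    obtain b where b: "u = (\<Sum>y\<in>B k. pscale (b y) y)"
      using B(3)[of k] f(3) cpoly.span_finite[OF finB] by blast
    obtain e where e: "h = (\<Sum>y\<in>E (d - k). fun_scale (e y) y)"
      using E(3)[of "d - k"] f(4) covs.span_finite[OF finE] by blast
    have "f = (\<Sum>y\<in>B k. \<Sum>z\<in>E (d - k). fun_scale (b y * e z) (\<Phi> ((k, y), z)))"
      unfolding f(1) b e
      by (simp add: fun_eq_iff sum_fun_apply sum_product fun_scale_def pscale_def \<Phi>_def pconst_mult mult_ac)
    also have "\<dots> \<in> covs.span (\<Phi> ` L)"
      using f(2) by (intro covs.span_sum covs.span_scale covs.span_base imageI) (auto simp: L_def K_def)
    finally show "f \<in> covs.span (\<Phi> ` L)" .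
  qed
  hence "covs.span (cov_products d) \<subseteq> covs.span (\<Phi> ` L)"
    by (intro covs.span_minimal covs.subspace_span)
  hence "covs_deg d \<subseteq> covs.span (\<Phi> ` L)" using covs_deg_subset_span by blast
  hence "covs.dim (covs_deg d) = card (\<Phi> ` L)"
    using covs.basis_card_eq_dim[OF sub _ indep(2)] by simp
  also have "\<dots> = card L" by (rule card_image[OF indep(1)])
  also have "\<dots> = (\<Sum>x\<in>K. card (E (d - fst x)))"
    unfolding L_def by (rule card_SigmaI) (simp_all add: finK finE)
  also have "\<dots> = (\<Sum>k\<le>d. \<Sum>u\<in>B k. card (E (d - k)))"
    unfolding K_def by (subst sum.Sigma) (simp_all add: finB case_prod_unfold)
  also have "\<dots> = (\<Sum>k\<le>d. cpoly.dim (invariants_deg k) * covs.dim (harm_covs (d - k)))"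
    by (simp add: B(4) E(4))
  finally show ?thesis .
qed

lemma harm_mult_convolution:
  "covs.dim (covs_deg d) = (\<Sum>k\<le>d. cpoly.dim (invariants_deg k) * harm_mult G \<sigma> W (d - k))"
  unfolding harm_mult_def by (rule dim_covs_deg_convolution)

end

subsection \<open>Harmonic polynomials have bounded degree\<close>

context basic_invariants
begin

text \<open>The coordinate is a root of the monic polynomial \<open>\<Prod>\<^sub>g (X - g x\<^sub>i)\<close>. Up to sign, its lower coefficients are
  the elementary symmetric functions of the \<open>g x\<^sub>i\<close>, which are invariants of positive degree.\<close>

lemma pvar_power_in_pos_ideal: "pvar i ^ card G \<in> pos_ideal"
proof -
  define f where "f g = pact g (pvar i)" for g
  let ?P = "\<lambda>k. {A\<in>Pow G. card A = k}"
  let ?e = "\<lambda>k. \<Sum>A\<in>?P k. \<Prod>g\<in>A. f g"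
  have perm: "?e k \<in> invariants_deg k" for k
  proof -
    have "pact h (?e k) = ?e k" if h: "h \<in> G" for h
    proof -
      have inj: "inj_on (\<lambda>g. h ** g) G" using bij_betw_mult_left[OF h] by (simp add: bij_betw_def)
      have "pact h (?e k) = (\<Sum>A\<in>?P k. \<Prod>g\<in>(\<lambda>g. h ** g) ` A. f g)"
        unfolding pact_sum
      proof (intro sum.cong refl)
        fix A assume A: "A \<in> ?P k"
        have "pact h (\<Prod>g\<in>A. f g) = (\<Prod>g\<in>A. f (h ** g))"
          unfolding pact_prod using A h by (intro prod.cong refl) (auto simp: f_def pact_pact)
        also have "\<dots> = (\<Prod>g\<in>(\<lambda>g. h ** g) ` A. f g)"
          using A by (subst prod.reindex) (auto intro: inj_on_subset[OF inj])
        finally show "pact h (\<Prod>g\<in>A. f g) = (\<Prod>g\<in>(\<lambda>g. h ** g) ` A. f g)" .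
      qed
      also have "\<dots> = ?e k"
      proof (rule sum.reindex_bij_witness[where i = "\<lambda>A. (\<lambda>g. matrix_inv h ** g) ` A" and j = "\<lambda>A. (\<lambda>g. h ** g) ` A"])
        fix A assume A: "A \<in> ?P k"
        show "(\<lambda>g. matrix_inv h ** g) ` (\<lambda>g. h ** g) ` A = A"
          using h by (simp add: image_image matrix_mul_assoc matrix_inv_G)
        show "(\<lambda>g. h ** g) ` (\<lambda>g. matrix_inv h ** g) ` A = A"
          using h by (simp add: image_image matrix_mul_assoc matrix_inv_G)
        show "(\<lambda>g. h ** g) ` A \<in> ?P k"
          using A h card_image[OF inj_on_subset[OF inj, of A]] by auto
        have "inj_on (\<lambda>g. matrix_inv h ** g) G"
          using bij_betw_mult_left[of "matrix_inv h"] h by (simp add: bij_betw_def)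
        thus "(\<lambda>g. matrix_inv h ** g) ` A \<in> ?P k"
          using A h card_image[OF inj_on_subset, of "\<lambda>g. matrix_inv h ** g" G A] by auto
      qed auto
      finally show ?thesis .
    qed
    moreover have "homogeneous k (?e k)"
    proof (intro homogeneous_sum)
      fix A assume "A \<in> ?P k"
      thus "homogeneous k (\<Prod>g\<in>A. f g)"
        using homogeneous_prod[of A "\<lambda>_. 1" f] homogeneous_pact[OF homogeneous_pvar, of _ i] by (simp add: f_def)
    qed
    ultimately show ?thesis by (simp add: invariants_deg_def invariants_def)
  qed
  have "0 = (\<Prod>g\<in>G. pvar i + - f g)"
    by (rule prod_zero[symmetric]) (auto intro!: bexI[of _ "mat 1"] simp: f_def)
  also have "\<dots> = (\<Sum>A\<in>Pow G. (\<Prod>g\<in>G - A. pvar i) * (\<Prod>g\<in>A. - f g))"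
  proof -
    have "(\<Prod>g\<in>G. - f g + pvar i) = (\<Sum>A\<in>Pow G. (\<Prod>g\<in>A. - f g) * (\<Prod>g\<in>G - A. pvar i))"
      by (rule prod_add) simp
    thus ?thesis by (simp add: add.commute mult.commute)
  qed
  also have "\<dots> = (\<Sum>A\<in>Pow G. pvar i ^ (card G - card A) * (- 1) ^ card A * (\<Prod>g\<in>A. f g))"
  proof (intro sum.cong refl)
    fix A assume A: "A \<in> Pow G"
    hence "finite A" using finite_subset[OF _ finite_G] by auto
    moreover have "(\<Prod>g\<in>A. - f g) = (- 1) ^ card A * (\<Prod>g\<in>A. f g)"
      using \<open>finite A\<close> by induction (simp_all add: algebra_simps)
    ultimately show "(\<Prod>g\<in>G - A. pvar i) * (\<Prod>g\<in>A. - f g) = pvar i ^ (card G - card A) * (- 1) ^ card A * (\<Prod>g\<in>A. f g)"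
      using A by (simp add: card_Diff_subset mult.assoc)
  qed
  also have "\<dots> = (\<Sum>k\<le>card G. \<Sum>A\<in>?P k. pvar i ^ (card G - card A) * (- 1) ^ card A * (\<Prod>g\<in>A. f g))"
    by (rule sum.group[symmetric]) (auto intro: card_mono)
  also have "\<dots> = (\<Sum>k\<le>card G. pvar i ^ (card G - k) * (- 1) ^ k * ?e k)"
    by (simp add: sum_distrib_left)
  also have "\<dots> = pvar i ^ card G + (\<Sum>k\<in>{1..card G}. pvar i ^ (card G - k) * (- 1) ^ k * ?e k)"
  proof -
    have "{A\<in>Pow G. card A = 0} = {{}}" using finite_subset[OF _ finite_G] by auto
    moreover have "{..card G} = insert 0 {1..card G}" by auto
    ultimately show ?thesis by simp
  qed
  finally have "pvar i ^ card G = - (\<Sum>k\<in>{1..card G}. pvar i ^ (card G - k) * (- 1) ^ k * ?e k)"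
    by (simp add: eq_neg_iff_add_eq_0)
  also have "\<dots> \<in> pos_ideal"
  proof (rule pos_ideal_uminus, rule pos_ideal_sum, rule pos_ideal_mult_left)
    fix k assume "k \<in> {1..card G}"
    thus "?e k \<in> pos_ideal"
      using perm[of k] homogeneous_invariant_in_pos_ideal[of _ k] by (simp add: invariants_deg_def)
  qed
  finally show ?thesis .
qed

lemma homogeneous_large_in_pos_ideal:
  assumes "homogeneous d p" "CARD('n) * card G < d"
  shows "p \<in> pos_ideal"
proof -
  have "single m c \<in> pos_ideal" if "mdeg m = d" for m c
  proof -
    have "\<exists>i. card G \<le> lookup m i"
    proof (rule ccontr)
      assume "\<not> ?thesis"
      hence "mdeg m \<le> (\<Sum>i\<in>(UNIV :: 'n set). card G)"
        unfolding mdeg_def by (intro sum_mono) (auto simp: not_le less_imp_le)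
      thus False using assms(2) that by simp
    qed
    then obtain i where "card G \<le> lookup m i" by blast
    hence "pvar i ^ lookup m i = pvar i ^ card G * pvar i ^ (lookup m i - card G)"
      by (simp flip: power_add)
    hence "pvar i ^ lookup m i \<in> pos_ideal"
      using pos_ideal_mult[OF pvar_power_in_pos_ideal] by simp
    moreover have "single m c
        = pconst c * (pvar i ^ lookup m i * (\<Prod>j\<in>UNIV - {i}. pvar j ^ lookup m j))"
      unfolding single_conv_pvar by (subst prod.remove[of UNIV i]) auto
    ultimately show ?thesis using pos_ideal_mult pos_ideal_mult_left by simp
  qed
  hence "(\<Sum>m\<in>keys p. single m (lookup p m)) \<in> pos_ideal"
    using assms(1) by (intro pos_ideal_sum) (auto simp: homogeneous_def mdeg_def)
  thus ?thesis by (simp only: cpoly_expand[symmetric])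
qed

lemma harm_mult_eq_0:
  assumes "CARD('n) * card G < d"
  shows "harm_mult G \<sigma> W d = 0"
proof -
  have "harmonics_deg \<sigma> d \<subseteq> {0}"
    using homogeneous_large_in_pos_ideal[OF _ assms] harmonic_pos_ideal_zero by (auto simp: harmonics_deg_def)
  hence "gmodule_hom G W (harmonics_deg \<sigma> d) \<subseteq> covs.span {}"
    by (auto simp: gmodule_hom_def fun_eq_iff) (metis singletonD subsetD)
  hence "covs.dim (gmodule_hom G W (harmonics_deg \<sigma> d)) \<le> card ({} :: (complex Matrix.vec \<Rightarrow> 'n cpoly) set)"
    by (rule covs.dim_le_card) simp
  thus ?thesis by (simp add: harm_mult_def)
qed

end

section \<open>The graded trace of a linear map of finite order\<close>

text \<open>The matrices of the two substitutions on the monomials of degree \<open>d\<close> satisfy \<open>tr(X Y) = tr(Y X)\<close>.\<close>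

lemma sym_trace_commute:
  fixes A B :: "complex^'n^'n"
  shows "sym_trace (A ** B) d = sym_trace (B ** A) d"
proof -
  have expand: "lookup (lsubst (A ** B) (single k 1)) m
      = (\<Sum>l\<in>{l. mdeg l = d}. lookup (lsubst A (single k 1)) l
          * lookup (lsubst B (single l 1)) m)" if "mdeg k = d" for A B :: "complex^'n^'n" and k m
  proof -
    have "homogeneous d (lsubst A (single k 1))"
      using homogeneous_lsubst[OF homogeneous_single[of k 1], of A] that by simp
    hence "lsubst A (single k 1) = (\<Sum>l\<in>{l. mdeg l = d}.
        pscale (lookup (lsubst A (single k 1)) l) (single l 1))"
      by (rule homogeneous_expand)
    hence "lsubst B (lsubst A (single k 1)) = lsubst B (\<Sum>l\<in>{l. mdeg l = d}.
        pscale (lookup (lsubst A (single k 1)) l) (single l 1))"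
      by (rule arg_cong)
    thus ?thesis
      by (simp add: lsubst_lsubst lsubst_sum pscale_def lsubst_mult lookup_sum)
  qed
  have "sym_trace (A ** B) d = (\<Sum>k\<in>{k. mdeg k = d}. \<Sum>l\<in>{l. mdeg l = d}.
      lookup (lsubst A (single k 1)) l * lookup (lsubst B (single l 1)) k)"
    unfolding sym_trace_def by (intro sum.cong refl) (simp add: expand)
  also have "\<dots> = sym_trace (B ** A) d"
    unfolding sym_trace_def by (subst sum.swap) (intro sum.cong refl, simp add: expand mult.commute)
  finally show ?thesis .
qed

definition diagonal_matrix :: "('n \<Rightarrow> complex) \<Rightarrow> complex^'n^'n" where
  "diagonal_matrix \<mu> = (\<chi> i j. if i = j then \<mu> i else 0)"

lemma sym_trace_diag: "sym_trace (diagonal_matrix \<mu>) d = (\<Sum>m\<in>{m. mdeg m = d}. \<Prod>i\<in>UNIV. \<mu> i ^ lookup m i)"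
proof -
  have var: "(\<Sum>k\<in>UNIV. pconst (diagonal_matrix \<mu> $ i $ k) * pvar k) = pconst (\<mu> i) * pvar i" for i
  proof -
    have "(\<Sum>k\<in>UNIV. pconst (diagonal_matrix \<mu> $ i $ k) * pvar k) = (\<Sum>k\<in>UNIV. if i = k then pconst (\<mu> i) * pvar i else 0)"
      by (intro sum.cong) (auto simp: diagonal_matrix_def)
    thus ?thesis by simp
  qed
  have pow: "pconst c ^ n = pconst (c ^ n)" for c :: complex and n
    by (induction n) (simp_all add: pconst_mult)
  have prod: "(\<Prod>i\<in>A. pconst (f i)) = pconst (\<Prod>i\<in>A. f i)" for f :: "'a \<Rightarrow> complex" and A
    by (induction A rule: infinite_finite_induct) (simp_all add: pconst_mult)
  have "lsubst (diagonal_matrix \<mu>) (single m 1) = pconst (\<Prod>i\<in>UNIV. \<mu> i ^ lookup m i) * single m 1" for m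
    by (simp add: lsubst_def psubst_single var power_mult_distrib prod.distrib pow prod pvar_monomial)
  thus ?thesis by (simp add: sym_trace_def)
qed

lemma norm_mult_less_1:
  fixes z :: complex
  assumes "norm z = 1" "0 \<le> t" "t < 1"
  shows "norm (of_real t * z) < 1"
  using assms by (simp add: norm_mult)

text \<open>The product of the geometric series, expanded over all exponent vectors and collected by total
  degree.\<close>

lemma sums_diag_trace:
  fixes \<mu> :: "'n::finite \<Rightarrow> complex"
  assumes "\<And>i. norm (\<mu> i) = 1" "0 \<le> t" "t < 1"
  shows "(\<lambda>d. sym_trace (diagonal_matrix \<mu>) d * of_real t ^ d) sums (\<Prod>i\<in>UNIV. 1 / (1 - of_real t * \<mu> i))"
proof -
  define f :: "'n \<Rightarrow> nat \<Rightarrow> complex" where "f i k = (of_real t * \<mu> i) ^ k" for i k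
  define F where "F m = (\<Prod>i\<in>UNIV. f i (m i))" for m
  have lt1: "norm (of_real t * \<mu> i) < 1" for i
    by (rule norm_mult_less_1[OF assms])
  have summ: "summable (\<lambda>k. norm (f i k))" for i
    unfolding f_def norm_power by (rule summable_geometric) (use lt1[of i] in simp)
  have abs: "Infinite_Sum.abs_summable_on (f i) UNIV" for i
    by (rule norm_summable_imp_summable_on) (simp add: summ)
  have F_has: "(F has_sum (\<Prod>i\<in>UNIV. 1 / (1 - of_real t * \<mu> i))) UNIV"
  proof -
    have U: "PiE (UNIV :: 'n set) (\<lambda>_. UNIV :: nat set) = UNIV" by (auto simp: PiE_def)
    have "Infinite_Set_Sum.abs_summable_on F (PiE UNIV (\<lambda>_. UNIV))"
      unfolding F_def by (rule abs_summable_on_prod_PiE) (use abs in \<open>auto simp: abs_summable_equivalent\<close>)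
    hence "Infinite_Sum.abs_summable_on F UNIV" by (simp add: U abs_summable_equivalent)
    hence "F summable_on UNIV" by (rule abs_summable_summable)
    moreover have "infsum F UNIV = (\<Prod>i\<in>UNIV. infsum (f i) UNIV)"
      using infsum_prod_PiE_abs[of UNIV f "\<lambda>_. UNIV"] abs by (simp add: U F_def[abs_def])
    moreover have "infsum (f i) UNIV = 1 / (1 - of_real t * \<mu> i)" for i
    proof -
      have "f i sums (1 / (1 - of_real t * \<mu> i))"
        unfolding f_def by (rule geometric_sums[OF lt1])
      thus ?thesis using norm_summable_imp_has_sum[OF summ] infsumI by blast
    qed
    ultimately show ?thesis by (metis (no_types, lifting) has_sum_infsum prod.cong)
  qed
  have bij: "bij_betw (\<lambda>(d, m). lookup m) (Sigma UNIV (\<lambda>d. {m :: 'n \<Rightarrow>\<^sub>0 nat. mdeg m = d})) UNIV"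
    by (rule bij_betwI[where g = "\<lambda>m. (\<Sum>i\<in>UNIV. m i, Abs_poly_mapping m)"]) (auto simp: mdeg_def)
  have "((\<lambda>x. F ((\<lambda>(d, m). lookup m) x)) has_sum (\<Prod>i\<in>UNIV. 1 / (1 - of_real t * \<mu> i)))
      (Sigma UNIV (\<lambda>d. {m :: 'n \<Rightarrow>\<^sub>0 nat. mdeg m = d}))"
    using F_has by (subst has_sum_reindex_bij_betw[OF bij])
  hence "((\<lambda>d. \<Sum>m\<in>{m. mdeg m = d}. F (lookup m)) has_sum (\<Prod>i\<in>UNIV. 1 / (1 - of_real t * \<mu> i))) UNIV"
    by (rule has_sum_SigmaD) (auto intro!: has_sum_finite finite_mdeg)
  moreover have "(\<Sum>m\<in>{m. mdeg m = d}. F (lookup m)) = sym_trace (diagonal_matrix \<mu>) d * of_real t ^ d" for d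
    unfolding sym_trace_diag sum_distrib_right
  proof (intro sum.cong refl)
    fix m :: "'n \<Rightarrow>\<^sub>0 nat" assume "m \<in> {m. mdeg m = d}"
    thus "F (lookup m) = (\<Prod>i\<in>UNIV. \<mu> i ^ lookup m i) * of_real t ^ d"
      by (auto simp: F_def f_def power_mult_distrib prod.distrib mdeg_def power_sum mult.commute)
  qed
  ultimately show ?thesis by (intro has_sum_imp_sums) simp
qed

subsection \<open>Diagonalisation\<close>

definition mat_power :: "complex^'n^'n \<Rightarrow> nat \<Rightarrow> complex^'n^'n" where
  "mat_power A k = (((**) A) ^^ k) (mat 1)"

lemma mat_power_Suc: "mat_power A (Suc k) = A ** mat_power A k"
  by (simp add: mat_power_def)

lemma mat_power_0 [simp]: "mat_power A 0 = mat 1"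
  by (simp add: mat_power_def)

text \<open>For each \<open>N\<close>-th root of unity \<open>\<omega> j\<close> the vector \<open>e j v = \<Sum>\<^sub>k \<omega>\<^sub>j\<^sup>-\<^sup>k A\<^sup>k v\<close> is zero or an eigenvector, and these vectors
  add up to \<open>N v\<close>. So the eigenvectors span, and a basis can be chosen among them.\<close>

lemma finite_order_diagonalizable:
  fixes A :: "complex^'n^'n"
  assumes N: "N > 0" "mat_power A N = mat 1"
  obtains P Q :: "complex^'n^'n" and \<mu> :: "'n \<Rightarrow> complex" where "P ** Q = mat 1" "Q ** P = mat 1" "A = P ** diagonal_matrix \<mu> ** Q"
    "\<And>i. norm (\<mu> i) = 1"
proof -
  define \<omega> where "\<omega> j = cis (2 * pi * real j / real N)" for j
  define S where "S = {v. \<exists>z. norm z = 1 \<and> A *v v = z *s v}"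
  define e where "e j v = (\<Sum>k<N. inverse (\<omega> j) ^ k *s (mat_power A k *v v))" for j v
  have \<omega>N: "\<omega> j ^ N = 1" for j
  proof -
    have "\<omega> j ^ N = cis (real N * (2 * pi * real j / real N))" by (simp only: \<omega>_def Complex.DeMoivre)
    also have "\<dots> = cis (2 * pi * real j)" using N by simp
    finally show ?thesis by (simp add: cis_multiple_2pi)
  qed
  have \<omega>0: "\<omega> j \<noteq> 0" for j by (simp add: \<omega>_def)
  have eig: "e j v \<in> S" for j v
  proof -
    define a where "a k = inverse (\<omega> j) ^ k *s (mat_power A k *v v)" for k
    have step: "A *v a k = \<omega> j *s a (Suc k)" for k
      using \<omega>0[of j]
      by (simp add: a_def mat_power_Suc vector_smult_assoc matrix_vector_mul_assoc [symmetric] vec.scale)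
    have "a N = a 0" using N \<omega>N[of j] by (simp add: a_def power_inverse)
    have "(\<Sum>k<N. a (Suc k)) = (\<Sum>k<N. a k)"
      using sum.lessThan_Suc_shift[of a N] sum.lessThan_Suc[of a N] \<open>a N = a 0\<close> by simp
    hence "A *v e j v = \<omega> j *s e j v"
      unfolding e_def a_def[symmetric] by (simp add: vec.sum step vec.scale_sum_right [symmetric])
    thus ?thesis unfolding S_def by (auto intro!: exI[of _ "\<omega> j"] simp: \<omega>_def)
  qed
  \<comment> \<open>a geometric series in \<open>j\<close>, whose ratio \<open>\<zeta>\<close> is another \<open>N\<close>-th root of unity\<close>
  have geom: "(\<Sum>j<N. inverse (\<omega> j) ^ k) = (if k = 0 then of_nat N else 0)" if "k < N" for k
  proof (cases "k = 0")
    case False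
    define \<zeta> where "\<zeta> = cis (- (2 * pi * real k / real N))"
    have "inverse (\<omega> j) ^ k = \<zeta> ^ j" for j
      unfolding \<omega>_def \<zeta>_def cis_inverse Complex.DeMoivre by (simp add: mult_ac)
    moreover have "\<zeta> ^ N = 1"
    proof -
      have "\<zeta> ^ N = cis (real N * - (2 * pi * real k / real N))" by (simp only: \<zeta>_def Complex.DeMoivre)
      also have "\<dots> = cis (2 * pi * - real k)" using N by simp
      also have "\<dots> = 1" by (rule cis_multiple_2pi) simp
      finally show ?thesis .
    qed
    moreover have "\<zeta> \<noteq> 1"
    proof
      assume "\<zeta> = 1"
      hence "cos (2 * pi * real k / real N) = 1" by (simp add: \<zeta>_def complex_eq_iff)
      then obtain m :: int where "2 * pi * real k / real N = of_int m * 2 * pi"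
        using cos_one_2pi_int by blast
      hence "real k = of_int m * real N" using N by (simp add: field_simps)
      hence "int k = m * int N" by (metis of_int_eq_iff of_int_mult of_int_of_nat_eq)
      thus False using that False N
        by (metis gr0I int_dvd_int_iff dvd_triv_right linorder_not_le nat_dvd_not_less)
    qed
    ultimately show ?thesis using False by (simp add: geometric_sum)
  qed simp
  have decomp: "(\<Sum>j<N. e j v) = of_nat N *s v" for v
  proof -
    have "(\<Sum>j<N. e j v) = (\<Sum>k<N. (\<Sum>j<N. inverse (\<omega> j) ^ k) *s (mat_power A k *v v))"
      unfolding e_def by (subst sum.swap) (simp add: vec.scale_sum_left)
    also have "\<dots> = (\<Sum>k<N. if k = 0 then of_nat N *s v else 0)"
      by (intro sum.cong refl) (simp add: geom)
    also have "\<dots> = of_nat N *s v" using N by simp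
    finally show ?thesis .
  qed
  have span: "vec.span S = UNIV"
  proof -
    have "v \<in> vec.span S" for v
    proof -
      have "(\<Sum>j<N. e j v) \<in> vec.span S" by (intro vec.span_sum vec.span_base eig)
      hence "inverse (of_nat N) *s (of_nat N *s v) \<in> vec.span S"
        unfolding decomp by (rule vec.span_scale)
      thus ?thesis using N by (simp add: vector_smult_assoc)
    qed
    thus ?thesis by blast
  qed
  obtain B where B: "B \<subseteq> S" "vec.independent B" "S \<subseteq> vec.span B"
    by (rule vec.maximal_independent_subset)
  have spanB: "vec.span B = UNIV"
    using span B(3) vec.span_minimal[OF B(3) vec.subspace_span] by auto
  have "card B = vec.dim (UNIV :: (complex^'n) set)"
    using vec.dim_span_eq_card_independent[OF B(2)] spanB by simp
  hence card: "card B = CARD('n)" by (simp only: vec_dim_card)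
  have "finite B" using B(2) by (rule vec.finiteI_independent)
  then obtain b where b: "bij_betw b (UNIV :: 'n set) B"
    using card by (metis finite_same_card_bij finite)
  have "\<exists>z. norm z = 1 \<and> A *v b i = z *s b i" for i
    using b B(1) by (auto simp: S_def bij_betw_def)
  then obtain \<mu> where \<mu>: "\<And>i. norm (\<mu> i) = 1" "\<And>i. A *v b i = \<mu> i *s b i" by metis
  define P where "P = (\<chi> i j. b j $ i)"
  have "column j P = b j" for j
    by (simp add: P_def column_def Finite_Cartesian_Product.vec_eq_iff)
  hence "columns P = B" using b by (auto simp: columns_def bij_betw_def)
  hence "\<exists>Q. P ** Q = mat 1" using spanB by (simp add: matrix_right_invertible_span_columns)
  then obtain Q where Q: "P ** Q = mat 1" by blast
  hence Q': "Q ** P = mat 1" using matrix_left_right_inverse by blast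
  have "A ** P = P ** diagonal_matrix \<mu>"
  proof -
    have "(A ** P) $ i $ j = (P ** diagonal_matrix \<mu>) $ i $ j" for i j
    proof -
      have "(A ** P) $ i $ j = (A *v b j) $ i"
        by (simp add: matrix_matrix_mult_def matrix_vector_mult_def P_def)
      also have "\<dots> = \<mu> j * b j $ i" by (simp add: \<mu>(2))
      also have "\<dots> = (\<Sum>k\<in>UNIV. if k = j then \<mu> j * b j $ i else 0)" by simp
      also have "\<dots> = (P ** diagonal_matrix \<mu>) $ i $ j"
        unfolding matrix_matrix_mult_def vec_lambda_beta
        by (intro sum.cong) (auto simp: P_def diagonal_matrix_def)
      finally show ?thesis .
    qed
    thus ?thesis by (simp add: Finite_Cartesian_Product.vec_eq_iff)
  qed
  hence "A = P ** diagonal_matrix \<mu> ** Q"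
    by (metis Q matrix_mul_assoc matrix_mul_rid)
  from that[OF Q Q' this \<mu>(1)] show ?thesis .
qed

section \<open>Eigenvalues of the elements of a reflection group\<close>

lemma cmat_eq_iff: "cmat g = cmat h \<longleftrightarrow> g = h"
  by (simp add: cmat_def Finite_Cartesian_Product.vec_eq_iff)

lemma trace_matrix_mult_commute:
  fixes A B :: "'a::comm_semiring_1^'n^'n"
  shows "trace (A ** B) = trace (B ** A)"
  unfolding trace_def matrix_matrix_mult_def vec_lambda_beta
  by (subst sum.swap) (simp add: mult.commute)

lemma trace_diagonal_matrix: "trace (diagonal_matrix \<mu>) = (\<Sum>i\<in>UNIV. \<mu> i)"
  by (simp add: trace_def diagonal_matrix_def)

lemma diagonal_matrix_mult: "diagonal_matrix \<mu> ** diagonal_matrix \<nu> = diagonal_matrix (\<lambda>i. \<mu> i * \<nu> i)"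
proof -
  have "(\<Sum>k\<in>UNIV. (if i = k then \<mu> i else 0) * (if k = j then \<nu> k else 0)) = (if i = j then \<mu> i * \<nu> i else 0)" for i j
  proof -
    have "(\<Sum>k\<in>UNIV. (if i = k then \<mu> i else 0) * (if k = j then \<nu> k else 0))
        = (\<Sum>k\<in>UNIV. if i = k then (if i = j then \<mu> i * \<nu> i else 0) else 0)"
      by (intro sum.cong) auto
    thus ?thesis by simp
  qed
  thus ?thesis by (simp add: Finite_Cartesian_Product.vec_eq_iff matrix_matrix_mult_def diagonal_matrix_def)
qed

lemma diagonal_matrix_1: "diagonal_matrix (\<lambda>_. 1) = mat 1"
  by (simp add: diagonal_matrix_def Finite_Cartesian_Product.mat_def)

lemma diagonal_matrix_eq_iff: "diagonal_matrix \<mu> = diagonal_matrix \<nu> \<longleftrightarrow> \<mu> = \<nu>"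
proof
  assume "diagonal_matrix \<mu> = diagonal_matrix \<nu>"
  hence "diagonal_matrix \<mu> $ i $ i = diagonal_matrix \<nu> $ i $ i" for i by simp
  thus "\<mu> = \<nu>" by (auto simp: diagonal_matrix_def)
qed simp

lemma matrix_sub_ldistrib: "A ** (B - C) = A ** B - A ** (C :: 'a::ring_1^'n^'m)"
  and matrix_sub_rdistrib: "(B - C) ** D = B ** D - (C :: 'a::ring_1^'n^'m) ** D"
  by (simp_all add: Finite_Cartesian_Product.vec_eq_iff matrix_matrix_mult_def right_diff_distrib
      left_diff_distrib sum_subtractf)

text \<open>The hypothesis \<open>rank\<close> says that the two-by-two minors of \<open>1 - g\<close> vanish. An orthogonal involution is symmetric, and
  \<open>M = 1 - g\<close> satisfies \<open>M\<^sup>2 = 2 M\<close>. So a nonzero column \<open>\<alpha>\<close> of \<open>M\<close> spans its image, and \<open>M\<close> is twice the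
  orthogonal projection onto the line of \<open>\<alpha>\<close>.\<close>

lemma rank_one_involution_is_reflection:
  fixes g :: "'n::finite rmat"
  assumes orth: "orthogonal_matrix g" and sq: "g ** g = mat 1" and "g \<noteq> mat 1"
    and rank: "\<And>i j k l. (mat 1 - g) $ i $ j * (mat 1 - g) $ k $ l = (mat 1 - g) $ i $ l * (mat 1 - g) $ k $ j"
  shows "g \<in> reflections"
proof -
  define M where "M = mat 1 - g"
  have "matrix_inv g = g" using sq by (rule matrix_inv_unique)
  hence gt: "Finite_Cartesian_Product.transpose g = g" using matrix_inv_orthogonal[OF orth] by simp
  have "g $ i $ j = g $ j $ i" for i j
  proof -
    have "Finite_Cartesian_Product.transpose g $ i $ j = g $ j $ i"
      by (simp add: Finite_Cartesian_Product.transpose_def)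
    thus ?thesis by (simp only: gt)
  qed
  hence sym: "M $ i $ j = M $ j $ i" for i j
    by (simp add: M_def Finite_Cartesian_Product.mat_def)
  have "M ** M = M + M"
  proof -
    have "M ** M = mat 1 - g - g + g ** g"
      unfolding M_def by (simp add: matrix_sub_ldistrib matrix_sub_rdistrib)
    thus ?thesis by (simp add: sq M_def)
  qed
  hence "(M ** M) $ i $ j = (M + M) $ i $ j" for i j by simp
  hence M2: "(\<Sum>k\<in>UNIV. M $ i $ k * M $ k $ j) = 2 * M $ i $ j" for i j
    unfolding matrix_matrix_mult_def vec_lambda_beta vector_add_component by (simp only: mult_2)
  have "M \<noteq> 0" using assms(3) by (simp add: M_def)
  then obtain a b where ab: "M $ a $ b \<noteq> 0"
    by (auto simp: Finite_Cartesian_Product.vec_eq_iff)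
  define \<alpha> where "\<alpha> = (\<chi> i. M $ i $ b)"
  have "\<alpha> \<noteq> 0" using ab by (auto simp: \<alpha>_def Finite_Cartesian_Product.vec_eq_iff)
  have inner: "\<alpha> \<bullet> \<alpha> = 2 * M $ b $ b"
  proof -
    have "\<alpha> \<bullet> \<alpha> = (\<Sum>k\<in>UNIV. M $ b $ k * M $ k $ b)"
      unfolding inner_vec_def by (intro sum.cong refl) (metis \<alpha>_def inner_real_def sym vec_lambda_beta)
    thus ?thesis by (simp only: M2)
  qed
  hence bb: "M $ b $ b \<noteq> 0" using \<open>\<alpha> \<noteq> 0\<close> by (metis inner_eq_zero_iff mult_zero_right)
  have "reflection_matrix \<alpha> $ i $ j = g $ i $ j" for i j
  proof -
    have "M $ i $ b * M $ b $ j = M $ i $ j * M $ b $ b"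
      using rank[of i b b j] by (simp add: M_def)
    hence "2 * \<alpha> $ i * \<alpha> $ j / (\<alpha> \<bullet> \<alpha>) = M $ i $ j"
      using bb unfolding inner by (simp add: \<alpha>_def sym[of j b] field_simps)
    thus ?thesis by (simp add: reflection_matrix_nth M_def Finite_Cartesian_Product.mat_def)
  qed
  hence "g = reflection_matrix \<alpha>" by (simp add: Finite_Cartesian_Product.vec_eq_iff)
  thus ?thesis using \<open>\<alpha> \<noteq> 0\<close> by (auto simp: reflections_def)
qed

lemma trace_reflection:
  fixes s :: "'n::finite rmat"
  assumes "s \<in> reflections"
  shows "trace s = real CARD('n) - 2"
proof -
  obtain \<alpha> where \<alpha>: "\<alpha> \<noteq> 0" "s = reflection_matrix \<alpha>" using assms by (rule reflectionsE)
  have "trace s = (\<Sum>i\<in>UNIV. 1 - 2 * (\<alpha> $ i * \<alpha> $ i) / (\<alpha> \<bullet> \<alpha>))"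
    by (simp add: trace_def \<alpha>(2) reflection_matrix_nth mult.assoc)
  also have "\<dots> = real CARD('n) - 2 * (\<Sum>i\<in>UNIV. \<alpha> $ i * \<alpha> $ i) / (\<alpha> \<bullet> \<alpha>)"
    by (simp add: sum_subtractf sum_divide_distrib sum_distrib_left)
  also have "(\<Sum>i\<in>UNIV. \<alpha> $ i * \<alpha> $ i) = \<alpha> \<bullet> \<alpha>" by (simp add: inner_vec_def)
  finally show ?thesis using \<alpha>(1) by simp
qed

lemma real_unit_complex:
  fixes z :: complex
  assumes "norm z = 1" "z \<in> \<real>" "z \<noteq> 1"
  shows "z = - 1"
proof -
  obtain r where "z = of_real r" using assms(2) by (auto elim: Reals_cases)
  thus ?thesis using assms by (auto simp: abs_if split: if_splits)
qed

context reflection_group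
begin

lemma finite_order:
  assumes g: "g \<in> G"
  obtains N where "N > 0" "mat_power (cmat g) N = mat 1"
proof -
  define r where "r k = (((**) g) ^^ k) (mat 1)" for k
  have r: "r 0 = mat 1" "r (Suc k) = g ** r k" for k by (simp_all add: r_def)
  have rG: "r k \<in> G" for k by (induction k) (auto simp: r g)
  have cancel: "x = y" if "g ** x = g ** y" for x y
  proof -
    have "matrix_inv g ** (g ** x) = matrix_inv g ** (g ** y)" using that by simp
    thus ?thesis using g by (simp add: matrix_mul_assoc matrix_inv_G)
  qed
  have "\<exists>n>0. r n = mat 1" if "r i = r j" "i < j" for i j
    using that
  proof (induction i arbitrary: j)
    case 0
    thus ?case using r by metis
  next
    case (Suc i)
    then obtain j' where "j = Suc j'" by (cases j) auto
    hence "g ** r i = g ** r j'" using Suc.prems(1) by (simp add: r)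
    hence "r i = r j'" by (rule cancel)
    thus ?case using Suc.IH[of j'] Suc.prems(2) \<open>j = Suc j'\<close> by simp
  qed
  moreover have "\<not> inj r"
  proof
    assume "inj r"
    moreover have "finite (range r)" using rG by (intro finite_subset[OF _ finite_G]) auto
    ultimately show False using finite_imageD infinite_UNIV_nat by blast
  qed
  then obtain i j where "r i = r j" "i < j"
    unfolding inj_def by (metis linorder_neqE_nat)
  ultimately obtain N where N: "N > 0" "r N = mat 1" by blast
  have "mat_power (cmat g) k = cmat (r k)" for k
    by (induction k) (simp_all add: mat_power_Suc r cmat_mult)
  thus ?thesis using that N by simp
qed

text \<open>A reflection has square \<open>1\<close> and trace \<open>n - 2\<close>, so exactly one eigenvalue is \<open>-1\<close>. Conversely, a single eigenvalue
  different from \<open>1\<close> is real because the trace is, so it is \<open>-1\<close>, and \<open>1 - g\<close> has rank one.\<close>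

lemma eigenvalues:
  assumes g: "g \<in> G"
  obtains \<mu> :: "'n \<Rightarrow> complex" where
    "\<And>d. sym_trace (cmat g) d = sym_trace (diagonal_matrix \<mu>) d"
    "\<And>i. norm (\<mu> i) = 1"
    "(\<forall>i. \<mu> i = 1) \<longleftrightarrow> g = mat 1"
    "(\<exists>i. \<mu> i \<noteq> 1 \<and> (\<forall>j. j \<noteq> i \<longrightarrow> \<mu> j = 1)) \<longleftrightarrow> g \<in> reflections"
    "\<And>i. g \<in> reflections \<Longrightarrow> \<mu> i \<noteq> 1 \<Longrightarrow> \<mu> i = - 1"
proof -
  obtain N where N: "N > 0" "mat_power (cmat g) N = mat 1" using g by (rule finite_order)
  obtain P Q :: "complex^'n^'n" and \<mu> :: "'n \<Rightarrow> complex" where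
    PQ: "P ** Q = mat 1" "Q ** P = mat 1" and A: "cmat g = P ** diagonal_matrix \<mu> ** Q"
    and norm: "\<And>i. norm (\<mu> i) = 1"
    by (rule finite_order_diagonalizable[OF N]) blast
  have conj: "P ** X ** Q = P ** Y ** Q \<longleftrightarrow> X = Y" for X Y
  proof
    assume "P ** X ** Q = P ** Y ** Q"
    hence "Q ** (P ** X ** Q) ** P = Q ** (P ** Y ** Q) ** P" by simp
    hence "(Q ** P) ** X ** (Q ** P) = (Q ** P) ** Y ** (Q ** P)" by (simp only: matrix_mul_assoc)
    thus "X = Y" by (simp add: PQ)
  qed simp
  have conj_trace: "trace (P ** X ** Q) = trace X" for X
  proof -
    have "trace (P ** X ** Q) = trace (Q ** (P ** X))" by (rule trace_matrix_mult_commute)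
    thus ?thesis by (simp add: matrix_mul_assoc PQ)
  qed
  have conj_1: "mat 1 = P ** diagonal_matrix (\<lambda>_. 1) ** Q"
    by (simp add: diagonal_matrix_1 PQ)
  have sq: "cmat (g ** g) = P ** diagonal_matrix (\<lambda>i. \<mu> i * \<mu> i) ** Q"
  proof -
    have "cmat (g ** g) = P ** diagonal_matrix \<mu> ** (Q ** P) ** diagonal_matrix \<mu> ** Q"
      unfolding cmat_mult A by (simp only: matrix_mul_assoc)
    also have "\<dots> = P ** (diagonal_matrix \<mu> ** diagonal_matrix \<mu>) ** Q"
      unfolding PQ by (simp only: matrix_mul_rid matrix_mul_assoc)
    finally show ?thesis by (simp only: diagonal_matrix_mult)
  qed
  have trace: "of_real (trace g) = (\<Sum>i\<in>UNIV. \<mu> i)"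
  proof -
    have "of_real (trace g) = trace (cmat g)" by (simp add: trace_def cmat_def)
    thus ?thesis by (simp add: A conj_trace trace_diagonal_matrix)
  qed
  have sq1: "g ** g = mat 1 \<longleftrightarrow> (\<forall>i. \<mu> i * \<mu> i = 1)"
  proof -
    have "g ** g = mat 1 \<longleftrightarrow> cmat (g ** g) = cmat (mat 1)" by (simp only: cmat_eq_iff)
    also have "\<dots> \<longleftrightarrow> (\<lambda>i. \<mu> i * \<mu> i) = (\<lambda>_. 1)"
      unfolding sq cmat_1 conj_1 conj diagonal_matrix_eq_iff ..
    finally show ?thesis by (simp add: fun_eq_iff)
  qed
  have pm1: "\<mu> i = 1 \<or> \<mu> i = - 1" if "g \<in> reflections" for i
    using sq1 reflection_square[OF that] by (metis square_eq_1_iff)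
  have one: "(\<forall>i. \<mu> i = 1) \<longleftrightarrow> g = mat 1"
  proof -
    have "g = mat 1 \<longleftrightarrow> cmat g = cmat (mat 1)" by (simp only: cmat_eq_iff)
    also have "\<dots> \<longleftrightarrow> \<mu> = (\<lambda>_. 1)" unfolding A cmat_1 conj_1 conj diagonal_matrix_eq_iff ..
    finally show ?thesis by (simp add: fun_eq_iff)
  qed
  have refl: "(\<exists>i. \<mu> i \<noteq> 1 \<and> (\<forall>j. j \<noteq> i \<longrightarrow> \<mu> j = 1)) \<longleftrightarrow> g \<in> reflections"
  proof
    assume "g \<in> reflections"
    note pm = pm1[OF this]
    define I where "I = {i. \<mu> i \<noteq> 1}"
    \<comment> \<open>each summand is \<open>0\<close> or \<open>2\<close>, so the trace counts the eigenvalues different from \<open>1\<close>\<close>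
    have "(\<Sum>i\<in>UNIV. 1 - \<mu> i) = (2 :: complex)"
      by (simp add: sum_subtractf trace [symmetric] trace_reflection[OF \<open>g \<in> reflections\<close>])
    also have "(\<Sum>i\<in>UNIV. 1 - \<mu> i) = (\<Sum>i\<in>I. 2)"
    proof -
      have "(\<Sum>i\<in>UNIV. 1 - \<mu> i) = (\<Sum>i\<in>I. 1 - \<mu> i)"
        by (intro sum.mono_neutral_right) (auto simp: I_def)
      also have "\<dots> = (\<Sum>i\<in>I. 2)"
      proof (intro sum.cong refl)
        fix i assume "i \<in> I"
        thus "1 - \<mu> i = 2" using pm[of i] by (auto simp: I_def)
      qed
      finally show ?thesis .
    qed
    finally have "of_nat (card I) * (2 :: complex) = 2" by simp
    hence "card I = 1" by simp
    then obtain i where "I = {i}" by (auto simp: card_1_singleton_iff)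
    thus "\<exists>i. \<mu> i \<noteq> 1 \<and> (\<forall>j. j \<noteq> i \<longrightarrow> \<mu> j = 1)" by (auto simp: I_def)
  next
    assume "\<exists>i. \<mu> i \<noteq> 1 \<and> (\<forall>j. j \<noteq> i \<longrightarrow> \<mu> j = 1)"
    then obtain i where i: "\<mu> i \<noteq> 1" "\<And>j. j \<noteq> i \<Longrightarrow> \<mu> j = 1" by blast
    have "(\<Sum>j\<in>UNIV. \<mu> j) = \<mu> i + (\<Sum>j\<in>UNIV-{i}. 1)"
      by (subst sum.remove[of UNIV i]) (auto simp: i(2))
    hence "\<mu> i = of_real (trace g - real (card (UNIV - {i})))" by (simp add: trace [symmetric])
    hence "\<mu> i \<in> \<real>" by (simp only: Reals_of_real)
    hence \<mu>i: "\<mu> i = - 1" by (intro real_unit_complex norm i(1))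
    have "\<mu> j * \<mu> j = 1" for j by (cases "j = i") (simp_all add: \<mu>i i(2))
    hence gg: "g ** g = mat 1" unfolding sq1 by blast
    let ?E = "diagonal_matrix (\<lambda>j. if j = i then 2 else 0) :: complex^'n^'n"
    have M: "of_real ((mat 1 - g) $ a $ b) = 2 * (P $ a $ i * Q $ i $ b)" for a b
    proof -
      have "of_real ((mat 1 - g) $ a $ b) = ((mat 1 :: complex^'n^'n) - cmat g) $ a $ b"
        by (simp add: cmat_def Finite_Cartesian_Product.mat_def)
      also have "(mat 1 :: complex^'n^'n) - cmat g = P ** (diagonal_matrix (\<lambda>_. 1) - diagonal_matrix \<mu>) ** Q"
        unfolding A by (subst conj_1) (simp add: matrix_sub_ldistrib matrix_sub_rdistrib)
      also have "diagonal_matrix (\<lambda>_. 1) - diagonal_matrix \<mu> = ?E"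
        using \<mu>i i(2) by (auto simp: diagonal_matrix_def Finite_Cartesian_Product.vec_eq_iff)
      also have "(P ** ?E ** Q) $ a $ b = 2 * (P $ a $ i * Q $ i $ b)"
      proof -
        have 1: "(P ** ?E) $ a $ l = (if l = i then 2 * P $ a $ i else 0)" for l
        proof -
          have "(P ** ?E) $ a $ l
              = (\<Sum>k\<in>UNIV. if k = l then (if l = i then 2 * P $ a $ i else 0) else 0)"
            unfolding matrix_matrix_mult_def vec_lambda_beta by (intro sum.cong) (auto simp: diagonal_matrix_def)
          thus ?thesis by simp
        qed
        have "(P ** ?E ** Q) $ a $ b
            = (\<Sum>l\<in>UNIV. (P ** ?E) $ a $ l * Q $ l $ b)"
          by (simp add: matrix_matrix_mult_def)
        also have "\<dots> = (\<Sum>l\<in>UNIV. if l = i then 2 * (P $ a $ i * Q $ i $ b) else 0)"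
          unfolding 1 by (intro sum.cong) auto
        finally show ?thesis by simp
      qed
      finally show ?thesis .
    qed
    show "g \<in> reflections"
    proof (rule rank_one_involution_is_reflection[OF orthogonal_G[OF g] gg])
      show "g \<noteq> mat 1" using one i(1) by blast
      fix a b c d
      have "complex_of_real ((mat 1 - g) $ a $ b * (mat 1 - g) $ c $ d)
          = of_real ((mat 1 - g) $ a $ d * (mat 1 - g) $ c $ b)"
        unfolding of_real_mult M by simp
      thus "(mat 1 - g) $ a $ b * (mat 1 - g) $ c $ d = (mat 1 - g) $ a $ d * (mat 1 - g) $ c $ b"
        by (simp only: of_real_eq_iff)
    qed
  qed
  have tr: "sym_trace (cmat g) d = sym_trace (diagonal_matrix \<mu>) d" for d
  proof -
    have "sym_trace (cmat g) d = sym_trace (Q ** (P ** diagonal_matrix \<mu>)) d"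
      unfolding A by (rule sym_trace_commute)
    thus ?thesis by (simp add: matrix_mul_assoc PQ)
  qed
  show ?thesis using that[OF tr norm one refl] pm1 by blast
qed

end

subsection \<open>The pole of the graded trace at 1\<close>

text \<open>The product of \<open>1 - t\<close> and \<open>1 / (1 - t z)\<close>, with its removable singularity at \<open>1\<close> for \<open>z = 1\<close> filled in.\<close>

definition pole_factor :: "complex \<Rightarrow> complex \<Rightarrow> complex" where
  "pole_factor z t = (if z = 1 then 1 else (1 - t) / (1 - t * z))"

lemma pole_factor_at_1: "pole_factor z 1 = (if z = 1 then 1 else 0)"
  by (simp add: pole_factor_def)

lemma pole_factor_deriv:
  "(pole_factor z has_field_derivative (if z = 1 then 0 else - 1 / (1 - z))) (at 1)"
proof (cases "z = 1")
  case True
  thus ?thesis by (simp add: pole_factor_def[abs_def])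
next
  case False
  define w where "w = 1 - z"
  have "w \<noteq> 0" using False by (simp add: w_def)
  have "((\<lambda>t. (1 - t) / (1 - t * z)) has_field_derivative - w / (w * w)) (at 1)"
    using False by (auto intro!: derivative_eq_intros simp: w_def)
  also have "- w / (w * w) = - 1 / (1 - z)"
    using \<open>w \<noteq> 0\<close> by (simp add: field_simps flip: w_def)
  finally have "((\<lambda>t. (1 - t) / (1 - t * z)) has_field_derivative - 1 / (1 - z)) (at 1)" .
  thus ?thesis using False by (simp add: pole_factor_def[abs_def])
qed

text \<open>The function \<open>K\<close> has one factor for every eigenvalue, and those of the eigenvalues other than \<open>1\<close> vanish at \<open>1\<close>.
  With two of them the derivative vanishes as well; with exactly one, which is \<open>-1\<close>, it is that of
  \<open>(1 - t) / (1 + t)\<close>.\<close>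

lemma (in reflection_group) graded_trace_pole:
  assumes g: "g \<in> G"
  obtains K :: "complex \<Rightarrow> complex" where
    "\<And>t. 0 < t \<Longrightarrow> t < 1 \<Longrightarrow> (\<lambda>d. sym_trace (cmat g) d * of_real t ^ d) sums (K (of_real t) / of_real (1 - t) ^ CARD('n))"
    "K 1 = (if g = mat 1 then 1 else 0)"
    "(K has_field_derivative (if g \<in> reflections then - 1 / 2 else 0)) (at 1)"
proof -
  obtain \<mu> :: "'n \<Rightarrow> complex" where \<mu>:
    "\<And>d. sym_trace (cmat g) d = sym_trace (diagonal_matrix \<mu>) d"
    "\<And>i. norm (\<mu> i) = 1"
    "(\<forall>i. \<mu> i = 1) \<longleftrightarrow> g = mat 1"
    "(\<exists>i. \<mu> i \<noteq> 1 \<and> (\<forall>j. j \<noteq> i \<longrightarrow> \<mu> j = 1)) \<longleftrightarrow> g \<in> reflections"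
    "\<And>i. g \<in> reflections \<Longrightarrow> \<mu> i \<noteq> 1 \<Longrightarrow> \<mu> i = - 1"
    by (rule eigenvalues[OF g]) blast
  define K where "K t = (\<Prod>i\<in>UNIV. pole_factor (\<mu> i) t)" for t
  have 1: "(\<lambda>d. sym_trace (cmat g) d * of_real t ^ d) sums (K (of_real t) / of_real (1 - t) ^ CARD('n))"
    if t: "0 < t" "t < 1" for t
  proof -
    have "1 / (1 - of_real t * \<mu> i) = pole_factor (\<mu> i) (of_real t) / of_real (1 - t)" for i
      using t by (simp add: pole_factor_def field_simps)
    hence "(\<Prod>i\<in>UNIV. 1 / (1 - of_real t * \<mu> i)) = K (of_real t) / of_real (1 - t) ^ CARD('n)"
      by (simp add: K_def prod_dividef)
    thus ?thesis using sums_diag_trace[of \<mu> t, OF \<mu>(2)] t by (simp add: \<mu>(1))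
  qed
  have 2: "K 1 = (if g = mat 1 then 1 else 0)"
    unfolding K_def pole_factor_at_1 \<mu>(3)[symmetric] by (auto intro!: prod_zero)
  define D where "D = (\<Sum>i\<in>UNIV. (if \<mu> i = 1 then 0 else - 1 / (1 - \<mu> i)) * (\<Prod>j\<in>UNIV - {i}. pole_factor (\<mu> j) 1))"
  have "(K has_field_derivative D) (at 1)"
    unfolding K_def[abs_def] D_def by (rule has_field_derivative_prod) (rule pole_factor_deriv)
  moreover have "D = (if g \<in> reflections then - 1 / 2 else 0)"
  proof -
    have prod: "(\<Prod>j\<in>UNIV - {i}. pole_factor (\<mu> j) 1) = (if \<forall>j. j \<noteq> i \<longrightarrow> \<mu> j = 1 then 1 else 0)" for i
    proof (cases "\<forall>j. j \<noteq> i \<longrightarrow> \<mu> j = 1")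
      case False
      then obtain j where "j \<noteq> i" "\<mu> j \<noteq> 1" by blast
      hence "(\<Prod>j\<in>UNIV - {i}. pole_factor (\<mu> j) 1) = 0"
        by (intro prod_zero) (auto simp: pole_factor_at_1)
      thus ?thesis by (simp only: if_not_P[OF False])
    qed (simp add: pole_factor_at_1)
    show ?thesis
    proof (cases "g \<in> reflections")
      case True
      then obtain i where i: "\<mu> i \<noteq> 1" "\<forall>j. j \<noteq> i \<longrightarrow> \<mu> j = 1" using \<mu>(4) by blast
      have "D = (\<Sum>k\<in>UNIV. if k = i then - 1 / 2 else 0)"
        unfolding D_def prod using i \<mu>(5)[OF True i(1)] by (intro sum.cong) auto
      thus ?thesis using True by simp
    next
      case False
      hence "\<not> (\<mu> i \<noteq> 1 \<and> (\<forall>j. j \<noteq> i \<longrightarrow> \<mu> j = 1))" for i using \<mu>(4) by blast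
      hence "D = 0" unfolding D_def prod by (intro sum.neutral) auto
      thus ?thesis using False by simp
    qed
  qed
  ultimately show ?thesis using that[of K, OF 1 2] by simp
qed

text \<open>The series converge for \<open>t < 1\<close> only; this lemma carries an identity between their sums over to values
  and derivatives at \<open>1\<close>.\<close>

lemma deriv_zero_of_vanishing_left:
  fixes f :: "complex \<Rightarrow> complex"
  assumes deriv: "(f has_field_derivative D) (at 1)" and zero: "\<And>t. 0 < t \<Longrightarrow> t < 1 \<Longrightarrow> f (of_real t) = 0"
  shows "f 1 = 0" "D = 0"
proof -
  have lim: "filterlim complex_of_real (at 1) (at_left 1)"
    unfolding filterlim_at
    by (auto intro!: tendsto_eq_intros simp: eventually_at_filter)
  have ev: "eventually (\<lambda>t::real. 0 < t \<and> t < 1) (at_left 1)"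
    using eventually_at_left_real[of 0 1] by simp
  have "(f \<longlongrightarrow> f 1) (at 1)" using DERIV_isCont[OF deriv] by (simp add: isCont_def)
  hence "((\<lambda>t. f (complex_of_real t)) \<longlongrightarrow> f 1) (at_left 1)"
    using lim by (rule filterlim_compose)
  moreover have "((\<lambda>t. f (complex_of_real t)) \<longlongrightarrow> 0) (at_left 1)"
    by (rule tendsto_eventually) (rule eventually_mono[OF ev], simp add: zero)
  ultimately show f1: "f 1 = 0" by (rule tendsto_unique[rotated]) simp
  have "((\<lambda>y. (f y - f 1) / (y - 1)) \<longlongrightarrow> D) (at 1)" using deriv by (simp add: has_field_derivative_iff)
  hence "((\<lambda>t. (f (complex_of_real t) - f 1) / (complex_of_real t - 1)) \<longlongrightarrow> D) (at_left 1)"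
    using lim by (rule filterlim_compose)
  moreover have "((\<lambda>t. (f (complex_of_real t) - f 1) / (complex_of_real t - 1)) \<longlongrightarrow> 0) (at_left 1)"
    by (rule tendsto_eventually) (rule eventually_mono[OF ev], simp add: zero f1)
  ultimately show "D = 0" by (rule tendsto_unique[rotated]) simp
qed

section \<open>The negative eigenspace of an involution\<close>

definition mtrace :: "complex Matrix.mat \<Rightarrow> complex" where
  "mtrace A = (\<Sum>i<dim_row A. A $$ (i, i))"

lemma mtrace_commute:
  assumes "A \<in> carrier_mat n n" "B \<in> carrier_mat n n"
  shows "mtrace (A * B) = mtrace (B * A)"
proof -
  have *: "mtrace (A * B) = (\<Sum>i<n. \<Sum>k<n. A $$ (i, k) * B $$ (k, i))"
    if "A \<in> carrier_mat n n" "B \<in> carrier_mat n n" for A B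
  proof -
    have "(A * B) $$ (i, i) = (\<Sum>k<n. A $$ (i, k) * B $$ (k, i))" if "i < n" for i
      using \<open>A \<in> carrier_mat n n\<close> \<open>B \<in> carrier_mat n n\<close> that
      by (simp add: scalar_prod_def lessThan_atLeast0)
    thus ?thesis using that by (simp add: mtrace_def)
  qed
  show ?thesis
    unfolding *[OF assms] *[OF assms(2,1)] by (subst sum.swap) (simp add: mult.commute)
qed

lemma mtrace_similar:
  assumes "similar_mat A B"
  shows "mtrace A = mtrace B"
proof -
  obtain P Q where w: "similar_mat_wit A B P Q" using assms by (auto simp: similar_mat_def)
  define n where "n = dim_row A"
  note d = similar_mat_witD[OF n_def w]
  have "mtrace A = mtrace (P * (B * Q))"
    unfolding d(3) by (simp only: assoc_mult_mat[OF d(6,5,7)])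
  also have "\<dots> = mtrace (B * Q * P)"
    by (rule mtrace_commute[OF d(6)]) (rule mult_carrier_mat[OF d(5,7)])
  also have "B * Q * P = B"
    unfolding assoc_mult_mat[OF d(5,7,6)] d(2) by (rule right_mult_one_mat[OF d(5)])
  finally show ?thesis .
qed

lemma mtrace_jordan_matrix_ones: "mtrace (jordan_matrix (map (Pair 1) ds)) = sum_list ds"
proof (induction ds)
  case Nil
  show ?case by (simp add: mtrace_def)
next
  case (Cons d ds)
  let ?J = "jordan_matrix (map (Pair 1) ds)"
  have len: "sum_list (map fst (map (Pair (1::nat)) ds)) = length ds" by (induction ds) auto
  have "mtrace (jordan_matrix (map (Pair 1) (d # ds))) = (\<Sum>i<Suc (length ds). jordan_matrix (map (Pair 1) (d # ds)) $$ (i, i))"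
    using len by (simp add: mtrace_def)
  also have "\<dots> = d + (\<Sum>i<length ds. ?J $$ (i, i))"
    unfolding sum.lessThan_Suc_shift using len by (simp add: jordan_matrix_Cons)
  also have "(\<Sum>i<length ds. ?J $$ (i, i)) = mtrace ?J"
    using len by (simp add: mtrace_def)
  finally show ?case using Cons.IH by simp
qed

lemma sum_list_eq_pointwise:
  fixes f g :: "'a \<Rightarrow> nat"
  assumes "\<And>x. x \<in> set xs \<Longrightarrow> g x \<le> f x" "sum_list (map f xs) = sum_list (map g xs)" "x \<in> set xs"
  shows "f x = g x"
  using assms
proof (induction xs)
  case (Cons y ys)
  have "sum_list (map g ys) \<le> sum_list (map f ys)"
    using Cons.prems(1) by (intro sum_list_mono) auto
  hence "f y = g y" "sum_list (map f ys) = sum_list (map g ys)"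
    using Cons.prems(1)[of y] Cons.prems(2) by auto
  thus ?case using Cons by auto
qed simp

text \<open>An eigenvalue \<open>a\<close> satisfies \<open>a\<^sup>2 = 1\<close>, whence \<open>(B - a)\<^sup>2 = -2 a (B - a)\<close>. So \<open>B - a\<close> has the same kernel as its square,
  which leaves no room for a Jordan block of size at least two.\<close>

lemma involution_jordan_blocks:
  assumes B: "B \<in> carrier_mat m m" "B * B = 1\<^sub>m m" and jnf: "jordan_nf B n_as" and mem: "(n, a) \<in> set n_as"
  shows "n = 1" "a = 1 \<or> a = (- 1 :: complex)"
proof -
  have n0: "n \<noteq> 0" if "(n, a) \<in> set n_as" for n a
    using jnf that by (force simp: jordan_nf_def)
  have "poly (char_poly B) a = 0"
    unfolding jordan_nf_char_poly[OF jnf] using mem n0[OF mem]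
    by (force simp: poly_prod_list prod_list_zero_iff)
  then obtain v where v: "v \<in> carrier_vec m" "v \<noteq> 0\<^sub>v m" "B *\<^sub>v v = a \<cdot>\<^sub>v v"
    using eigenvalue_root_char_poly[OF B(1)] B(1) by (auto simp: eigenvalue_def eigenvector_def)
  have "v = B *\<^sub>v (B *\<^sub>v v)" using B v(1) by (simp flip: assoc_mult_mat_vec)
  also have "\<dots> = a \<cdot>\<^sub>v (a \<cdot>\<^sub>v v)" using B(1) v by (simp add: mult_mat_vec)
  finally have vv: "v = (a * a) \<cdot>\<^sub>v v" by (simp add: smult_smult_assoc)
  obtain i where i: "i < m" "vec_index v i \<noteq> 0"
    using v(1,2) by (metis carrier_vecD eq_vecI index_zero_vec)
  have "vec_index v i = a * a * vec_index v i"
    using arg_cong[OF vv, of "\<lambda>w. vec_index w i"] i(1) v(1) by simp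
  hence aa: "a * a = 1" using i(2) by simp
  thus "a = 1 \<or> a = - 1" by (simp add: square_eq_1_iff)
  define X where "X = char_matrix B a"
  have X: "X \<in> carrier_mat m m" using B(1) by (simp add: X_def)
  have Xe: "X = B + (- a) \<cdot>\<^sub>m 1\<^sub>m m" using B(1) by (simp add: X_def char_matrix_def)
  have XX: "X * X = X * ((- 2 * a) \<cdot>\<^sub>m 1\<^sub>m m)"
  proof -
    have "X * X = X * B + X * ((- a) \<cdot>\<^sub>m 1\<^sub>m m)"
      using X B(1) by (subst (2) Xe) (simp add: mult_add_distrib_mat)
    also have "X * B = 1\<^sub>m m + (- a) \<cdot>\<^sub>m B"
    proof -
      have "(c \<cdot>\<^sub>m 1\<^sub>m m) * B = c \<cdot>\<^sub>m B" for c
        by (simp add: mult_smult_assoc_mat[OF one_carrier_mat B(1)] left_mult_one_mat[OF B(1)])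
      thus ?thesis using B by (simp add: Xe add_mult_distrib_mat)
    qed
    also have "\<dots> = (- a) \<cdot>\<^sub>m X"
    proof (rule eq_matI)
      fix i j assume "i < dim_row ((- a) \<cdot>\<^sub>m X)" "j < dim_col ((- a) \<cdot>\<^sub>m X)"
      hence ij: "i < m" "j < m" using X by auto
      show "(1\<^sub>m m + (- a) \<cdot>\<^sub>m B) $$ (i, j) = ((- a) \<cdot>\<^sub>m X) $$ (i, j)"
        using ij B(1) aa by (simp add: Xe algebra_simps)
    qed (use X B(1) in auto)
    also have "(- a) \<cdot>\<^sub>m X + X * ((- a) \<cdot>\<^sub>m 1\<^sub>m m) = X * ((- 2 * a) \<cdot>\<^sub>m 1\<^sub>m m)"
    proof -
      have "X * (c \<cdot>\<^sub>m 1\<^sub>m m) = c \<cdot>\<^sub>m X" for c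
        by (simp add: mult_smult_distrib[OF X one_carrier_mat] right_mult_one_mat[OF X])
      moreover have "(- a) \<cdot>\<^sub>m X + (- a) \<cdot>\<^sub>m X = (- 2 * a) \<cdot>\<^sub>m X"
        by (rule eq_matI) (use X in auto)
      ultimately show ?thesis by simp
    qed
    finally show ?thesis .
  qed
  have "a \<noteq> 0" using aa by auto
  have inv: "((- 2 * a) \<cdot>\<^sub>m 1\<^sub>m m) * ((inverse (- 2 * a)) \<cdot>\<^sub>m 1\<^sub>m m) = 1\<^sub>m m"
    using \<open>a \<noteq> 0\<close> by (intro eq_matI) (auto simp: mult_smult_distrib mult_smult_assoc_mat[of _ m m _ m])
  have "dim_gen_eigenspace B a 2 = kernel.dim m (X * X)"
    using X by (simp add: dim_gen_eigenspace_def kernel_dim_def numeral_2_eq_2 flip: X_def)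
  also have "\<dots> = kernel.dim m X"
    unfolding XX by (rule mat_kernel_dim_mult_eq_right[OF X _ _ inv]) auto
  also have "\<dots> = dim_gen_eigenspace B a 1"
    using X by (simp add: dim_gen_eigenspace_def kernel_dim_def flip: X_def)
  finally have eq: "(\<Sum>n \<leftarrow> map fst [(n, e)\<leftarrow>n_as . e = a]. min 2 n) = (\<Sum>n \<leftarrow> map fst [(n, e)\<leftarrow>n_as . e = a]. min 1 n)"
    unfolding dim_gen_eigenspace[OF jnf] .
  have "n \<in> set (map fst [(n, e)\<leftarrow>n_as . e = a])" using mem by force
  from sum_list_eq_pointwise[OF _ eq this] have "min 2 n = min 1 n" by simp
  thus "n = 1" using n0[OF mem] by (simp add: min_def split: if_splits)
qed

lemma kernel_dim_involution:
  assumes B: "B \<in> carrier_mat m m" "B * B = 1\<^sub>m m"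
  shows "mtrace B = of_nat m - 2 * of_nat (kernel_dim (char_matrix B (- 1)))"
proof -
  obtain as where "char_poly B = (\<Prod>a\<leftarrow>as. [:- a, 1:])"
    using char_poly_factorized[OF B(1)] by blast
  then obtain n_as where jnf: "jordan_nf B n_as" using jordan_nf_exists[OF B(1)] by blast
  define ds where "ds = map snd n_as"
  have n_as: "n_as = map (Pair 1) ds"
  proof -
    have "map (\<lambda>x. x) n_as = map (\<lambda>x. (1, snd x)) n_as"
      using involution_jordan_blocks(1)[OF B jnf] by (intro map_cong) auto
    thus ?thesis by (simp add: ds_def comp_def)
  qed
  have ds: "d = 1 \<or> d = - 1" if "d \<in> set ds" for d
    using involution_jordan_blocks(2)[OF B jnf, of 1 d] that by (auto simp: n_as)
  have sim: "similar_mat B (jordan_matrix n_as)" using jnf by (simp add: jordan_nf_def)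
  have len: "length ds = m"
  proof -
    have "jordan_matrix n_as \<in> carrier_mat m m"
      using similar_matD[OF sim] B(1) by (metis carrier_matD(1) insert_subset)
    hence "sum_list (map fst n_as) = m" by (metis carrier_matD(1) jordan_matrix_dim(1))
    thus ?thesis by (simp add: n_as comp_def sum_list_triv)
  qed
  have "kernel_dim (char_matrix B (- 1)) = dim_gen_eigenspace B (- 1) 1"
    using B(1) by (simp add: dim_gen_eigenspace_def)
  also have "\<dots> = length (filter (\<lambda>d. d = - 1) ds)"
    unfolding dim_gen_eigenspace[OF jnf] n_as by (induction ds) auto
  finally have kd: "kernel_dim (char_matrix B (- 1)) = length (filter (\<lambda>d. d = - 1) ds)" .
  have "mtrace B = sum_list ds"
    unfolding mtrace_similar[OF sim] n_as by (rule mtrace_jordan_matrix_ones)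
  also have "\<dots> = of_nat (length ds) - 2 * of_nat (length (filter (\<lambda>d. d = - 1) ds))"
    using ds by (induction ds) auto
  finally show ?thesis by (simp add: kd len)
qed

section \<open>The graded multiplicity of a module at 1\<close>

context covariants
begin

lemma harm_series_finite:
  "harm_series G \<sigma> W t = (\<Sum>d\<le>CARD('n) * card G. real (harm_mult G \<sigma> W d) * t ^ d)"
  unfolding harm_series_def by (rule suminf_finite) (auto simp: harm_mult_eq_0)

lemma gtrace_one: "gtrace W (mat 1) = of_nat (gdim W)"
  using gmodule by (simp add: gtrace_def is_gmodule_def)

text \<open>For \<open>0 < t < 1\<close> the convolution formula reads \<open>H NR = NW\<close>, where \<open>NR\<close> and \<open>NW\<close> are the two Molien series without the
  common factor \<open>1 / (|G| (1 - t)\<^sup>n)\<close>. At \<open>1\<close> the identity contributes the values of \<open>NR\<close> and \<open>NW\<close>, and the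
  reflections their derivatives.\<close>

lemma harm_series_at_1:
  shows "harm_series G \<sigma> W 1 = real (gdim W)"
    and "\<exists>D. (harm_series G \<sigma> W has_field_derivative D) (at 1) \<and>
      of_real D = (of_nat (card (G \<inter> reflections)) * of_nat (gdim W) - (\<Sum>s\<in>G \<inter> reflections. gtrace W s)) / 2"
proof -
  define P where "P g K \<longleftrightarrow>
      (\<forall>t. 0 < t \<longrightarrow> t < 1 \<longrightarrow> (\<lambda>d. sym_trace (cmat g) d * of_real t ^ d) sums (K (of_real t) / of_real (1 - t) ^ CARD('n))) \<and>
      K 1 = (if g = mat 1 then 1 else 0) \<and>
      (K has_field_derivative (if g \<in> reflections then - 1 / 2 else 0)) (at 1)" for g :: "'n rmat" and K :: "complex \<Rightarrow> complex"
  have "\<exists>K. P g K" if g: "g \<in> G" for g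
  proof (rule graded_trace_pole[OF g])
    fix K :: "complex \<Rightarrow> complex"
    assume "\<And>t. 0 < t \<Longrightarrow> t < 1 \<Longrightarrow> (\<lambda>d. sym_trace (cmat g) d * of_real t ^ d) sums (K (of_real t) / of_real (1 - t) ^ CARD('n))"
      "K 1 = (if g = mat 1 then 1 else 0)" "(K has_field_derivative (if g \<in> reflections then - 1 / 2 else 0)) (at 1)"
    hence "P g K" unfolding P_def by blast
    thus ?thesis by blast
  qed
  then obtain K where K: "\<And>g. g \<in> G \<Longrightarrow> P g (K g)" by metis
  define D where "D = CARD('n) * card G"
  define h where "h d = harm_mult G \<sigma> W d" for d
  define H where "H t = (\<Sum>d\<le>D. of_nat (h d) * t ^ d)" for t :: complex
  define NR where "NR t = (\<Sum>g\<in>G. K g t)" for t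
  define NW where "NW t = (\<Sum>g\<in>G. gtrace W g * K g t)" for t
  have identity: "H (of_real t) * NR (of_real t) - NW (of_real t) = 0" if t: "0 < t" "t < 1" for t
  proof -
    define c where "c = of_nat (card G) * complex_of_real (1 - t) ^ CARD('n)"
    have c0: "c \<noteq> 0" using t by (simp add: c_def)
    have Ksums: "(\<lambda>d. sym_trace (cmat g) d * of_real t ^ d) sums (K g (of_real t) / of_real (1 - t) ^ CARD('n))"
      if "g \<in> G" for g using K[OF that] t by (simp add: P_def)
    define a where "a k = of_nat (cpoly.dim (invariants_deg k)) * complex_of_real t ^ k" for k
    define b where "b k = of_nat (h k) * complex_of_real t ^ k" for k
    have a: "a sums (NR (of_real t) / c)"
    proof -
      have "(\<lambda>d. (\<Sum>g\<in>G. sym_trace (cmat g) d * of_real t ^ d) / of_nat (card G)) sums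
          ((\<Sum>g\<in>G. K g (of_real t) / of_real (1 - t) ^ CARD('n)) / of_nat (card G))"
        by (intro sums_divide sums_sum Ksums)
      moreover have "(\<lambda>d. (\<Sum>g\<in>G. sym_trace (cmat g) d * of_real t ^ d) / of_nat (card G)) = a"
        by (rule ext) (simp add: a_def dim_invariants_deg sum_distrib_right)
      moreover have "(\<Sum>g\<in>G. K g (of_real t) / of_real (1 - t) ^ CARD('n)) / of_nat (card G) = NR (of_real t) / c"
        by (simp add: NR_def c_def sum_divide_distrib [symmetric] mult.commute)
      ultimately show ?thesis by (simp only:)
    qed
    have w: "(\<lambda>d. of_nat (covs.dim (covs_deg d)) * complex_of_real t ^ d) sums (NW (of_real t) / c)"
    proof -
      have "(\<lambda>d. (\<Sum>g\<in>G. gtrace W g * (sym_trace (cmat g) d * of_real t ^ d)) / of_nat (card G)) sums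
          ((\<Sum>g\<in>G. gtrace W g * (K g (of_real t) / of_real (1 - t) ^ CARD('n))) / of_nat (card G))"
        by (intro sums_divide sums_sum sums_mult Ksums)
      moreover have "(\<lambda>d. (\<Sum>g\<in>G. gtrace W g * (sym_trace (cmat g) d * of_real t ^ d)) / of_nat (card G))
          = (\<lambda>d. of_nat (covs.dim (covs_deg d)) * complex_of_real t ^ d)"
        by (rule ext) (simp add: dim_covs_deg sum_distrib_right mult.assoc)
      moreover have "(\<Sum>g\<in>G. gtrace W g * (K g (of_real t) / of_real (1 - t) ^ CARD('n))) / of_nat (card G) = NW (of_real t) / c"
        by (simp add: NW_def c_def sum_divide_distrib [symmetric] mult.commute[of "of_nat (card G)"])
      ultimately show ?thesis by (simp only:)
    qed
    have norm_a: "norm (a k) = real (cpoly.dim (invariants_deg k)) * t ^ k" for k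
      using t by (simp add: a_def norm_mult norm_power)
    have "summable (\<lambda>k. complex_of_real (norm (a k)))"
      unfolding norm_a using sums_summable[OF a] by (simp add: a_def[abs_def])
    hence "summable (\<lambda>k. norm (a k))" by (simp only: summable_complex_of_real)
    moreover have b0: "b k = 0" if "k \<notin> {..D}" for k
      using that harm_mult_eq_0[of k W] by (simp add: b_def h_def D_def)
    hence "summable (\<lambda>k. norm (b k))" by (intro summable_finite[of "{..D}"]) auto
    ultimately have "(\<lambda>k. \<Sum>i\<le>k. a i * b (k - i)) sums (suminf a * suminf b)"
      by (rule Cauchy_product_sums)
    also have "suminf a = NR (of_real t) / c" using a by (rule sums_unique[symmetric])
    also have "suminf b = H (of_real t)"
      using b0 by (subst suminf_finite[of "{..D}"]) (auto simp: H_def b_def)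
    also have "(\<lambda>k. \<Sum>i\<le>k. a i * b (k - i)) = (\<lambda>d. of_nat (covs.dim (covs_deg d)) * complex_of_real t ^ d)"
    proof
      fix d
      have "(\<Sum>i\<le>d. a i * b (d - i))
          = (\<Sum>i\<le>d. of_nat (cpoly.dim (invariants_deg i) * h (d - i)) * complex_of_real t ^ d)"
        by (intro sum.cong refl) (simp add: a_def b_def flip: power_add)
      thus "(\<Sum>i\<le>d. a i * b (d - i)) = of_nat (covs.dim (covs_deg d)) * complex_of_real t ^ d"
        unfolding harm_mult_convolution h_def by (simp add: sum_distrib_right)
    qed
    finally have "NR (of_real t) / c * H (of_real t) = NW (of_real t) / c" using w by (rule sums_unique2)
    thus ?thesis using c0 by (simp add: field_simps)
  qed
  define H' where "H' = (\<Sum>d\<le>D. of_nat (h d) * of_nat d :: complex)"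
  have dH: "(H has_field_derivative H') (at 1)"
    unfolding H_def[abs_def] H'_def by (auto intro!: derivative_eq_intros sum.cong)
  have dK: "(K g has_field_derivative (if g \<in> reflections then - 1 / 2 else 0)) (at 1)" if "g \<in> G" for g
    using K[OF that] by (simp add: P_def)
  have dNR: "(NR has_field_derivative (\<Sum>g\<in>G. if g \<in> reflections then - 1 / 2 else 0)) (at 1)"
    unfolding NR_def[abs_def] by (intro DERIV_sum dK)
  have dNW: "(NW has_field_derivative (\<Sum>g\<in>G. gtrace W g * (if g \<in> reflections then - 1 / 2 else 0))) (at 1)"
    unfolding NW_def[abs_def] by (intro DERIV_sum DERIV_cmult dK)
  have K1: "K g 1 = (if g = mat 1 then 1 else 0)" if "g \<in> G" for g using K[OF that] by (simp add: P_def)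
  have NR1: "NR 1 = 1"
    by (simp add: NR_def K1)
  have NW1: "NW 1 = of_nat (gdim W)"
  proof -
    have "NW 1 = (\<Sum>g\<in>G. if g = mat 1 then gtrace W (mat 1) else 0)"
      unfolding NW_def by (intro sum.cong) (auto simp: K1)
    thus ?thesis by (simp add: gtrace_one)
  qed
  have restrict: "(\<Sum>g\<in>G. if g \<in> reflections then f g else 0) = (\<Sum>g\<in>G \<inter> reflections. f g)" for f :: "'n rmat \<Rightarrow> complex"
    by (subst sum.inter_restrict) auto
  have deriv: "((\<lambda>t. H t * NR t - NW t) has_field_derivative
      (H 1 * (\<Sum>g\<in>G. if g \<in> reflections then - 1 / 2 else 0) + H' * NR 1
        - (\<Sum>g\<in>G. gtrace W g * (if g \<in> reflections then - 1 / 2 else 0)))) (at 1)"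
    by (intro DERIV_diff DERIV_mult' dH dNR dNW)
  note zero = deriv_zero_of_vanishing_left[OF deriv identity]
  have H1: "H 1 = of_nat (gdim W)" using zero(1) by (simp add: NR1 NW1)
  have "of_real (harm_series G \<sigma> W 1) = H 1"
    by (simp add: harm_series_finite H_def D_def h_def)
  hence "complex_of_real (harm_series G \<sigma> W 1) = of_real (real (gdim W))" by (simp add: H1)
  thus "harm_series G \<sigma> W 1 = real (gdim W)" by (simp only: of_real_eq_iff)
  have "(\<Sum>g\<in>G. gtrace W g * (if g \<in> reflections then - 1 / 2 else 0)) = (\<Sum>g\<in>G \<inter> reflections. - (gtrace W g / 2))"
    unfolding restrict[symmetric] by (intro sum.cong) auto
  also have "\<dots> = - (\<Sum>g\<in>G \<inter> reflections. gtrace W g) / 2"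
    by (simp add: sum_negf sum_divide_distrib)
  finally have H': "H' = (of_nat (card (G \<inter> reflections)) * of_nat (gdim W) - (\<Sum>s\<in>G \<inter> reflections. gtrace W s)) / 2"
    using zero(2) unfolding H1 NR1 restrict by (simp add: field_simps)
  define D' where "D' = (\<Sum>d\<le>D. real (h d) * real d)"
  have "(harm_series G \<sigma> W has_field_derivative D') (at 1)"
    unfolding harm_series_finite[abs_def] D'_def D_def[symmetric] h_def[symmetric]
    by (auto intro!: derivative_eq_intros sum.cong)
  moreover have "of_real D' = H'" by (simp add: D'_def H'_def)
  ultimately show "\<exists>D. (harm_series G \<sigma> W has_field_derivative D) (at 1) \<and>
      of_real D = (of_nat (card (G \<inter> reflections)) * of_nat (gdim W) - (\<Sum>s\<in>G \<inter> reflections. gtrace W s)) / 2"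
    using H' by metis
qed

subsection \<open>Characters\<close>

lemma gtrace_conv_mtrace: "g \<in> G \<Longrightarrow> gtrace W g = mtrace (gmat W g)"
  using gmat_carrier[of g] by (simp add: gtrace_def mtrace_def)

lemma gmat_mult: "g \<in> G \<Longrightarrow> h \<in> G \<Longrightarrow> gmat W (g ** h) = gmat W g * gmat W h"
  using gmodule by (simp add: is_gmodule_def)

lemma gtrace_conj:
  assumes "g \<in> G" "r \<in> G"
  shows "gtrace W (g ** r ** matrix_inv g) = gtrace W r"
proof -
  have "gtrace W (g ** r ** matrix_inv g) = mtrace (gmat W (g ** r) * gmat W (matrix_inv g))"
    using assms by (simp add: gtrace_conv_mtrace gmat_mult)
  also have "\<dots> = mtrace (gmat W (matrix_inv g) * gmat W (g ** r))"
    using assms by (intro mtrace_commute[of _ "gdim W"] gmat_carrier) auto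
  also have "\<dots> = gtrace W (matrix_inv g ** (g ** r))"
    using assms by (simp add: gtrace_conv_mtrace gmat_mult)
  also have "matrix_inv g ** (g ** r) = r" using assms by (simp add: matrix_mul_assoc matrix_inv_G)
  finally show ?thesis .
qed

lemma gtrace_reflection:
  assumes "s \<in> G" "s \<in> reflections"
  shows "gtrace W s = of_nat (gdim W) - 2 * of_nat (kernel_dim (char_matrix (gmat W s) (- 1)))"
proof -
  have "gmat W s * gmat W s = gmat W (s ** s)" using assms by (simp add: gmat_mult)
  also have "\<dots> = 1\<^sub>m (gdim W)" using gmodule assms by (simp add: reflection_square is_gmodule_def)
  finally show ?thesis
    using kernel_dim_involution[OF gmat_carrier[OF assms(1)]] assms by (simp add: gtrace_conv_mtrace)
qed

end

lemma gtrace_iso_twist: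
  assumes "g \<in> G" and W: "is_gmodule G W" "is_gmodule G W'" and iso: "gmodule_iso G W' (twist W chi)"
  shows "gtrace W' g = chi g * gtrace W g"
proof -
  define m where "m = gdim W"
  have m: "gdim W' = m" using iso by (simp add: gmodule_iso_def twist_def m_def)
  have c: "gmat W g \<in> carrier_mat m m" "gmat W' g \<in> carrier_mat m m"
    using W assms(1) m by (auto simp: is_gmodule_def m_def)
  obtain T where T: "T \<in> carrier_mat m m" "invertible_mat T" "T * gmat W' g = (chi g \<cdot>\<^sub>m gmat W g) * T"
    using iso assms(1) m by (auto simp: gmodule_iso_def twist_def)
  obtain T' where "inverts_mat T T'" "inverts_mat T' T" using T(2) by (auto simp: invertible_mat_def)
  hence T': "T * T' = 1\<^sub>m m" "T' * T = 1\<^sub>m (dim_row T')" using T(1) by (auto simp: inverts_mat_def)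
  have "dim_col (T * T') = m" using T'(1) by simp
  hence "dim_col T' = m" by simp
  moreover have "dim_col (T' * T) = dim_row T'" using T'(2) by simp
  hence "dim_row T' = m" using T(1) by simp
  ultimately have cT': "T' \<in> carrier_mat m m" by auto
  have T'T: "T' * T = 1\<^sub>m m" using T'(2) \<open>dim_row T' = m\<close> by simp
  define Y where "Y = chi g \<cdot>\<^sub>m gmat W g"
  have Y: "Y \<in> carrier_mat m m" using c(1) by (simp add: Y_def)
  have "gmat W' g = T' * T * gmat W' g" using c(2) by (simp add: T'T)
  also have "\<dots> = T' * (Y * T)" using assoc_mult_mat[OF cT' T(1) c(2)] T(3) by (simp add: Y_def)
  finally have "mtrace (gmat W' g) = mtrace (T' * (Y * T))" by simp
  also have "\<dots> = mtrace (Y * T * T')"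
    by (rule mtrace_commute[OF cT']) (rule mult_carrier_mat[OF Y T(1)])
  also have "Y * T * T' = Y"
    unfolding assoc_mult_mat[OF Y T(1) cT'] T'(1) by (rule right_mult_one_mat[OF Y])
  also have "mtrace Y = chi g * mtrace (gmat W g)"
    using c(1) by (simp add: mtrace_def Y_def sum_distrib_left)
  finally show ?thesis using c m by (simp add: gtrace_def mtrace_def m_def)
qed

subsection \<open>Conjugacy classes of reflections\<close>

lemma reflection_matrix_apply:
  "reflection_matrix \<alpha> *v x = x - (2 * (x \<bullet> \<alpha>) / (\<alpha> \<bullet> \<alpha>)) *\<^sub>R \<alpha>"
proof -
  have "linear (\<lambda>x. x - (2 * (x \<bullet> \<alpha>) / (\<alpha> \<bullet> \<alpha>)) *\<^sub>R \<alpha>)"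
    by (intro linearI) (simp_all add: inner_simps add_divide_distrib algebra_simps)
  thus ?thesis by (simp add: reflection_matrix_def)
qed

lemma conj_reflection:
  fixes g :: "'n::finite rmat"
  assumes g: "orthogonal_matrix g" and "r \<in> reflections"
  shows "g ** r ** matrix_inv g \<in> reflections"
proof -
  obtain \<alpha> where \<alpha>: "\<alpha> \<noteq> 0" "r = reflection_matrix \<alpha>" using assms(2) by (rule reflectionsE)
  have tg: "Finite_Cartesian_Product.transpose g ** g = mat 1" "g ** Finite_Cartesian_Product.transpose g = mat 1"
    using g by (auto simp: orthogonal_matrix_def)
  have adj: "(Finite_Cartesian_Product.transpose g *v x) \<bullet> y = x \<bullet> (g *v y)" for x y
    by (metis dot_lmul_matrix inner_commute transpose_matrix_vector)
  have "g *v \<alpha> \<noteq> 0"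
  proof
    assume "g *v \<alpha> = 0"
    hence "Finite_Cartesian_Product.transpose g *v (g *v \<alpha>) = 0" by simp
    thus False using \<alpha>(1) by (simp add: matrix_vector_mul_assoc tg)
  qed
  have norm: "(g *v \<alpha>) \<bullet> (g *v \<alpha>) = \<alpha> \<bullet> \<alpha>"
    using adj[of "g *v \<alpha>" \<alpha>] by (simp add: matrix_vector_mul_assoc tg)
  have "(g ** r ** matrix_inv g) *v x = reflection_matrix (g *v \<alpha>) *v x" for x
  proof -
    have "(g ** r ** matrix_inv g) *v x = g *v (r *v (Finite_Cartesian_Product.transpose g *v x))"
      by (simp only: matrix_inv_orthogonal[OF g] matrix_vector_mul_assoc matrix_mul_assoc)
    also have "\<dots> = g *v (Finite_Cartesian_Product.transpose g *v x)
        - (2 * (x \<bullet> (g *v \<alpha>)) / (\<alpha> \<bullet> \<alpha>)) *\<^sub>R (g *v \<alpha>)"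
      unfolding \<alpha>(2) reflection_matrix_apply adj
      by (simp only: matrix_vector_mult_diff_distrib matrix_vector_mult_scaleR)
    finally show ?thesis
      by (simp only: matrix_vector_mul_assoc tg matrix_vector_mul_lid reflection_matrix_apply norm)
  qed
  hence "g ** r ** matrix_inv g = reflection_matrix (g *v \<alpha>)" by (simp add: matrix_eq)
  thus ?thesis using \<open>g *v \<alpha> \<noteq> 0\<close> by (auto simp: reflections_def)
qed

context reflection_group
begin

lemma reflection_class_subset:
  assumes "K \<in> reflection_classes G"
  shows "K \<subseteq> G \<inter> reflections"
  using assms by (auto simp: reflection_classes_def conj_reflection orthogonal_G)

lemma reflection_in_class:
  assumes "r \<in> G \<inter> reflections"
  obtains K where "K \<in> reflection_classes G" "r \<in> K"
proof -
  have "r = mat 1 ** r ** matrix_inv (mat 1)" by (simp add: matrix_inv_unique[of "mat 1" "mat 1"])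
  hence "r \<in> {g ** r ** matrix_inv g |g. g \<in> G}" using one_in_G by blast
  thus ?thesis using that assms unfolding reflection_classes_def by blast
qed

end

lemma (in covariants) gtrace_class_const:
  assumes "K \<in> reflection_classes G" "r \<in> K" "s \<in> K"
  shows "gtrace W r = gtrace W s"
  using assms by (auto simp: reflection_classes_def gtrace_conj)

theorem proposition4p3:
  fixes G :: "('n::finite) rmat set"
    and C :: "nat \<Rightarrow> 'n rmat set"
    and chi :: "nat \<Rightarrow> 'n rmat \<Rightarrow> complex"
    and \<sigma> :: "'n \<Rightarrow> 'n cpoly"
    and V :: "nat \<Rightarrow> 'n rmat gmodule"
    and tensor_index :: "nat \<Rightarrow> nat \<Rightarrow> nat"
    and p q :: nat
  assumes "finite_reflection_group G"
    and "bij_betw C {1..q} (reflection_classes G)"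
    and "\<And>i. \<exists>d. homogeneous d (\<sigma> i)"
    and "freely_generates_invariants G \<sigma>"
    and "simple_gmodule_list G p V"
    and "\<And>a. a \<in> {1..q} \<Longrightarrow> reflection_character G q C a (chi a)"
    and "\<And>j a. j \<in> {1..p} \<Longrightarrow> a \<in> {1..q} \<Longrightarrow>
           tensor_index j a \<in> {1..p} \<and>
           gmodule_iso G (V (tensor_index j a)) (twist (V j) (chi a))"
  shows "\<forall>j\<in>{1..p}.
    (\<forall>a\<in>{1..q}. \<forall>s\<in>C a.
       (let L = (\<lambda>t. ln (harm_series G \<sigma> (V j) t / harm_series G \<sigma> (V (tensor_index j a)) t))
        in L field_differentiable (at 1) \<and>
           d_minus (C a) s (V j) = real (card (C a)) + deriv L 1)) \<and>
    (q = 1 \<longrightarrow> (\<forall>s\<in>C 1.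
       (let L = (\<lambda>t. ln (harm_series G \<sigma> (V j) t))
        in L field_differentiable (at 1) \<and>
           d_minus (C 1) s (V j) = 2 * deriv L 1)))"
proof -
  interpret basic_invariants G \<sigma>
    using assms(1,3,4) by unfold_locales
  have module: "is_gmodule G (V j)" and dim_pos: "0 < gdim (V j)" if "j \<in> {1..p}" for j
    using assms(5) that by (auto simp: simple_gmodule_list_def simple_gmodule_def)
  have classes: "C a \<in> reflection_classes G" if "a \<in> {1..q}" for a
    using assms(2) that by (auto simp: bij_betw_def)
  have classes_cover: "\<exists>b\<in>{1..q}. r \<in> C b" if r: "r \<in> G \<inter> reflections" for r
  proof -
    obtain K where "K \<in> reflection_classes G" "r \<in> K" using r by (rule reflection_in_class)
    thus ?thesis using assms(2) by (auto simp: bij_betw_def)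
  qed
  have class_sub: "C a \<subseteq> G \<inter> reflections" if "a \<in> {1..q}" for a
    by (rule reflection_class_subset[OF classes[OF that]])
  have class_sum: "(\<Sum>r\<in>C a. gtrace (V j) r)
      = of_nat (card (C a)) * (of_nat (gdim (V j)) - 2 * of_nat (kernel_dim (char_matrix (gmat (V j) s) (- 1))))"
    if j: "j \<in> {1..p}" and a: "a \<in> {1..q}" and s: "s \<in> C a" for j a s
  proof -
    interpret covariants G \<sigma> "V j" by unfold_locales (rule module[OF j])
    have "(\<Sum>r\<in>C a. gtrace (V j) r) = (\<Sum>r\<in>C a. gtrace (V j) s)"
      using gtrace_class_const[OF classes[OF a] _ s] by (intro sum.cong) auto
    thus ?thesis using gtrace_reflection[of s] class_sub[OF a] s by auto
  qed
  have at_1: "harm_series G \<sigma> (V j) 1 = real (gdim (V j))"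
    "\<exists>D. (harm_series G \<sigma> (V j) has_field_derivative D) (at 1) \<and>
      of_real D = (of_nat (card (G \<inter> reflections)) * of_nat (gdim (V j)) - (\<Sum>s\<in>G \<inter> reflections. gtrace (V j) s)) / 2"
    if j: "j \<in> {1..p}" for j
  proof -
    interpret covariants G \<sigma> "V j" by unfold_locales (rule module[OF j])
    show "harm_series G \<sigma> (V j) 1 = real (gdim (V j))" by (rule harm_series_at_1(1))
    show "\<exists>D. (harm_series G \<sigma> (V j) has_field_derivative D) (at 1) \<and>
      of_real D = (of_nat (card (G \<inter> reflections)) * of_nat (gdim (V j)) - (\<Sum>s\<in>G \<inter> reflections. gtrace (V j) s)) / 2"
      by (rule harm_series_at_1(2))
  qed
  have part1: "L field_differentiable (at 1) \<and> d_minus (C a) s (V j) = real (card (C a)) + deriv L 1"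
    if j: "j \<in> {1..p}" and a: "a \<in> {1..q}" and s: "s \<in> C a"
      and L: "L = (\<lambda>t. ln (harm_series G \<sigma> (V j) t / harm_series G \<sigma> (V (tensor_index j a)) t))" for j a s L
  proof -
    define k where "k = tensor_index j a"
    have k: "k \<in> {1..p}" and iso: "gmodule_iso G (V k) (twist (V j) (chi a))"
      using assms(7)[OF j a] by (auto simp: k_def)
    have dim_k: "gdim (V k) = gdim (V j)" using iso by (simp add: gmodule_iso_def twist_def)
    define m where "m = gdim (V j)"
    define kd where "kd = kernel_dim (char_matrix (gmat (V j) s) (- 1))"
    have m: "m > 0" using dim_pos[OF j] by (simp add: m_def)
    obtain D where D: "(harm_series G \<sigma> (V j) has_field_derivative D) (at 1)"
      "of_real D = (of_nat (card (G \<inter> reflections)) * of_nat m - (\<Sum>s\<in>G \<inter> reflections. gtrace (V j) s)) / 2"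
      using at_1(2)[OF j] by (auto simp: m_def)
    obtain D' where D': "(harm_series G \<sigma> (V k) has_field_derivative D') (at 1)"
      "of_real D' = (of_nat (card (G \<inter> reflections)) * of_nat m - (\<Sum>s\<in>G \<inter> reflections. gtrace (V k) s)) / 2"
      using at_1(2)[OF k] by (auto simp: m_def dim_k)
    have char: "gtrace (V k) r = chi a r * gtrace (V j) r" if "r \<in> G" for r
      by (rule gtrace_iso_twist[OF that module[OF j] module[OF k] iso])
    have rc: "reflection_character G q C a (chi a)" by (rule assms(6)[OF a])
    have "of_real (D - D') = (\<Sum>r\<in>G \<inter> reflections. gtrace (V k) r - gtrace (V j) r) / 2"
      by (simp add: D(2) D'(2) sum_subtractf field_simps)
    \<comment> \<open>the two characters agree at the reflections outside \<open>C a\<close> and are opposite on \<open>C a\<close>\<close>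
    also have "(\<Sum>r\<in>G \<inter> reflections. gtrace (V k) r - gtrace (V j) r) = (\<Sum>r\<in>C a. - 2 * gtrace (V j) r)"
    proof (rule sum.mono_neutral_cong_right)
      show "C a \<subseteq> G \<inter> reflections" by (rule class_sub[OF a])
      show "\<forall>r\<in>G \<inter> reflections - C a. gtrace (V k) r - gtrace (V j) r = 0"
      proof
        fix r assume r: "r \<in> G \<inter> reflections - C a"
        then obtain b where "b \<in> {1..q}" "r \<in> C b" "b \<noteq> a" using classes_cover by blast
        hence "chi a r = 1" using rc by (auto simp: reflection_character_def)
        thus "gtrace (V k) r - gtrace (V j) r = 0" using char[of r] r by simp
      qed
      show "gtrace (V k) r - gtrace (V j) r = - 2 * gtrace (V j) r" if "r \<in> C a" for r
      proof -
        have "chi a r = - 1" using rc that by (auto simp: reflection_character_def)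
        thus ?thesis using char[of r] class_sub[OF a] that by auto
      qed
    qed simp
    also have "\<dots> = - 2 * (\<Sum>r\<in>C a. gtrace (V j) r)" by (simp add: sum_distrib_left)
    also have "\<dots> / 2 = complex_of_real (- (real (card (C a)) * (real m - 2 * real kd)))"
      unfolding class_sum[OF j a s] by (simp add: m_def kd_def)
    finally have diff: "D - D' = - (real (card (C a)) * (real m - 2 * real kd))"
      by (simp only: of_real_eq_iff)
    have "(L has_field_derivative ((D * real m - real m * D') / (real m * real m)) / (real m / real m)) (at 1)"
    proof -
      have "((\<lambda>t. harm_series G \<sigma> (V j) t / harm_series G \<sigma> (V k) t) has_field_derivative
          (D * real m - real m * D') / (real m * real m)) (at 1)"
        using DERIV_divide[OF D(1) D'(1)] m by (simp add: at_1(1)[OF j] at_1(1)[OF k] dim_k m_def)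
      from DERIV_chain'[OF this DERIV_ln_divide]
      show ?thesis
        using m by (simp add: L k_def[symmetric] at_1(1)[OF j] at_1(1)[OF k] dim_k m_def[symmetric])
    qed
    also have "((D * real m - real m * D') / (real m * real m)) / (real m / real m) = (D - D') / real m"
      using m by (simp add: field_simps)
    finally have L': "(L has_field_derivative (D - D') / real m) (at 1)" .
    have "d_minus (C a) s (V j) = real (card (C a)) + (D - D') / real m"
      using m unfolding diff by (simp add: d_minus_def m_def kd_def field_simps)
    thus ?thesis using L' by (auto simp: field_differentiable_def DERIV_imp_deriv[OF L'])
  qed
  have part2: "L field_differentiable (at 1) \<and> d_minus (C 1) s (V j) = 2 * deriv L 1"
    if j: "j \<in> {1..p}" and q: "q = 1" and s: "s \<in> C 1" and L: "L = (\<lambda>t. ln (harm_series G \<sigma> (V j) t))" for j s L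
  proof -
    define m where "m = gdim (V j)"
    define kd where "kd = kernel_dim (char_matrix (gmat (V j) s) (- 1))"
    have m: "m > 0" using dim_pos[OF j] by (simp add: m_def)
    have one: "1 \<in> {1..q}" using q by simp
    have all: "G \<inter> reflections = C 1"
      using class_sub[OF one] classes_cover q by auto
    obtain D where D: "(harm_series G \<sigma> (V j) has_field_derivative D) (at 1)"
      "of_real D = (of_nat (card (C 1)) * of_nat m - (\<Sum>s\<in>C 1. gtrace (V j) s)) / 2"
      using at_1(2)[OF j] by (auto simp: m_def all)
    have "complex_of_real D = of_real (real (card (C 1)) * real kd)"
      unfolding D(2) class_sum[OF j one s] by (simp add: m_def kd_def field_simps)
    hence D_eq: "D = real (card (C 1)) * real kd" by (simp only: of_real_eq_iff)
    have L': "(L has_field_derivative D / real m) (at 1)"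
      using DERIV_chain'[OF D(1) DERIV_ln_divide] m by (simp add: L at_1(1)[OF j] m_def)
    have "d_minus (C 1) s (V j) = 2 * (D / real m)"
      by (simp add: d_minus_def m_def kd_def D_eq)
    thus ?thesis using L' by (auto simp: field_differentiable_def DERIV_imp_deriv[OF L'])
  qed
  show ?thesis
    unfolding Let_def using part1[OF _ _ _ refl] part2[OF _ _ _ refl] by blast
qed

end
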